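(* Let $p$ be a prime number and $n\geq 3$ an integer. Let $F$ be a field such that $F$ contains a primitive $p$-th root of unity if $\mathrm{char}(F)\neq p$, and such that $-1\in F^2$ if $p=2$. Let $G$ be either the absolute Galois group $G_F$ of $F$ or its maximal pro-$p$ quotient $G_F(p)$. Then for every $\chi\in H^1(G,\mathbb{F}_p)$, the $n$-fold Massey product $\langle \chi,\ldots,\chi\rangle$ (with $n$ entries equal to $\chi$) is defined and contains $0$.
   Context: Let $G$ be a profinite group, $\mathbb{F}_p$ the trivial discrete $G$-module, and $\mathcal{C}^\bullet(G,\mathbb{F}_p)$ the standard inhomogeneous continuous cochain complex with differential $\delta$ and cup product $\cup$; $H^i(G,\mathbb{F}_p)$ its cohomology. For $\alpha_1,\ldots,\alpha_n\in H^1(G,\mathbb{F}_p)$, a defining system for the $n$-fold Massey product $\langle\alpha_1,\ldots,\alpha_n\rangle$ is a collection $M=(a_{ij})$, $1\leq i<j\leq n+1$, $(i,j)\neq(1,n+1)$, of elements of $\mathcal{C}^1(G,\mathbb{F}_p)$ such that $a_{i,i+1}$ represents $\alpha_i$ and $\delta a_{ij}=\sum_{l=i+1}^{j-1}a_{il}\cup a_{lj}$ for $i+1<j$. Then $\sum_{k=2}^{n}a_{1k}\cup a_{k,n+1}$ is a $2$-cocycle, whose class is the value $\langle\alpha_1,\ldots,\alpha_n\rangle_M$. The Massey product $\langle\alpha_1,\ldots,\alpha_n\rangle\subseteq H^2(G,\mathbb{F}_p)$ is the set of all values over all defining systems; it is said to be defined if a defining system exists. *)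

theory Defs
  imports "HOL-Algebra.Algebra" "HOL-Analysis.Analysis"
begin

text \<open>Formal derivative of a polynomial p = [a_n, ..., a_1, a_0]:
  [n a_n, ..., 1 a_1], normalized (leading zeros removed).\<close>
definition poly_deriv :: "('a, 'b) ring_scheme \<Rightarrow> 'a list \<Rightarrow> 'a list" where
  "poly_deriv R p =
     ring.normalize R (map (\<lambda>(a, k). add_pow R (k::nat) a) (zip (butlast p) (rev [1..<length p])))"

definition separable_poly :: "('a, 'b) ring_scheme \<Rightarrow> 'a set \<Rightarrow> 'a list \<Rightarrow> bool" where
  "separable_poly R K f \<longleftrightarrow> f \<in> carrier (K[X]\<^bsub>R\<^esub>) \<and>
     (\<exists>u \<in> carrier (K[X]\<^bsub>R\<^esub>). \<exists>v \<in> carrier (K[X]\<^bsub>R\<^esub>).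
        (u \<otimes>\<^bsub>K[X]\<^bsub>R\<^esub>\<^esub> f) \<oplus>\<^bsub>K[X]\<^bsub>R\<^esub>\<^esub> (v \<otimes>\<^bsub>K[X]\<^bsub>R\<^esub>\<^esub> poly_deriv R f) = \<one>\<^bsub>K[X]\<^bsub>R\<^esub>\<^esub>)"

definition separable_elem :: "('a, 'b) ring_scheme \<Rightarrow> 'a set \<Rightarrow> 'a \<Rightarrow> bool" where
  "separable_elem R K x \<longleftrightarrow> ring.algebraic R K x \<and> separable_poly R K (ring.Irr R K x)"

definition separably_closed :: "('a, 'b) ring_scheme \<Rightarrow> bool" where
  "separably_closed R \<longleftrightarrow>
     (\<forall>f. separable_poly R (carrier R) f \<and> Polynomials.degree f \<ge> 1 \<longrightarrow>
          (\<exists>x \<in> carrier R. ring.eval R f x = \<zero>\<^bsub>R\<^esub>))"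

definition separable_closure_of :: "('a, 'b) ring_scheme \<Rightarrow> 'a set \<Rightarrow> bool" where
  "separable_closure_of \<Omega> K \<longleftrightarrow> field \<Omega> \<and> subfield K \<Omega> \<and>
     (\<forall>x \<in> carrier \<Omega>. separable_elem \<Omega> K x) \<and> separably_closed \<Omega>"

text \<open>L (inside the separable closure Omega of K) is a finite Galois extension of K
  of degree a power of p: L is an intermediate field, [L:K] = p^m, and L/K is normal
  (every K-conjugate in Omega of an element of L lies in L); separability is automatic
  inside Omega.\<close>
definition galois_p_ext :: "('a, 'b) ring_scheme \<Rightarrow> 'a set \<Rightarrow> nat \<Rightarrow> 'a set \<Rightarrow> bool" where
  "galois_p_ext \<Omega> K p L \<longleftrightarrow> subfield L \<Omega> \<and> K \<subseteq> L \<and>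
     (\<exists>m. ring.dimension \<Omega> (p ^ m) K L) \<and>
     (\<forall>x \<in> L. separable_elem \<Omega> K x) \<and>
     (\<forall>x \<in> L. \<forall>y \<in> carrier \<Omega>. ring.eval \<Omega> (ring.Irr \<Omega> K x) y = \<zero>\<^bsub>\<Omega>\<^esub> \<longrightarrow> y \<in> L)"

text \<open>The maximal pro-p extension K(p) of K inside Omega: compositum (= union, as the
  family is directed) of all finite Galois p-extensions of K in Omega.\<close>
definition max_p_ext :: "('a, 'b) ring_scheme \<Rightarrow> 'a set \<Rightarrow> nat \<Rightarrow> 'a set" where
  "max_p_ext \<Omega> K p = \<Union> {L. galois_p_ext \<Omega> K p L}"

definition gal :: "('a, 'b) ring_scheme \<Rightarrow> 'a set \<Rightarrow> ('a \<Rightarrow> 'a) monoid" where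
  "gal E K = \<lparr> carrier = {\<sigma>. \<sigma> \<in> ring_iso E E \<and> (\<forall>x \<in> K. \<sigma> x = x) \<and> \<sigma> \<in> extensional (carrier E)},
              monoid.mult = (\<lambda>\<sigma> \<tau>. compose (carrier E) \<sigma> \<tau>),
              monoid.one = restrict id (carrier E) \<rparr>"

text \<open>Krull topology on Gal(E/K): the topology of pointwise convergence, i.e. the
  subspace topology of the product of discrete copies of E.  (Basic open neighbourhoods
  of sigma: the automorphisms agreeing with sigma on a finite set, equivalently on a
  finite subextension.)\<close>
definition krull_topology :: "('a, 'b) ring_scheme \<Rightarrow> 'a set \<Rightarrow> ('a \<Rightarrow> 'a) topology" where
  "krull_topology E K =
     subtopology (product_topology (\<lambda>_. discrete_topology (carrier E)) (carrier E)) (carrier (gal E K))"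

text \<open>F_p is represented by {0..<p} \<subseteq> int, with all identities read modulo p.
  A continuous 1-cochain G \<rightarrow> F_p (F_p discrete).\<close>
definition cochain1 :: "nat \<Rightarrow> 'g topology \<Rightarrow> ('g \<Rightarrow> int) \<Rightarrow> bool" where
  "cochain1 p T a \<longleftrightarrow> continuous_map T (discrete_topology {0..<int p}) a"

definition delta1 :: "('g \<Rightarrow> 'g \<Rightarrow> 'g) \<Rightarrow> ('g \<Rightarrow> int) \<Rightarrow> 'g \<Rightarrow> 'g \<Rightarrow> int" where
  "delta1 m a s t = a t - a (m s t) + a s"

definition cup11 :: "('g \<Rightarrow> int) \<Rightarrow> ('g \<Rightarrow> int) \<Rightarrow> 'g \<Rightarrow> 'g \<Rightarrow> int" where
  "cup11 a b s t = a s * b t"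

text \<open>Elements of H^1(G,F_p): continuous 1-cocycles (B^1 = 0 for the trivial module).\<close>
definition H1_elem :: "nat \<Rightarrow> 'g monoid \<Rightarrow> 'g topology \<Rightarrow> ('g \<Rightarrow> int) \<Rightarrow> bool" where
  "H1_elem p G T chi \<longleftrightarrow> cochain1 p T chi \<and>
     (\<forall>s \<in> carrier G. \<forall>t \<in> carrier G. delta1 (monoid.mult G) chi s t mod int p = 0)"

definition defining_system ::
  "nat \<Rightarrow> 'g monoid \<Rightarrow> 'g topology \<Rightarrow> nat \<Rightarrow> (nat \<Rightarrow> 'g \<Rightarrow> int) \<Rightarrow> (nat \<Rightarrow> nat \<Rightarrow> 'g \<Rightarrow> int) \<Rightarrow> bool" where
  "defining_system p G T n \<alpha> a \<longleftrightarrow>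
     (\<forall>i j. 1 \<le> i \<and> i < j \<and> j \<le> n + 1 \<and> (i, j) \<noteq> (1, n + 1) \<longrightarrow>
        cochain1 p T (a i j) \<and>
        (j = i + 1 \<longrightarrow> (\<forall>s \<in> carrier G. a i j s = \<alpha> i s)) \<and>
        (i + 1 < j \<longrightarrow> (\<forall>s \<in> carrier G. \<forall>t \<in> carrier G.
            (delta1 (monoid.mult G) (a i j) s t - (\<Sum>l = i + 1..j - 1. cup11 (a i l) (a l j) s t)) mod int p = 0)))"

definition massey_value_zero ::
  "nat \<Rightarrow> 'g monoid \<Rightarrow> 'g topology \<Rightarrow> nat \<Rightarrow> (nat \<Rightarrow> nat \<Rightarrow> 'g \<Rightarrow> int) \<Rightarrow> bool" where
  "massey_value_zero p G T n a \<longleftrightarrow>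
     (\<exists>b. cochain1 p T b \<and>
        (\<forall>s \<in> carrier G. \<forall>t \<in> carrier G.
           ((\<Sum>k = 2..n. cup11 (a 1 k) (a k (n + 1)) s t) - delta1 (monoid.mult G) b s t) mod int p = 0))"

definition massey_contains_zero ::
  "nat \<Rightarrow> 'g monoid \<Rightarrow> 'g topology \<Rightarrow> nat \<Rightarrow> (nat \<Rightarrow> 'g \<Rightarrow> int) \<Rightarrow> bool" where
  "massey_contains_zero p G T n \<alpha> \<longleftrightarrow>
     (\<exists>a. defining_system p G T n \<alpha> a \<and> massey_value_zero p G T n a)"

end

theory Submission
  imports Defs "HOL-Number_Theory.Cong"
begin

text \<open>Lift \<open>- chi\<close> to a homomorphism into the unipotent group of size \<open>n + 1\<close> over \<open>\<int>/p\<close> with a constant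
  superdiagonal: the negatives of its entries form a defining system, and the corner entry kills its value.

  If the characteristic is not \<open>p\<close>, Kummer theory attaches \<open>a \<in> K\<close> to \<open>chi\<close>. The Galois group permutes the
  \<open>p ^ m\<close>-th roots of \<open>a\<close> by affine maps \<open>x \<mapsto> b + u x\<close> of \<open>\<int>/p ^ m\<close>, which act on \<open>\<int>/p [T]/(T ^ (n + 1))\<close> by
  \<open>f(T) \<mapsto> (1 + T) ^ b f((1 + T) ^ u - 1)\<close>. This is unipotent with superdiagonal \<open>b\<close> because \<open>u\<close> is \<open>1\<close>
  modulo \<open>p\<close>, and modulo \<open>4\<close> if \<open>p = 2\<close> since \<open>-1\<close> is a square in \<open>K\<close>.
  In characteristic \<open>p\<close>, take \<open>f \<in> 1 + T \<Omega>[[T]]\<close> with \<open>Frob f = (1 + a T) f\<close>, where \<open>a\<close> is the Artin-Schreier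
  constant of \<open>chi\<close>; then \<open>s f / f\<close> has coefficients in the prime field for all \<open>s\<close>.

  Both representations factor through a tower of extensions of degree \<open>1\<close> or \<open>p\<close>, hence through the Galois
  group of the maximal \<open>p\<close>-extension.\<close>

section \<open>Separable polynomials\<close>

text \<open>The negatives are forced by signs: for a unipotent homomorphism the coboundary of an
  entry above the diagonal is minus the sum of the intermediate products, whereas a defining system
  asks for plus that sum. Negation repairs this and turns the superdiagonal \<open>- chi\<close>
  into \<open>chi\<close>. If all \<open>p ^ m\<close>-th roots of unity lay in \<open>K\<close>,
  multiplication by \<open>(1 + T) ^ b\<close> would already be a homomorphism. In general
  \<open>b\<close> is a cocycle twisted by the cyclotomic character \<open>u\<close>, and the
  substitution absorbs the twist. Its price is a term with \<open>u choose 2\<close> on the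
  superdiagonal: for odd \<open>p\<close> it vanishes modulo \<open>p\<close> as soon as
  \<open>u\<close> is \<open>1\<close> modulo \<open>p\<close>, for \<open>p = 2\<close> the
  congruence modulo \<open>4\<close> is what kills it. Any \<open>m\<close> with
  \<open>n < p ^ m\<close> makes \<open>(1 + T) ^ (p ^ m)\<close> trivial modulo \<open>p\<close>
  and \<open>T ^ (n + 1)\<close>; the proof takes \<open>m = n + 1\<close>. In characteristic
  \<open>p\<close> no twist arises: every automorphism fixes the prime field, so
  \<open>s f / f\<close> is multiplicative in \<open>s\<close>.\<close>

abbreviation (in ring) poly_mult_op (infixl "\<otimes>\<^sub>P" 70) where "f \<otimes>\<^sub>P g \<equiv> f \<otimes>\<^bsub>poly_ring R\<^esub> g"

abbreviation (in ring) poly_add_op (infixl "\<oplus>\<^sub>P" 65) where "f \<oplus>\<^sub>P g \<equiv> f \<oplus>\<^bsub>poly_ring R\<^esub> g"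

abbreviation (in ring) natr :: "nat \<Rightarrow> 'a" where "natr k \<equiv> add_pow R k \<one>"

lemma (in domain) poly_cring: "cring (poly_ring R)"
  by (rule univ_poly_is_cring[OF carrier_is_subring])

lemma (in ring) poly_ring_set: "f \<in> carrier (poly_ring R) \<Longrightarrow> set f \<subseteq> carrier R"
  using polynomial_in_carrier[OF carrier_is_subring] univ_poly_carrier by blast

lemma (in field) inverse_nonzero:
  assumes "x \<in> carrier R" "x \<noteq> \<zero>"
  shows "inv x \<in> carrier R" "inv x \<otimes> x = \<one>" "x \<otimes> inv x = \<one>" "inv x \<noteq> \<zero>"
proof -
  have u: "x \<in> Units R" using assms field_Units by auto
  show "inv x \<in> carrier R" "inv x \<otimes> x = \<one>" "x \<otimes> inv x = \<one>"
    using Units_inv_closed[OF u] Units_l_inv[OF u] Units_r_inv[OF u] by auto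
  then show "inv x \<noteq> \<zero>" using assms by auto
qed

lemma (in ring) coeff_Cons: "coeff (a # p) i = (if i = length p then a else coeff p i)"
  by simp

text \<open>Coefficients are listed from the highest degree down, so the reversed range pairs each
  entry of \<open>q\<close> with the exponent it had before the constant term was dropped.\<close>

lemma (in ring) coeff_zip_deriv:
  "length q = n \<Longrightarrow> coeff (map (\<lambda>(a, k). add_pow R (k::nat) a) (zip q (rev [1..<Suc n]))) i
    = (if i < n then add_pow R (Suc i) (coeff q i) else \<zero>)"
proof (induction q arbitrary: n i)
  case Nil then show ?case by simp
next
  case (Cons a q)
  then obtain m where m: "n = Suc m" "length q = m" by auto
  have "rev [1..<Suc n] = n # rev [1..<Suc m]" using m by simp
  then show ?case using Cons.IH[OF m(2)] m by (auto simp del: upt_Suc)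
qed

lemma (in ring) coeff_butlast: "coeff (butlast p) i = coeff p (Suc i)"
  by (induction p) auto

lemma (in ring) coeff_poly_deriv: "coeff (poly_deriv R p) i = add_pow R (Suc i) (coeff p (Suc i))"
proof (cases "p = []")
  case True then show ?thesis by (simp add: poly_deriv_def)
next
  case False
  have l: "length (butlast p) = length p - 1" "length p = Suc (length p - 1)" using False by auto
  have "coeff (poly_deriv R p) i = (if i < length p - 1 then add_pow R (Suc i) (coeff (butlast p) i) else \<zero>)"
    unfolding poly_deriv_def normalize_coeff[symmetric]
    using coeff_zip_deriv[OF l(1), of i] l(2) by metis
  also have "\<dots> = add_pow R (Suc i) (coeff p (Suc i))"
    using coeff_length[of p "Suc i"] by (auto simp: coeff_butlast)
  finally show ?thesis .
qed

lemma (in ring) poly_deriv_polynomial: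
  assumes "set p \<subseteq> carrier R" shows "poly_deriv R p \<in> carrier (poly_ring R)"
proof -
  have "set (map (\<lambda>(a, k). add_pow R (k::nat) a) (zip (butlast p) (rev [1..<length p]))) \<subseteq> carrier R"
    using assms by (auto dest!: set_zip_leftD in_set_butlastD)
  then show ?thesis unfolding poly_deriv_def univ_poly_carrier[symmetric]
    by (rule normalize_gives_polynomial)
qed

lemma (in field) coeff_linear_mult:
  assumes "d \<in> carrier R" "e \<in> carrier R" "g \<in> carrier (poly_ring R)"
  shows "coeff ([e, d] \<otimes>\<^sub>P g) i = (if i = 0 then \<zero> else e \<otimes> coeff g (i - 1)) \<oplus> d \<otimes> coeff g i"
proof -
  have g: "set g \<subseteq> carrier R" using poly_ring_set assms(3) .
  have s1: "set (map (\<lambda>b. d \<otimes> b) g) \<subseteq> carrier R" "set (map (\<lambda>b. e \<otimes> b) g @ [\<zero>]) \<subseteq> carrier R"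
    using g assms by auto
  have s2: "set (poly_add (map (\<lambda>b. d \<otimes> b) g) []) \<subseteq> carrier R"
    using poly_add_in_carrier[OF s1(1), of "[]"] by simp
  have "[e, d] \<otimes>\<^sub>P g
      = poly_add (map (\<lambda>b. e \<otimes> b) g @ [\<zero>]) (poly_add (map (\<lambda>b. d \<otimes> b) g) [])"
    by (simp add: univ_poly_mult del: poly_add.simps)
  then have "coeff ([e, d] \<otimes>\<^sub>P g) i
     = coeff (map (\<lambda>b. e \<otimes> b) g @ [\<zero>]) i \<oplus> (coeff (map (\<lambda>b. d \<otimes> b) g) i \<oplus> coeff [] i)"
    using poly_add_coeff[OF s1(2) s2] poly_add_coeff[OF s1(1), of "[]"] by simp
  then show ?thesis
    using g assms by (simp add: append_coeff scalar_coeff del: coeff.simps(2)) (simp add: scalar_coeff)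
qed

lemma (in field) coeff_const_mult:
  assumes "d \<in> carrier R" "g \<in> carrier (poly_ring R)"
  shows "coeff ([d] \<otimes>\<^sub>P g) i = d \<otimes> coeff g i"
proof -
  have g: "set g \<subseteq> carrier R" using poly_ring_set assms(2) .
  have s: "set (map (\<lambda>b. d \<otimes> b) g) \<subseteq> carrier R" using g assms by auto
  have "[d] \<otimes>\<^sub>P g = poly_add (map (\<lambda>b. d \<otimes> b) g) []"
    by (simp add: univ_poly_mult del: poly_add.simps)
  then show ?thesis
    using poly_add_coeff[OF s, of "[]"] g assms by (simp add: scalar_coeff)
qed

text \<open>This instance of the product rule drives \<open>separable_factor\<close>, where roots
  are split off one at a time.\<close>

lemma (in field) deriv_linear_mult:
  assumes x: "x \<in> carrier R" and g: "g \<in> carrier (poly_ring R)"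
  shows "poly_deriv R ([\<one>, \<ominus> x] \<otimes>\<^sub>P g)
    = g \<oplus>\<^sub>P ([\<one>, \<ominus> x] \<otimes>\<^sub>P poly_deriv R g)"
proof -
  interpret P: cring "poly_ring R" by (rule poly_cring)
  have lx: "[\<one>, \<ominus> x] \<in> carrier (poly_ring R)"
    using x unfolding univ_poly_carrier[symmetric] polynomial_def by auto
  have g': "poly_deriv R g \<in> carrier (poly_ring R)"
    by (rule poly_deriv_polynomial[OF poly_ring_set[OF g]])
  have l: "poly_deriv R ([\<one>, \<ominus> x] \<otimes>\<^sub>P g) \<in> carrier (poly_ring R)"
    by (intro poly_deriv_polynomial poly_ring_set P.m_closed lx g)
  have r: "g \<oplus>\<^sub>P ([\<one>, \<ominus> x] \<otimes>\<^sub>P poly_deriv R g) \<in> carrier (poly_ring R)"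
    by (intro P.a_closed P.m_closed lx g g')
  have c: "coeff g k \<in> carrier R" for k using poly_ring_set[OF g] by simp
  have "coeff (poly_deriv R ([\<one>, \<ominus> x] \<otimes>\<^sub>P g)) k
     = coeff (g \<oplus>\<^sub>P ([\<one>, \<ominus> x] \<otimes>\<^sub>P poly_deriv R g)) k" for k
  proof -
    have eq: "add_pow R (Suc k) (coeff g k \<oplus> \<ominus> x \<otimes> coeff g (Suc k)) =
       coeff g k \<oplus> ((if k = 0 then \<zero> else add_pow R k (coeff g k)) \<oplus> \<ominus> x \<otimes> add_pow R (Suc k) (coeff g (Suc k)))"
    proof -
      have "add_pow R (Suc k) (coeff g k \<oplus> \<ominus> x \<otimes> coeff g (Suc k)) =
        add_pow R (Suc k) (coeff g k) \<oplus> add_pow R (Suc k) (\<ominus> x \<otimes> coeff g (Suc k))"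
        by (rule add.nat_pow_distrib) (use c x in auto)
      also have "add_pow R (Suc k) (\<ominus> x \<otimes> coeff g (Suc k)) = \<ominus> x \<otimes> add_pow R (Suc k) (coeff g (Suc k))"
        by (rule add_pow_rdistr[symmetric]) (use c x in auto)
      also have "add_pow R (Suc k) (coeff g k) = coeff g k \<oplus> add_pow R k (coeff g k)"
        using c by (simp add: add.m_comm)
      finally show ?thesis using c x by (cases "k = 0") (auto simp: a_assoc)
    qed
    have "coeff (g \<oplus>\<^sub>P ([\<one>, \<ominus> x] \<otimes>\<^sub>P poly_deriv R g)) k
       = coeff g k \<oplus> coeff ([\<one>, \<ominus> x] \<otimes>\<^sub>P poly_deriv R g) k"
      using poly_add_coeff[OF poly_ring_set[OF g] poly_ring_set[OF P.m_closed[OF lx g']]]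
      by (simp add: univ_poly_add del: poly_add.simps)
    then show ?thesis
      using eq unfolding coeff_poly_deriv coeff_linear_mult[OF a_inv_closed[OF x] one_closed g]
        coeff_linear_mult[OF a_inv_closed[OF x] one_closed g']
      using c by (cases k) (simp_all add: coeff_poly_deriv del: add.nat_pow_Suc)
  qed
  then show ?thesis
    using coeff_iff_polynomial_cond[of "carrier R"] l r univ_poly_carrier by blast
qed

text \<open>With \<open>l = X - x\<close> and \<open>f = l g\<close> the product rule gives
  \<open>f' = g + l g'\<close>, so \<open>u f + v f' = 1\<close> regroups to
  \<open>(u l + v) g + (v l) g' = 1\<close>. If \<open>g\<close> vanished at \<open>x\<close>, so
  would \<open>f\<close> and \<open>f'\<close>, and evaluating the identity there would give
  \<open>0 = 1\<close>.\<close>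

lemma (in field) separable_factor:
  assumes x: "x \<in> carrier R" and g: "g \<in> carrier (poly_ring R)"
    and sep: "separable_poly R (carrier R) ([\<one>, \<ominus> x] \<otimes>\<^sub>P g)"
  shows "separable_poly R (carrier R) g" and "eval g x \<noteq> \<zero>"
proof -
  interpret P: cring "poly_ring R" by (rule poly_cring)
  let ?l = "[\<one>, \<ominus> x]" and ?f = "[\<one>, \<ominus> x] \<otimes>\<^sub>P g"
  have lx: "?l \<in> carrier (poly_ring R)"
    using x unfolding univ_poly_carrier[symmetric] polynomial_def by auto
  have g': "poly_deriv R g \<in> carrier (poly_ring R)"
    by (rule poly_deriv_polynomial[OF poly_ring_set[OF g]])
  obtain u v where u: "u \<in> carrier (poly_ring R)" and v: "v \<in> carrier (poly_ring R)"
    and uv: "(u \<otimes>\<^sub>P ?f) \<oplus>\<^sub>P (v \<otimes>\<^sub>P poly_deriv R ?f) = \<one>\<^bsub>poly_ring R\<^esub>"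
    using sep unfolding separable_poly_def by blast
  note d = deriv_linear_mult[OF x g]
  have "((u \<otimes>\<^sub>P ?l \<oplus>\<^sub>P v) \<otimes>\<^sub>P g)
     \<oplus>\<^sub>P ((v \<otimes>\<^sub>P ?l) \<otimes>\<^sub>P poly_deriv R g) = \<one>\<^bsub>poly_ring R\<^esub>"
    unfolding uv[symmetric] d using u v lx g g' by algebra
  then show "separable_poly R (carrier R) g"
    unfolding separable_poly_def using u v lx g by blast
  show "eval g x \<noteq> \<zero>"
  proof
    assume e: "eval g x = \<zero>"
    interpret h: ring_hom_cring "poly_ring R" R "\<lambda>q. eval q x" by (rule eval_cring_hom[OF carrier_is_subring x])
    have el: "eval ?l x = \<zero>" using x by (auto, algebra)
    have "eval ((u \<otimes>\<^sub>P ?f) \<oplus>\<^sub>P (v \<otimes>\<^sub>P poly_deriv R ?f)) x = \<zero>"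
      unfolding d using u v lx g g' e el by (simp add: h.hom_closed del: eval.simps)
    then show False unfolding uv using h.hom_one by simp
  qed
qed

lemma (in field) separable_poly_not_zero: "\<not> separable_poly R (carrier R) []"
proof
  assume "separable_poly R (carrier R) []"
  then obtain u v where u: "u \<in> carrier (poly_ring R)" and v: "v \<in> carrier (poly_ring R)"
    and uv: "(u \<otimes>\<^sub>P []) \<oplus>\<^sub>P (v \<otimes>\<^sub>P poly_deriv R []) = \<one>\<^bsub>poly_ring R\<^esub>"
    unfolding separable_poly_def by blast
  interpret P: cring "poly_ring R" by (rule poly_cring)
  have "poly_deriv R [] = \<zero>\<^bsub>poly_ring R\<^esub>" "[] = \<zero>\<^bsub>poly_ring R\<^esub>"
    by (simp_all add: poly_deriv_def univ_poly_zero)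
  then have "\<zero>\<^bsub>poly_ring R\<^esub> = \<one>\<^bsub>poly_ring R\<^esub>"
    using uv u v P.r_null P.r_zero P.zero_closed by metis
  then show False by (simp add: univ_poly_zero univ_poly_one)
qed

text \<open>A root exists because the field is separably closed. By \<open>separable_factor\<close>
  the cofactor is again separable and does not vanish at that root, so the induction also yields
  multiplicity at most one.\<close>

lemma (in field) separable_splits:
  assumes cl: "separably_closed R"
  shows "separable_poly R (carrier R) f \<Longrightarrow> splitted f \<and> (\<forall>x. count (roots f) x \<le> 1)"
proof (induction "length f" arbitrary: f rule: less_induct)
  case less
  have f: "f \<in> carrier (poly_ring R)" using less.prems by (simp add: separable_poly_def)
  have nz: "f \<noteq> []" using less.prems separable_poly_not_zero by auto
  show ?case
  proof (cases "Polynomials.degree f = 0")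
    case True
    then show ?thesis using degree_zero_imp_splitted[OF f] degree_zero_imp_empty_roots[OF f] by simp
  next
    case False
    then obtain x where x: "x \<in> carrier R" "eval f x = \<zero>"
      using cl less.prems unfolding separably_closed_def by (metis One_nat_def Suc_leI neq0_conv)
    then have "[\<one>, \<ominus> x] pdivides f" using is_root_imp_pdivides[OF f] nz by (simp add: is_root_def)
    then obtain g where g: "g \<in> carrier (poly_ring R)" and fg: "f = [\<one>, \<ominus> x] \<otimes>\<^sub>P g"
      unfolding pdivides_def factor_def by blast
    interpret P: cring "poly_ring R" by (rule poly_cring)
    have lx: "[\<one>, \<ominus> x] \<in> carrier (poly_ring R)"
      using x unfolding univ_poly_carrier[symmetric] polynomial_def by auto
    have gn: "g \<noteq> []"
    proof
      assume "g = []"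
      then have "f = []" using P.r_null[OF lx] fg by (simp add: univ_poly_zero)
      with nz show False by simp
    qed
    have sg: "separable_poly R (carrier R) g" "eval g x \<noteq> \<zero>"
      using separable_factor[OF x(1) g] less.prems unfolding fg by auto
    have deg: "Polynomials.degree f = 1 + Polynomials.degree g"
      unfolding fg univ_poly_mult
      by (subst poly_mult_degree_eq[OF carrier_is_subring]) (use lx g gn univ_poly_carrier in auto)
    then have "length g < length f" using gn by (cases g) auto
    then have IH: "splitted g \<and> (\<forall>x. count (roots g) x \<le> 1)" using less.hyps sg(1) by blast
    have rts: "roots f = add_mset x (roots g)"
      unfolding fg by (rule poly_mult_degree_one_monic_imp_same_roots[OF x(1) g gn])
    have "x \<notin># roots g" using roots_mem_iff_is_root[OF g] sg(2) by (simp add: is_root_def)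
    then show ?thesis using IH rts deg by (auto simp: splitted_def not_in_iff)
  qed
qed

text \<open>A Bezout identity over \<open>K\<close> is one over the whole ring: the polynomial
  operations and \<open>poly_deriv\<close> are the same for both.\<close>

lemma (in ring) separable_poly_mono:
  assumes "subring K R" "separable_poly R K f" shows "separable_poly R (carrier R) f"
  using assms(2) carrier_polynomial_shell[OF assms(1)]
  unfolding separable_poly_def univ_poly_mult univ_poly_add univ_poly_one by blast

section \<open>Embeddings into a separable closure\<close>

text \<open>Serves twice: for the domain of the union of a chain of embeddings and for
  \<open>max_p_ext\<close>.\<close>

lemma (in field) directed_union_subfield:
  assumes D: "D \<noteq> {}" and dir: "\<And>x y. x \<in> D \<Longrightarrow> y \<in> D \<Longrightarrow> \<exists>L. subfield L R \<and> L \<subseteq> D \<and> x \<in> L \<and> y \<in> L"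
  shows "subfield D R"
proof (rule subfieldI')
  show "subring D R"
  proof (rule subringI)
    show "D \<subseteq> carrier R" using dir subfieldE(3) by blast
    obtain x where "x \<in> D" using D by blast
    then obtain L where "subfield L R" "L \<subseteq> D" using dir by blast
    then show "\<one> \<in> D" using subringE(3)[OF subfieldE(1)] by blast
  next
    fix h assume "h \<in> D"
    then obtain L where L: "subfield L R" "L \<subseteq> D" "h \<in> L" using dir by blast
    then show "\<ominus> h \<in> D" using subringE(5)[OF subfieldE(1)[OF L(1)]] by blast
  next
    fix h1 h2 assume "h1 \<in> D" "h2 \<in> D"
    then obtain L where L: "subfield L R" "L \<subseteq> D" "h1 \<in> L" "h2 \<in> L" using dir by blast
    then show "h1 \<otimes> h2 \<in> D" "h1 \<oplus> h2 \<in> D" using subringE(6,7)[OF subfieldE(1)[OF L(1)]] by blast+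
  qed
  fix k assume k: "k \<in> D - {\<zero>}"
  then obtain L where L: "subfield L R" "L \<subseteq> D" "k \<in> L" using dir[of k k] by blast
  then show "inv k \<in> D" using subfield_m_inv(1)[OF L(1), of k] k by blast
qed

locale separable_closure = field R for R (structure) +
  fixes K
  assumes separable_closure: "separable_closure_of R K"
begin

lemma K_subfield: "subfield K R"
  and separable: "x \<in> carrier R \<Longrightarrow> separable_elem R K x"
  and closed: "separably_closed R"
  using separable_closure by (auto simp: separable_closure_of_def)

lemmas K_subring = subfieldE(1)[OF K_subfield] and K_carrier = subfieldE(3)[OF K_subfield]

lemma alg: "K \<subseteq> D \<Longrightarrow> x \<in> carrier R \<Longrightarrow> (algebraic over D) x"
  using separable algebraic_mono by (auto simp: separable_elem_def over_def)

text \<open>Only the values of \<open>t\<close> on \<open>D\<close> carry information. Outside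
  \<open>D\<close> they are arbitrary, which is why extension of embeddings is later expressed by
  inclusion of \<open>graph\<close>.\<close>

definition emb :: "'a set \<Rightarrow> ('a \<Rightarrow> 'a) \<Rightarrow> bool" where
  "emb D t \<longleftrightarrow> subfield D R \<and> K \<subseteq> D \<and> t \<in> ring_hom (R\<lparr>carrier := D\<rparr>) R \<and> (\<forall>k\<in>K. t k = k)"

lemma emb_ring_hom_ring: "emb D t \<Longrightarrow> ring_hom_ring (R\<lparr>carrier := D\<rparr>) R t"
  unfolding emb_def by (intro ring_hom_ringI2 ring_axioms subring_is_ring subfieldE(1)) auto

lemma emb_subring: "emb D t \<Longrightarrow> subring D R"
  by (simp add: emb_def subfieldE(1))

lemma emb_id: "subfield D R \<Longrightarrow> K \<subseteq> D \<Longrightarrow> emb D id"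
  unfolding emb_def using subsetD[OF subfieldE(3), of D R] by (auto intro!: ring_hom_memI)

lemma emb_nonzero:
  assumes t: "emb D t" and d: "d \<in> D" "d \<noteq> \<zero>" shows "t d \<noteq> \<zero>"
proof
  assume z: "t d = \<zero>"
  have D: "subfield D R" using t by (simp add: emb_def)
  have h: "t \<in> ring_hom (R\<lparr>carrier := D\<rparr>) R" using t by (simp add: emb_def)
  have i: "inv d \<in> D" "d \<otimes> inv d = \<one>" using subfield_m_inv[OF D, of d] d by auto
  have "\<one> = t (d \<otimes> inv d)" using ring_hom_one[OF h] i(2) by simp
  also have "\<dots> = t d \<otimes> t (inv d)" using ring_hom_mult[OF h, of d "inv d"] i(1) d(1) by simp
  also have "\<dots> = \<zero>" using z ring_hom_closed[OF h, of "inv d"] i by simp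
  finally show False by simp
qed

lemma emb_inj: assumes t: "emb D t" shows "inj_on t D"
proof (rule inj_onI)
  fix a b assume a: "a \<in> D" "b \<in> D" "t a = t b"
  have D: "subfield D R" using t by (simp add: emb_def)
  have ac: "a \<in> carrier R" "b \<in> carrier R" using a subfieldE(3)[OF D] by auto
  interpret h: ring_hom_ring "R\<lparr>carrier := D\<rparr>" R t by (rule emb_ring_hom_ring[OF t])
  have m: "a \<ominus> b \<in> D" using a subringE(5,7)[OF subfieldE(1)[OF D]] by (simp add: a_minus_def)
  have "t ((a \<ominus> b) \<oplus> b) = t (a \<ominus> b) \<oplus> t b" using h.hom_add[of "a \<ominus> b" b] m a by simp
  then have "t a = t (a \<ominus> b) \<oplus> t a" using ac a by (simp add: a_minus_def a_assoc l_neg)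
  then have "t (a \<ominus> b) = \<zero>" using h.hom_closed[of a] h.hom_closed[of "a \<ominus> b"] m a
    by (metis add.r_cancel_one' partial_object.select_convs(1) partial_object.surjective partial_object.update_convs(1))
  then have "a \<ominus> b = \<zero>" using emb_nonzero[OF t m] by blast
  then show "a = b" using ac r_right_minus_eq by blast
qed

lemma poly_set: "subfield D R \<Longrightarrow> p \<in> carrier (D[X]) \<Longrightarrow> set p \<subseteq> D"
  using polynomial_incl univ_poly_carrier by blast

lemma emb_map_poly:
  assumes t: "emb D t" and p: "p \<in> carrier (D[X])" shows "map t p \<in> carrier (poly_ring R)"
proof (cases p)
  case Nil then show ?thesis by (simp add: univ_poly_zero_closed)
next
  case (Cons a q)
  have D: "subfield D R" using t by (simp add: emb_def)
  have a: "a \<in> D" "a \<noteq> \<zero>" using p Cons unfolding univ_poly_carrier[symmetric] polynomial_def by auto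
  have "t ` D \<subseteq> carrier R" using t ring_hom_closed[of t "R\<lparr>carrier := D\<rparr>" R] by (auto simp: emb_def)
  then show ?thesis using poly_set[OF D p] emb_nonzero[OF t a] Cons
    unfolding univ_poly_carrier[symmetric] polynomial_def by auto
qed

text \<open>For a general homomorphism the image of a polynomial has to be normalized. An embedding
  kills no leading coefficient, so normalizing changes nothing.\<close>

lemma emb_map_hom:
  assumes t: "emb D t" and p: "p \<in> carrier (D[X])" and q: "q \<in> carrier (D[X])"
  shows "map t (p \<otimes>\<^bsub>D[X]\<^esub> q) = map t p \<otimes>\<^sub>P map t q" "map t (p \<oplus>\<^bsub>D[X]\<^esub> q) = map t p \<oplus>\<^sub>P map t q"
proof -
  have D: "subfield D R" using t by (simp add: emb_def)
  note sr = subfieldE(1)[OF D]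
  interpret h: ring_hom_ring "R\<lparr>carrier := D\<rparr>" R t by (rule emb_ring_hom_ring[OF t])
  interpret P: ring "D[X]" by (rule univ_poly_is_ring[OF sr])
  have n: "normalize (map t f) = map t f" if "f \<in> carrier (D[X])" for f
    using emb_map_poly[OF t that] univ_poly_carrier normalize_polynomial by blast
  have pq: "set p \<subseteq> carrier (R\<lparr>carrier := D\<rparr>)" "set q \<subseteq> carrier (R\<lparr>carrier := D\<rparr>)"
    using poly_set[OF D p] poly_set[OF D q] by auto
  show "map t (p \<otimes>\<^bsub>D[X]\<^esub> q) = map t p \<otimes>\<^sub>P map t q"
    using h.poly_mult_hom'[OF pq] n[OF P.m_closed[OF p q]] by (simp add: univ_poly_mult poly_mult_consistent[OF sr])
  show "map t (p \<oplus>\<^bsub>D[X]\<^esub> q) = map t p \<oplus>\<^sub>P map t q"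
    using h.poly_add_hom'[OF pq] n[OF P.a_closed[OF p q]]
    by (simp add: univ_poly_add poly_add_consistent[OF sr] del: poly_add.simps)
qed

text \<open>\<open>Irr D x\<close> divides \<open>Irr K x\<close>, whose coefficients
  \<open>t\<close> fixes, so the transported polynomial still divides \<open>Irr K x\<close>. The
  latter is separable, hence splits with simple roots, and both properties pass to divisors.\<close>

lemma emb_conjugates:
  assumes t: "emb D t" and x: "x \<in> carrier R"
  shows "finite {y \<in> carrier R. eval (map t (Irr D x)) y = \<zero>}"
    and "card {y \<in> carrier R. eval (map t (Irr D x)) y = \<zero>} = Polynomials.degree (Irr D x)"
proof -
  have D: "subfield D R" and KD: "K \<subseteq> D" using t by (auto simp: emb_def)
  note Ix = IrrE[OF D x alg[OF KD x]] and IK = IrrE[OF K_subfield x alg[OF subset_refl x]]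
  let ?F = "Irr K x" and ?f = "map t (Irr D x)"
  have sF: "separable_poly R (carrier R) ?F"
    using separable[OF x] separable_poly_mono[OF K_subring] by (auto simp: separable_elem_def)
  then have sp: "splitted ?F" "\<And>x. count (roots ?F) x \<le> 1"
    using separable_splits[OF closed] by auto
  have FD: "?F \<in> carrier (D[X])" using IK(1) KD unfolding univ_poly_carrier[symmetric] polynomial_def by auto
  have "Irr D x pdivides ?F" by (rule Irr_minimal[OF D x alg[OF KD x] FD IK(4)])
  then obtain q where q: "q \<in> carrier (D[X])" "?F = Irr D x \<otimes>\<^bsub>D[X]\<^esub> q"
    using pdivides_iff_shell[OF D Ix(1) FD] by (auto simp: factor_def)
  have "map t ?F = ?F" using poly_set[OF K_subfield IK(1)] t by (intro map_idI) (auto simp: emb_def)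
  then have F: "?F = ?f \<otimes>\<^sub>P map t q" using emb_map_hom(1)[OF t Ix(1) q(1)] q(2) by simp
  have fc: "?f \<in> carrier (poly_ring R)" and qc: "map t q \<in> carrier (poly_ring R)"
    using emb_map_poly[OF t] Ix(1) q(1) by auto
  have Fc: "?F \<in> carrier (poly_ring R)" using sF by (simp add: separable_poly_def)
  have Fn: "?F \<noteq> []" using sF separable_poly_not_zero by auto
  have fn: "?f \<noteq> []" using pirreducibleE(1)[OF subfieldE(1)[OF D] Ix(1,2)] by simp
  have dv: "?f pdivides ?F" unfolding pdivides_def factor_def using F qc by blast
  have spf: "splitted ?f" by (rule pdivides_imp_splitted[OF fc Fc Fn sp(1) dv])
  have inc: "roots ?f \<subseteq># roots ?F" by (rule pdivides_imp_roots_incl[OF fc Fc Fn dv])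
  have cnt: "count (roots ?f) y = (if y \<in># roots ?f then 1 else 0)" for y
    using mset_subset_eq_count[OF inc, of y] sp(2)[of y]
    by (metis count_greater_zero_iff le_antisym le_trans not_in_iff One_nat_def Suc_leI)
  have "roots ?f = mset_set (set_mset (roots ?f))"
    by (rule multiset_eqI) (use cnt in \<open>simp add: count_mset_set'\<close>)
  then have "card (set_mset (roots ?f)) = size (roots ?f)" by (metis size_mset_set)
  moreover have "set_mset (roots ?f) = {y \<in> carrier R. eval ?f y = \<zero>}"
    using roots_mem_iff_is_root[OF fc] fn by (auto simp: is_root_def)
  ultimately show "card {y \<in> carrier R. eval ?f y = \<zero>} = Polynomials.degree (Irr D x)"
    and "finite {y \<in> carrier R. eval ?f y = \<zero>}"
    using spf by (auto simp: splitted_def) (metis finite_set_mset)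
qed

text \<open>The map \<open>p(x) \<mapsto> (t p)(y)\<close> is well defined: a polynomial over
  \<open>D\<close> vanishing at \<open>x\<close> is a multiple of \<open>Irr D x\<close>, whose
  image under \<open>t\<close> vanishes at \<open>y\<close>.\<close>

lemma emb_extend_simple:
  assumes t: "emb D t" and x: "x \<in> carrier R" and y: "y \<in> carrier R" "eval (map t (Irr D x)) y = \<zero>"
  obtains t' where "emb (simple_extension D x) t'" "\<And>d. d \<in> D \<Longrightarrow> t' d = t d" "t' x = y"
proof -
  have D: "subfield D R" and KD: "K \<subseteq> D" using t by (auto simp: emb_def)
  note sr = subfieldE(1)[OF D]
  note Ix = IrrE[OF D x alg[OF KD x]]
  interpret P: ring "D[X]" by (rule univ_poly_is_ring[OF sr])
  interpret Q: ring_hom_cring "poly_ring R" R "\<lambda>p. eval p y" by (rule eval_cring_hom[OF carrier_is_subring y(1)])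
  interpret E: ring_hom_cring "D[X]" R "\<lambda>p. eval p x" by (rule eval_cring_hom[OF sr x])
  define \<phi> where "\<phi> p = eval (map t p) y" for p
  have \<phi>_mult: "\<phi> (p \<otimes>\<^bsub>D[X]\<^esub> q) = \<phi> p \<otimes> \<phi> q" if "p \<in> carrier (D[X])" "q \<in> carrier (D[X])" for p q
    unfolding \<phi>_def emb_map_hom(1)[OF t that] using Q.hom_mult emb_map_poly[OF t] that by blast
  have \<phi>_add: "\<phi> (p \<oplus>\<^bsub>D[X]\<^esub> q) = \<phi> p \<oplus> \<phi> q" if "p \<in> carrier (D[X])" "q \<in> carrier (D[X])" for p q
    unfolding \<phi>_def emb_map_hom(2)[OF t that] using Q.hom_add emb_map_poly[OF t] that by blast
  have \<phi>_cl: "\<phi> p \<in> carrier R" if "p \<in> carrier (D[X])" for p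
    unfolding \<phi>_def using Q.hom_closed emb_map_poly[OF t] that by blast
  have ker: "\<phi> p = \<zero>" if p: "p \<in> carrier (D[X])" "eval p x = \<zero>" for p
  proof -
    have "Irr D x pdivides p" by (rule Irr_minimal[OF D x alg[OF KD x] p])
    then obtain q where q: "q \<in> carrier (D[X])" "p = Irr D x \<otimes>\<^bsub>D[X]\<^esub> q"
      using pdivides_iff_shell[OF D Ix(1) p(1)] by (auto simp: factor_def)
    then have "\<phi> p = \<phi> (Irr D x) \<otimes> \<phi> q" using \<phi>_mult[OF Ix(1)] by simp
    then show ?thesis using y(2) \<phi>_cl q(1) by (simp add: \<phi>_def)
  qed
  have wd: "\<phi> p = \<phi> q" if pq: "p \<in> carrier (D[X])" "q \<in> carrier (D[X])" "eval p x = eval q x" for p q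
  proof -
    have mc: "p \<ominus>\<^bsub>D[X]\<^esub> q \<in> carrier (D[X])" using pq by simp
    have "eval (p \<ominus>\<^bsub>D[X]\<^esub> q) x = \<zero>" using pq by (simp add: a_minus_def E.hom_a_inv r_neg)
    then have "\<phi> (p \<ominus>\<^bsub>D[X]\<^esub> q) = \<zero>" by (rule ker[OF mc])
    moreover have "p = (p \<ominus>\<^bsub>D[X]\<^esub> q) \<oplus>\<^bsub>D[X]\<^esub> q" using pq by (simp add: a_minus_def P.a_assoc P.l_neg)
    ultimately show ?thesis using \<phi>_add[OF mc pq(2)] \<phi>_cl[OF pq(2)] by simp
  qed
  define t' where "t' z = \<phi> (SOME p. p \<in> carrier (D[X]) \<and> eval p x = z)" for z
  have t': "t' (eval p x) = \<phi> p" if "p \<in> carrier (D[X])" for p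
  proof -
    have "(SOME q. q \<in> carrier (D[X]) \<and> eval q x = eval p x) \<in> carrier (D[X])
      \<and> eval (SOME q. q \<in> carrier (D[X]) \<and> eval q x = eval p x) x = eval p x"
      by (rule someI[where x=p]) (use that in simp)
    then show ?thesis unfolding t'_def using wd that by blast
  qed
  have S: "simple_extension D x = (\<lambda>p. eval p x) ` carrier (D[X])"
    by (rule simple_extension_as_eval_img[OF subfieldE(3)[OF D] x])
  have Dx: "t' d = t d" if d: "d \<in> D" for d
  proof (cases "d = \<zero>")
    case True
    interpret h: ring_hom_ring "R\<lparr>carrier := D\<rparr>" R t by (rule emb_ring_hom_ring[OF t])
    have "t' (eval [] x) = \<phi> []" by (rule t') (simp add: univ_poly_zero_closed)
    then show ?thesis using True h.hom_zero by (simp add: \<phi>_def)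
  next
    case False
    have dc: "d \<in> carrier R" and td: "t d \<in> carrier R" using d D t ring_hom_closed[of t "R\<lparr>carrier := D\<rparr>" R] subfieldE(3) by (auto simp: emb_def)
    have "[d] \<in> carrier (D[X])" using d False unfolding univ_poly_carrier[symmetric] polynomial_def by auto
    from t'[OF this] show ?thesis using dc td x y(1) by (simp add: \<phi>_def)
  qed
  have one: "\<one> \<in> D" using subringE(3)[OF sr] .
  have X: "X \<in> carrier (D[X])" by (rule var_closed(1)[OF sr])
  interpret h: ring_hom_ring "R\<lparr>carrier := D\<rparr>" R t by (rule emb_ring_hom_ring[OF t])
  have xy: "t' x = y"
    using t'[OF X] eval_var[OF x] h.hom_one h.hom_zero y(1) by (simp add: \<phi>_def var_def)
  let ?S = "R\<lparr>carrier := simple_extension D x\<rparr>"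
  have hom: "t' \<in> ring_hom ?S R"
  proof (rule ring_hom_memI)
    fix z w assume "z \<in> carrier ?S" "w \<in> carrier ?S"
    then obtain p q where p: "p \<in> carrier (D[X])" "z = eval p x" and q: "q \<in> carrier (D[X])" "w = eval q x"
      unfolding S by auto
    show "t' z \<in> carrier R" using t' p \<phi>_cl by simp
    have "t' (eval (p \<otimes>\<^bsub>D[X]\<^esub> q) x) = \<phi> p \<otimes> \<phi> q"
      by (rule trans[OF t'[OF P.m_closed[OF p(1) q(1)]] \<phi>_mult[OF p(1) q(1)]])
    then show "t' (z \<otimes>\<^bsub>?S\<^esub> w) = t' z \<otimes> t' w"
      using p q t' by simp
    have "t' (eval (p \<oplus>\<^bsub>D[X]\<^esub> q) x) = \<phi> p \<oplus> \<phi> q"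
      by (rule trans[OF t'[OF P.a_closed[OF p(1) q(1)]] \<phi>_add[OF p(1) q(1)]])
    then show "t' (z \<oplus>\<^bsub>?S\<^esub> w) = t' z \<oplus> t' w"
      using p q t' by simp
  next
    show "t' \<one>\<^bsub>?S\<^esub> = \<one>" using Dx[OF one] h.hom_one by simp
  qed
  have "emb (simple_extension D x) t'"
    unfolding emb_def
    using simple_extension_is_subfield[OF D x] alg[OF KD x] hom KD Dx t simple_extension_incl[OF subfieldE(3)[OF D] x]
    by (auto simp: emb_def)
  then show ?thesis using that Dx xy by blast
qed

definition graph :: "'a set \<Rightarrow> ('a \<Rightarrow> 'a) \<Rightarrow> ('a \<times> 'a) set" where
  "graph D t = (\<lambda>d. (d, t d)) ` D"

text \<open>Any two elements of the union's domain lie in the domain of one member of the chain, and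
  each condition on a homomorphism involves at most two elements.\<close>

lemma emb_chain_union:
  assumes C: "C \<noteq> {}" and emb: "\<And>g. g \<in> C \<Longrightarrow> \<exists>D t. emb D t \<and> g = graph D t"
    and chain: "\<And>g g'. g \<in> C \<Longrightarrow> g' \<in> C \<Longrightarrow> g \<subseteq> g' \<or> g' \<subseteq> g"
  shows "\<exists>D t. emb D t \<and> \<Union>C = graph D t"
proof -
  define D where "D = fst ` \<Union>C"
  define t where "t x = (THE y. (x, y) \<in> \<Union>C)" for x
  have sv: "y = y'" if xy: "(x, y) \<in> \<Union>C" "(x, y') \<in> \<Union>C" for x y y'
  proof -
    obtain g g' where g: "g \<in> C" "(x, y) \<in> g" "g' \<in> C" "(x, y') \<in> g'" using xy by blast
    then obtain h where h: "h \<in> C" "(x, y) \<in> h" "(x, y') \<in> h" using chain by blast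
    then show ?thesis using emb[OF h(1)] by (auto simp: graph_def)
  qed
  have t: "t x = y" if "(x, y) \<in> \<Union>C" for x y
    unfolding t_def using that sv by (intro the_equality) blast+
  have U: "\<Union>C = graph D t"
  proof (rule subset_antisym; rule subsetI)
    fix z assume z: "z \<in> \<Union>C"
    then have "(fst z, snd z) \<in> \<Union>C" by simp
    then have "t (fst z) = snd z" by (rule t)
    then show "z \<in> graph D t" using z by (auto simp: graph_def D_def intro!: image_eqI[of _ _ "fst z"])
  next
    fix z assume "z \<in> graph D t"
    then obtain x w where z: "z = (x, t x)" "w \<in> \<Union>C" "x = fst w" by (auto simp: graph_def D_def)
    then have "(x, snd w) \<in> \<Union>C" by simp
    then show "z \<in> \<Union>C" using t z by metis
  qed
  have common: "\<exists>D' t'. emb D' t' \<and> D' \<subseteq> D \<and> x \<in> D' \<and> y \<in> D' \<and> (\<forall>z\<in>D'. t z = t' z)"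
    if xy: "x \<in> D" "y \<in> D" for x y
  proof -
    obtain g g' where g: "g \<in> C" "x \<in> fst ` g" "g' \<in> C" "y \<in> fst ` g'" using xy by (auto simp: D_def)
    then obtain h where h: "h \<in> C" "x \<in> fst ` h" "y \<in> fst ` h" using chain by blast
    obtain D' t' where e: "emb D' t'" "h = graph D' t'" using emb[OF h(1)] by blast
    have hU: "h \<subseteq> \<Union>C" using h(1) by blast
    have fh: "fst ` h = D'" using e(2) by (force simp: graph_def)
    have "D' \<subseteq> D" using hU fh unfolding D_def by blast
    moreover have "t z = t' z" if "z \<in> D'" for z
      using that e(2) hU by (intro t) (auto simp: graph_def)
    ultimately show ?thesis using e(1) h fh by blast
  qed
  obtain g where g: "g \<in> C" using C by blast
  then obtain D1 t1 where e1: "emb D1 t1" "g = graph D1 t1" using emb by blast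
  have "D1 \<subseteq> D"
  proof
    fix x assume "x \<in> D1"
    then have "(x, t1 x) \<in> \<Union>C" using e1(2) g by (auto simp: graph_def)
    then show "x \<in> D" unfolding D_def by (metis fst_conv image_eqI)
  qed
  then have KD: "K \<subseteq> D" using e1 by (auto simp: emb_def)
  have oneD: "\<one> \<in> D" using KD subringE(3)[OF K_subring] by blast
  have sub: "subfield D R"
  proof (rule directed_union_subfield)
    fix x y assume "x \<in> D" "y \<in> D"
    then obtain D' t' where "emb D' t'" "D' \<subseteq> D" "x \<in> D'" "y \<in> D'" using common[of x y] by blast
    then show "\<exists>L. subfield L R \<and> L \<subseteq> D \<and> x \<in> L \<and> y \<in> L" unfolding emb_def by blast
  qed (use oneD in blast)
  let ?D = "R\<lparr>carrier := D\<rparr>"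
  have hom: "t \<in> ring_hom ?D R"
  proof (rule ring_hom_memI)
    fix x y assume "x \<in> carrier ?D" "y \<in> carrier ?D"
    then have "x \<in> D" "y \<in> D" by auto
    then obtain D' t' where e: "emb D' t'" "D' \<subseteq> D" "x \<in> D'" "y \<in> D'" "\<forall>z\<in>D'. t z = t' z" using common[of x y] by blast
    interpret h: ring_hom_ring "R\<lparr>carrier := D'\<rparr>" R t' by (rule emb_ring_hom_ring[OF e(1)])
    have "x \<otimes> y \<in> D'" "x \<oplus> y \<in> D'" using e subringE(6,7)[OF emb_subring[OF e(1)], of x y] by auto
    then show "t x \<in> carrier R" "t (x \<otimes>\<^bsub>?D\<^esub> y) = t x \<otimes> t y" "t (x \<oplus>\<^bsub>?D\<^esub> y) = t x \<oplus> t y"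
      using e h.hom_closed[of x] h.hom_mult[of x y] h.hom_add[of x y] by simp_all
  next
    obtain D' t' where e: "emb D' t'" "\<one> \<in> D'" "\<forall>z\<in>D'. t z = t' z" using common[of \<one> \<one>] oneD by blast
    interpret h: ring_hom_ring "R\<lparr>carrier := D'\<rparr>" R t' by (rule emb_ring_hom_ring[OF e(1)])
    show "t \<one>\<^bsub>?D\<^esub> = \<one>" using e h.hom_one by simp
  qed
  have "t k = k" if k: "k \<in> K" for k
  proof -
    obtain D' t' where "emb D' t'" "k \<in> D'" "\<forall>z\<in>D'. t z = t' z" using common[of k k] KD k by blast
    then show ?thesis using k by (auto simp: emb_def)
  qed
  then show ?thesis using U sub hom KD by (auto simp: emb_def)
qed

text \<open>Zorn's lemma on graphs. A maximal embedding is total: for \<open>x\<close> outside its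
  domain the transported minimal polynomial has a root by \<open>emb_conjugates\<close>, since its
  degree is positive, and \<open>emb_extend_simple\<close> would enlarge the embedding.\<close>

lemma emb_extend:
  assumes "emb D0 t0"
  obtains t where "emb (carrier R) t" "\<And>d. d \<in> D0 \<Longrightarrow> t d = t0 d"
proof -
  define A where "A = {g. graph D0 t0 \<subseteq> g \<and> (\<exists>D t. emb D t \<and> g = graph D t)}"
  have "\<exists>M\<in>A. \<forall>Z\<in>A. M \<subseteq> Z \<longrightarrow> Z = M"
  proof (rule subset_Zorn_nonempty)
    show "A \<noteq> {}" using assms by (auto simp: A_def)
    fix C assume C: "C \<noteq> {}" "subset.chain A C"
    then have CA: "C \<subseteq> A" and ch: "\<And>g g'. g \<in> C \<Longrightarrow> g' \<in> C \<Longrightarrow> g \<subseteq> g' \<or> g' \<subseteq> g"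
      by (auto simp: subset_chain_def)
    have "\<exists>D t. emb D t \<and> \<Union>C = graph D t"
    proof (rule emb_chain_union[OF C(1)])
      show "\<exists>D t. emb D t \<and> g = graph D t" if "g \<in> C" for g using that CA by (auto simp: A_def)
    qed (rule ch)
    moreover have "graph D0 t0 \<subseteq> \<Union>C" using C(1) CA by (auto simp: A_def)
    ultimately show "\<Union>C \<in> A" by (auto simp: A_def)
  qed
  then obtain M where M: "M \<in> A" "\<And>Z. Z \<in> A \<Longrightarrow> M \<subseteq> Z \<Longrightarrow> Z = M" by blast
  then obtain D t where e: "emb D t" "M = graph D t" "graph D0 t0 \<subseteq> graph D t" by (auto simp: A_def)
  have D: "subfield D R" and KD: "K \<subseteq> D" using e(1) by (auto simp: emb_def)
  have "D = carrier R"
  proof (rule ccontr)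
    assume "D \<noteq> carrier R"
    then obtain x where x: "x \<in> carrier R" "x \<notin> D" using subfieldE(3)[OF D] by blast
    let ?Z = "{y \<in> carrier R. eval (map t (Irr D x)) y = \<zero>}"
    have "card ?Z \<noteq> 0"
      using emb_conjugates(2)[OF e(1) x(1)] pirreducible_degree[OF D IrrE(1,2)[OF D x(1) alg[OF KD x(1)]]] by linarith
    then have "?Z \<noteq> {}" by (metis card.empty)
    then obtain y where y: "y \<in> carrier R" "eval (map t (Irr D x)) y = \<zero>" by blast
    obtain t' where t': "emb (simple_extension D x) t'" "\<And>d. d \<in> D \<Longrightarrow> t' d = t d"
      using emb_extend_simple[OF e(1) x(1) y] by blast
    have D': "D \<subseteq> simple_extension D x" "x \<in> simple_extension D x"
      using simple_extension_incl[OF subfieldE(3)[OF D] x(1)] simple_extension_mem[OF subfieldE(1)[OF D] x(1)] by auto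
    have sub: "graph D t \<subseteq> graph (simple_extension D x) t'" using t'(2) D'(1) by (auto simp: graph_def)
    then have "graph (simple_extension D x) t' = graph D t"
      using M(2)[of "graph (simple_extension D x) t'"] e t'(1) by (auto simp: A_def)
    then have "x \<in> D" using D'(2) by (auto simp: graph_def)
    then show False using x by simp
  qed
  moreover have "t d = t0 d" if "d \<in> D0" for d using e(3) that by (auto simp: graph_def)
  ultimately show ?thesis using that e(1) by blast
qed

text \<open>Unlike the elements of \<open>gal R K\<close>, those of \<open>Gam\<close> are not made extensional.\<close>
definition Gam :: "('a \<Rightarrow> 'a) set" where
  "Gam = {s \<in> ring_iso R R. \<forall>k\<in>K. s k = k}"

lemma eval_fixed_hom:
  assumes s: "s \<in> ring_hom R R" and p: "set p \<subseteq> carrier R" "\<And>a. a \<in> set p \<Longrightarrow> s a = a" and x: "x \<in> carrier R"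
  shows "eval p (s x) = s (eval p x)"
proof -
  interpret h: ring_hom_ring R R s by (rule ring_hom_ringI2[OF ring_axioms ring_axioms s])
  show ?thesis using h.eval_hom'[OF x p(1)] map_idI[of p s] p(2) by simp
qed

lemma Irr_conjugates:
  assumes D: "subfield D R" "K \<subseteq> D" and x: "x \<in> carrier R"
  shows "finite {y \<in> carrier R. eval (Irr D x) y = \<zero>}"
    and "card {y \<in> carrier R. eval (Irr D x) y = \<zero>} = Polynomials.degree (Irr D x)"
proof -
  have "emb D id" by (rule emb_id[OF D])
  from emb_conjugates[OF this x]
  show "finite {y \<in> carrier R. eval (Irr D x) y = \<zero>}"
    "card {y \<in> carrier R. eval (Irr D x) y = \<zero>} = Polynomials.degree (Irr D x)" by simp_all
qed

text \<open>Surjectivity comes from finiteness: \<open>t\<close> maps the roots of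
  \<open>Irr K y\<close> injectively into themselves, hence onto, and \<open>y\<close> is one of
  them.\<close>

lemma emb_carrier_Gam:
  assumes "emb (carrier R) t" shows "t \<in> Gam"
proof -
  have h: "t \<in> ring_hom R R" using assms by (simp add: emb_def)
  have inj: "inj_on t (carrier R)" by (rule emb_inj[OF assms])
  have "y \<in> t ` carrier R" if y: "y \<in> carrier R" for y
  proof -
    let ?Z = "{z \<in> carrier R. eval (Irr K y) z = \<zero>}"
    note I = IrrE[OF K_subfield y alg[OF subset_refl y]]
    have sub: "set (Irr K y) \<subseteq> K" by (rule poly_set[OF K_subfield I(1)])
    have fin: "finite ?Z" by (rule Irr_conjugates(1)[OF K_subfield subset_refl y])
    have "t ` ?Z \<subseteq> ?Z"
    proof safe
      fix z assume z: "z \<in> carrier R" "eval (Irr K y) z = \<zero>"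
      have "eval (Irr K y) (t z) = t (eval (Irr K y) z)"
        using sub assms K_carrier z by (intro eval_fixed_hom[OF h]) (auto simp: emb_def)
      then show "eval (Irr K y) (t z) = \<zero>" using z ring_hom_zero[OF h ring_axioms ring_axioms] by simp
      show "t z \<in> carrier R" using ring_hom_closed[OF h z(1)] .
    qed
    moreover have "inj_on t ?Z" using inj by (rule inj_on_subset) auto
    ultimately have "t ` ?Z = ?Z" using fin by (intro endo_inj_surj)
    then show ?thesis using y I(4) by blast
  qed
  then have "bij_betw t (carrier R) (carrier R)"
    using inj ring_hom_closed[OF h] by (auto simp: bij_betw_def)
  then show ?thesis using h assms by (auto simp: Gam_def ring_iso_def emb_def)
qed

text \<open>The identity of \<open>D\<close> extends to \<open>simple_extension D x\<close> with any
  conjugate as value at \<open>x\<close>, and from there to the whole closure.\<close>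

lemma conjugate_Gam:
  assumes D: "subfield D R" "K \<subseteq> D" and x: "x \<in> carrier R" and y: "y \<in> carrier R" "eval (Irr D x) y = \<zero>"
  obtains s where "s \<in> Gam" "\<And>d. d \<in> D \<Longrightarrow> s d = d" "s x = y"
proof -
  note id = emb_id[OF D]
  obtain t' where t': "emb (simple_extension D x) t'" "\<And>d. d \<in> D \<Longrightarrow> t' d = id d" "t' x = y"
    using emb_extend_simple[OF id x y(1)] y(2) by auto
  obtain t where t: "emb (carrier R) t" "\<And>d. d \<in> simple_extension D x \<Longrightarrow> t d = t' d"
    using emb_extend[OF t'(1)] by blast
  have D': "D \<subseteq> simple_extension D x" "x \<in> simple_extension D x"
    using simple_extension_incl[OF subfieldE(3)[OF D(1)] x(1)] simple_extension_mem[OF subfieldE(1)[OF D(1)] x(1)] by auto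
  show ?thesis
  proof (rule that[OF emb_carrier_Gam[OF t(1)]])
    show "t d = d" if "d \<in> D" for d using that t(2)[of d] t'(2)[of d] D' by auto
    show "t x = y" using t(2)[OF D'(2)] t'(3) by simp
  qed
qed

section \<open>Finite extensions and orbits of the automorphism group\<close>

declare finite_extension.simps [simp del]

abbreviation "adjoin xs \<equiv> finite_extension K xs"

lemma finite_extension_Nil: "adjoin [] = K"
  and finite_extension_Cons: "adjoin (x # xs) = simple_extension (adjoin xs) x"
  by (simp_all add: finite_extension.simps)

lemma Gam_hom: "s \<in> Gam \<Longrightarrow> s \<in> ring_hom R R"
  by (simp add: Gam_def ring_iso_def)

lemma Gam_zero: "s \<in> Gam \<Longrightarrow> s \<zero> = \<zero>"
  using ring_hom_zero[OF Gam_hom ring_axioms ring_axioms] .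

lemma Gam_fix: "s \<in> Gam \<Longrightarrow> k \<in> K \<Longrightarrow> s k = k"
  by (simp add: Gam_def)

lemma Gam_inj: "s \<in> Gam \<Longrightarrow> inj_on s (carrier R)"
  by (simp add: Gam_def ring_iso_def bij_betw_def)

lemma Gam_closed: "s \<in> Gam \<Longrightarrow> x \<in> carrier R \<Longrightarrow> s x \<in> carrier R"
  using ring_hom_closed[OF Gam_hom] .

lemma Gam_id: "id \<in> Gam"
  by (auto simp: Gam_def ring_iso_def)

lemma Gam_comp: "s \<in> Gam \<Longrightarrow> t \<in> Gam \<Longrightarrow> s \<circ> t \<in> Gam"
  unfolding Gam_def using ring_iso_set_trans[of t R R s R] by auto

text \<open>The inverse is characterised pointwise on the carrier because elements of
  \<open>Gam\<close> are total functions with arbitrary values outside it.\<close>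

lemma Gam_inv:
  assumes "s \<in> Gam"
  obtains t where "t \<in> Gam" "\<And>x. x \<in> carrier R \<Longrightarrow> t (s x) = x" "\<And>x. x \<in> carrier R \<Longrightarrow> s (t x) = x"
proof
  have b: "bij_betw s (carrier R) (carrier R)" "s \<in> ring_iso R R" using assms by (auto simp: Gam_def ring_iso_def)
  let ?t = "inv_into (carrier R) s"
  show l: "?t (s x) = x" if "x \<in> carrier R" for x using bij_betw_inv_into_left[OF b(1) that] .
  show "s (?t x) = x" if "x \<in> carrier R" for x using bij_betw_inv_into_right[OF b(1) that] .
  have "?t k = k" if "k \<in> K" for k
    using l[of k] Gam_fix[OF assms that] subsetD[OF K_carrier that] by simp
  then show "?t \<in> Gam" using ring_iso_set_sym[OF ring_axioms b(2)] by (simp add: Gam_def)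
qed

definition fixes_on :: "'a set \<Rightarrow> ('a \<Rightarrow> 'a) set" where
  "fixes_on S = {s \<in> Gam. \<forall>x\<in>S. s x = x}"

lemma orbit_eq_roots:
  assumes D: "subfield D R" "K \<subseteq> D" and x: "x \<in> carrier R"
  shows "(\<lambda>s. s x) ` fixes_on D = {y \<in> carrier R. eval (Irr D x) y = \<zero>}"
proof safe
  fix s assume "s \<in> fixes_on D"
  then have s: "s \<in> Gam" "\<And>d. d \<in> D \<Longrightarrow> s d = d" by (auto simp: fixes_on_def)
  note I = IrrE[OF D(1) x alg[OF D(2) x]]
  show "s x \<in> carrier R" using Gam_closed[OF s(1) x] .
  have sD: "set (Irr D x) \<subseteq> D" by (rule poly_set[OF D(1) I(1)])
  then have "eval (Irr D x) (s x) = s (eval (Irr D x) x)"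
    using subfieldE(3)[OF D(1)] s by (intro eval_fixed_hom[OF Gam_hom[OF s(1)] _ _ x]) auto
  then show "eval (Irr D x) (s x) = \<zero>"
    using I(4) Gam_zero[OF s(1)] by simp
next
  fix y assume "y \<in> carrier R" "eval (Irr D x) y = \<zero>"
  then obtain s where "s \<in> Gam" "\<And>d. d \<in> D \<Longrightarrow> s d = d" "s x = y"
    using conjugate_Gam[OF D x] by metis
  then show "y \<in> (\<lambda>s. s x) ` fixes_on D" by (auto simp: fixes_on_def)
qed

lemma card_orbit:
  assumes D: "subfield D R" "K \<subseteq> D" and x: "x \<in> carrier R"
  shows "card ((\<lambda>s. s x) ` fixes_on D) = Polynomials.degree (Irr D x)"
  unfolding orbit_eq_roots[OF assms] by (rule Irr_conjugates(2)[OF assms])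

lemma fixes_on_K: "fixes_on K = Gam"
  by (auto simp: fixes_on_def Gam_def)

text \<open>The orbit of \<open>x\<close> over \<open>D\<close> is a single point and its size is
  the degree of \<open>Irr D x\<close>, so that polynomial is linear.\<close>

lemma fixed_imp_mem:
  assumes D: "subfield D R" "K \<subseteq> D" and x: "x \<in> carrier R" and fx: "\<And>s. s \<in> fixes_on D \<Longrightarrow> s x = x"
  shows "x \<in> D"
proof -
  note I = IrrE[OF D(1) x alg[OF D(2) x]]
  have "id \<in> fixes_on D" using Gam_id by (simp add: fixes_on_def)
  then have "(\<lambda>s. s x) ` fixes_on D = {x}" using fx by (auto intro!: image_eqI[of _ _ id])
  then have "Polynomials.degree (Irr D x) = 1" using card_orbit[OF D x] by simp
  then obtain a b where ab: "a \<in> D" "a \<noteq> \<zero>" "b \<in> D" "Irr D x = [a, b]" using degree_oneE[OF I(1)] by metis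
  have "\<one> \<otimes> x \<oplus> b = \<zero>" using I(3,4) ab x subfieldE(3)[OF D(1)] by auto
  then have "x = \<ominus> b" using x ab(3) subsetD[OF subfieldE(3)[OF D(1)]] by (simp add: minus_equality sum_zero_eq_neg)
  then show ?thesis using subringE(5)[OF subfieldE(1)[OF D(1)]] ab(3) by simp
qed

lemma fixed_subring: "s \<in> Gam \<Longrightarrow> subring {x \<in> carrier R. s x = x} R"
proof (rule subringI, goal_cases)
  case (3 h)
  interpret ring_hom_ring R R s by (rule ring_hom_ringI2[OF ring_axioms ring_axioms Gam_hom[OF 3(1)]])
  show ?case using 3 by simp
qed (auto simp: ring_hom_one[OF Gam_hom] ring_hom_mult[OF Gam_hom] ring_hom_add[OF Gam_hom])

lemma finite_extension_subset:
  assumes "set xs \<subseteq> carrier R" "subring L R" "K \<subseteq> L" "set xs \<subseteq> L"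
  shows "adjoin xs \<subseteq> L"
  using finite_extension_minimal[OF K_subring assms(1)] assms by blast

lemma finite_extension_props:
  assumes "set xs \<subseteq> carrier R"
  shows "subfield (adjoin xs) R" "K \<subseteq> adjoin xs" "set xs \<subseteq> adjoin xs"
  using finite_extension_is_subfield[OF K_subfield] assms alg[OF subset_refl]
    finite_extension_incl[OF K_carrier assms]
    finite_extension_mem[OF K_subring assms] by blast+

lemma fixes_on_finite_extension:
  assumes xs: "set xs \<subseteq> carrier R"
  shows "fixes_on (adjoin xs) = fixes_on (set xs)"
proof
  show "fixes_on (adjoin xs) \<subseteq> fixes_on (set xs)"
    using finite_extension_props(3)[OF xs] by (auto simp: fixes_on_def)
  show "fixes_on (set xs) \<subseteq> fixes_on (adjoin xs)"
  proof
    fix s assume s: "s \<in> fixes_on (set xs)"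
    then have sG: "s \<in> Gam" by (simp add: fixes_on_def)
    have "adjoin xs \<subseteq> {x \<in> carrier R. s x = x}"
      using s xs Gam_fix[OF sG] K_carrier
      by (intro finite_extension_subset[OF xs fixed_subring[OF sG]]) (auto simp: fixes_on_def)
    then show "s \<in> fixes_on (adjoin xs)" using sG by (auto simp: fixes_on_def)
  qed
qed

text \<open>By \<open>dimension_conj_count\<close> this is the degree of \<open>adjoin xs\<close>
  over \<open>K\<close>. Counting image tuples takes the place of indices of subgroups.\<close>

definition conj_count :: "'a list \<Rightarrow> nat" where
  "conj_count xs = card ((\<lambda>s. map s xs) ` Gam)"

lemma conj_count_Nil: "conj_count [] = 1"
proof -
  have "(\<lambda>s. map s []) ` Gam = {[]}" using Gam_id by auto
  then show ?thesis by (simp add: conj_count_def)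
qed

lemma finite_orbit: "x \<in> carrier R \<Longrightarrow> finite ((\<lambda>s. s x) ` Gam)"
  using orbit_eq_roots[OF K_subfield subset_refl] Irr_conjugates(1)[OF K_subfield subset_refl]
  by (simp add: fixes_on_K)

lemma finite_conj: "set xs \<subseteq> carrier R \<Longrightarrow> finite ((\<lambda>s. map s xs) ` Gam)"
proof (induction xs)
  case (Cons x xs)
  have "(\<lambda>s. map s (x # xs)) ` Gam \<subseteq> (\<lambda>(a, b). a # b) ` ((\<lambda>s. s x) ` Gam \<times> (\<lambda>s. map s xs) ` Gam)" by auto
  moreover have "finite ((\<lambda>(a, b). a # b) ` ((\<lambda>s. s x) ` Gam \<times> (\<lambda>s. map s xs) ` Gam))"
    using Cons.IH Cons.prems finite_orbit[of x] finite_imageI[OF finite_cartesian_product] by simp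
  ultimately show ?case by (rule finite_subset)
qed (auto intro: finite_subset[of _ "{[]}"])

text \<open>Orbit-stabiliser count: an image of \<open>ys @ xs\<close> is given by the image
  \<open>v\<close> of \<open>xs\<close> and, once a fixed automorphism realising \<open>v\<close> is
  undone, by an image of \<open>ys\<close> under the stabiliser of \<open>xs\<close>.\<close>

lemma conj_count_append:
  assumes xs: "set xs \<subseteq> carrier R" and ys: "set ys \<subseteq> carrier R"
  shows "conj_count (ys @ xs) = conj_count xs * card ((\<lambda>s. map s ys) ` fixes_on (set xs))"
proof -
  let ?I = "(\<lambda>s. map s xs) ` Gam" and ?O = "(\<lambda>s. map s ys) ` fixes_on (set xs)"
  have "\<forall>v. \<exists>s. v \<in> ?I \<longrightarrow> s \<in> Gam \<and> map s xs = v" by blast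
  then obtain \<tau> where \<tau>: "v \<in> ?I \<Longrightarrow> \<tau> v \<in> Gam \<and> map (\<tau> v) xs = v" for v by metis
  have "bij_betw (\<lambda>(v, w). map (\<tau> v) w @ v) (?I \<times> ?O) ((\<lambda>s. map s (ys @ xs)) ` Gam)"
  proof (rule bij_betwI')
    fix a b assume ab: "a \<in> ?I \<times> ?O" "b \<in> ?I \<times> ?O"
    obtain v w v' w' where e: "a = (v, w)" "b = (v', w')" by (metis prod.exhaust)
    have m: "v \<in> ?I" "v' \<in> ?I" "w \<in> ?O" "w' \<in> ?O" using ab e by auto
    then have len: "length v = length v'" "length w = length w'" by auto
    have wc: "set w \<subseteq> carrier R" "set w' \<subseteq> carrier R"
      using m subsetD[OF ys] Gam_closed by (auto simp: fixes_on_def)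
    have "map (\<tau> v) w = map (\<tau> v) w' \<longleftrightarrow> w = w'"
      using inj_on_map_eq_map[of "\<tau> v" w w'] inj_on_subset[OF Gam_inj[of "\<tau> v"]] \<tau>[OF m(1)] wc by blast
    then show "((case a of (v, w) \<Rightarrow> map (\<tau> v) w @ v) = (case b of (v, w) \<Rightarrow> map (\<tau> v) w @ v)) = (a = b)"
      using len e by auto
  next
    fix a assume "a \<in> ?I \<times> ?O"
    then obtain v s where e: "a = (v, map s ys)" "v \<in> ?I" "s \<in> fixes_on (set xs)" by auto
    then have "map (\<tau> v) (map s ys) @ v = map (\<tau> v \<circ> s) (ys @ xs)"
      using \<tau>[OF e(2)] by (auto simp: fixes_on_def map_eq_conv intro: trans[OF conjunct2[OF \<tau>[OF e(2)], symmetric]])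
    moreover have "\<tau> v \<circ> s \<in> Gam" using \<tau>[OF e(2)] e(3) Gam_comp by (auto simp: fixes_on_def)
    ultimately show "(case a of (v, w) \<Rightarrow> map (\<tau> v) w @ v) \<in> (\<lambda>s. map s (ys @ xs)) ` Gam" using e(1) by auto
  next
    fix b assume "b \<in> (\<lambda>s. map s (ys @ xs)) ` Gam"
    then obtain s where s: "s \<in> Gam" "b = map s ys @ map s xs" by auto
    let ?v = "map s xs"
    have v: "?v \<in> ?I" using s by blast
    obtain t where t: "t \<in> Gam" "\<And>x. x \<in> carrier R \<Longrightarrow> t (\<tau> ?v x) = x" "\<And>x. x \<in> carrier R \<Longrightarrow> \<tau> ?v (t x) = x"
      using Gam_inv[of "\<tau> ?v"] \<tau>[OF v] by blast
    have "t (s x) = x" if "x \<in> set xs" for x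
    proof -
      have "s x = \<tau> ?v x" using \<tau>[OF v] that by (auto simp: map_eq_conv)
      then show ?thesis using t(2) that xs by auto
    qed
    then have "t \<circ> s \<in> fixes_on (set xs)" using Gam_comp[OF t(1) s(1)] by (auto simp: fixes_on_def)
    moreover have "map (\<tau> ?v) (map (t \<circ> s) ys) = map s ys" using t(3) Gam_closed[OF s(1)] ys by auto
    ultimately show "\<exists>a\<in>?I \<times> ?O. b = (case a of (v, w) \<Rightarrow> map (\<tau> v) w @ v)"
      using v s(2) by (intro bexI[of _ "(?v, map (t \<circ> s) ys)"]) auto
  qed
  from bij_betw_same_card[OF this] show ?thesis
    by (simp add: conj_count_def card_cartesian_product)
qed

lemma conj_count_Cons:
  assumes "set xs \<subseteq> carrier R" "x \<in> carrier R"
  shows "conj_count (x # xs) = conj_count xs * card ((\<lambda>s. s x) ` fixes_on (set xs))"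
proof -
  have "card ((\<lambda>s. map s [x]) ` fixes_on (set xs)) = card ((\<lambda>s. s x) ` fixes_on (set xs))"
    by (rule bij_betw_same_card[of hd]) (auto simp: bij_betw_def inj_on_def image_image)
  then show ?thesis using conj_count_append[of xs "[x]"] assms by simp
qed

text \<open>Adjoining \<open>x\<close> contributes the same factor to both numbers: the degree of
  \<open>Irr\<close> over the field below is the size of the orbit of \<open>x\<close> under the
  stabiliser.\<close>

lemma dimension_conj_count:
  "set xs \<subseteq> carrier R \<Longrightarrow> dimension (conj_count xs) K (adjoin xs)"
proof (induction xs)
  case Nil
  show ?case using dimension_one[OF K_subfield] by (simp add: conj_count_Nil finite_extension_Nil)
next
  case (Cons x xs)
  then have xs: "set xs \<subseteq> carrier R" and x: "x \<in> carrier R" by auto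
  note P = finite_extension_props[OF xs]
  let ?D = "adjoin xs"
  have "dimension (Polynomials.degree (Irr ?D x)) ?D (simple_extension ?D x)"
    by (rule dimension_simple_extension[OF P(1) x alg[OF P(2) x]])
  then have "dimension (conj_count xs * Polynomials.degree (Irr ?D x)) K (simple_extension ?D x)"
    by (rule telescopic_base[OF K_subfield P(1) Cons.IH[OF xs]])
  moreover have "Polynomials.degree (Irr ?D x) = card ((\<lambda>s. s x) ` fixes_on (set xs))"
    using card_orbit[OF P(1,2) x] fixes_on_finite_extension[OF xs] by simp
  ultimately show ?case using conj_count_Cons[OF xs x] by (simp add: finite_extension_Cons)
qed

text \<open>For intermediate fields this is normality over \<open>K\<close>, since orbits are full
  sets of conjugates.\<close>

definition stable :: "'a set \<Rightarrow> bool" where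
  "stable L \<longleftrightarrow> (\<forall>s\<in>Gam. \<forall>x\<in>L. s x \<in> L)"

text \<open>The elements that \<open>s\<close> sends into the field form a subring, so it suffices
  that this subring contains \<open>K\<close> and the generators.\<close>

lemma stable_finite_extension:
  assumes xs: "set xs \<subseteq> carrier R" and st: "\<And>s x. s \<in> Gam \<Longrightarrow> x \<in> set xs \<Longrightarrow> s x \<in> adjoin xs"
  shows "stable (adjoin xs)"
  unfolding stable_def
proof (intro ballI)
  fix s x assume s: "s \<in> Gam" and x: "x \<in> adjoin xs"
  let ?L = "adjoin xs"
  note P = finite_extension_props[OF xs]
  note sr = subfieldE(1)[OF P(1)]
  interpret h: ring_hom_ring R R s by (rule ring_hom_ringI2[OF ring_axioms ring_axioms Gam_hom[OF s]])
  have "subring {x \<in> carrier R. s x \<in> ?L} R"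
    by (rule subringI) (auto simp: subringE(3,5,6,7)[OF sr])
  moreover have "K \<subseteq> {x \<in> carrier R. s x \<in> ?L}"
    using Gam_fix[OF s] P(2) K_carrier by auto
  moreover have "set xs \<subseteq> {x \<in> carrier R. s x \<in> ?L}" using st[OF s] xs by auto
  ultimately have "?L \<subseteq> {x \<in> carrier R. s x \<in> ?L}" by (intro finite_extension_subset[OF xs])
  then show "s x \<in> ?L" using x by blast
qed

text \<open>The stabiliser of \<open>xs\<close> is normal because \<open>adjoin xs\<close> is
  stable. Orbits of a normal subgroup inside one orbit of the whole group have equal size, so that
  size divides the total. For fields: the degree of a compositum over \<open>adjoin xs\<close>
  divides the degree of \<open>adjoin ys\<close> over \<open>K\<close>.\<close>

lemma card_relative_dvd:
  assumes xs: "set xs \<subseteq> carrier R" and ys: "set ys \<subseteq> carrier R" and st: "stable (adjoin xs)"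
  shows "card ((\<lambda>s. map s ys) ` fixes_on (set xs)) dvd conj_count ys"
proof -
  let ?H = "fixes_on (set xs)" and ?O = "(\<lambda>s. map s ys) ` fixes_on (set xs)"
  \<comment> \<open>The orbit of the tuple \<open>map \<tau> ys\<close> under the
    stabiliser.\<close>
  define B where "B \<tau> = (\<lambda>s. map (s \<circ> \<tau>) ys) ` ?H" for \<tau>
  have HG: "?H \<subseteq> Gam" by (auto simp: fixes_on_def)
  have Hcomp: "s \<circ> t \<in> ?H" if "s \<in> ?H" "t \<in> ?H" for s t using that Gam_comp by (auto simp: fixes_on_def)
  have Hinv: "\<exists>t\<in>?H. (\<forall>x\<in>carrier R. t (s x) = x \<and> s (t x) = x)" if s: "s \<in> ?H" for s
  proof -
    obtain t where t: "t \<in> Gam" "\<And>x. x \<in> carrier R \<Longrightarrow> t (s x) = x" "\<And>x. x \<in> carrier R \<Longrightarrow> s (t x) = x"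
      using Gam_inv[of s] s HG by blast
    have "t x = x" if "x \<in> set xs" for x using t(2)[of x] s that xs by (auto simp: fixes_on_def)
    then show ?thesis using t by (auto simp: fixes_on_def)
  qed
  \<comment> \<open>Normality: \<open>\<tau>\<close> keeps the entries of \<open>xs\<close> inside
    \<open>adjoin xs\<close>, where \<open>s\<close> is trivial, so the conjugate of
    \<open>s\<close> by \<open>\<tau>\<close> fixes them.\<close>
  have Hconj: "\<exists>t\<in>?H. \<forall>x\<in>carrier R. s (\<tau> x) = \<tau> (t x)" if s: "s \<in> ?H" and \<tau>: "\<tau> \<in> Gam" for s \<tau>
  proof -
    obtain r where r: "r \<in> Gam" "\<And>x. x \<in> carrier R \<Longrightarrow> r (\<tau> x) = x" "\<And>x. x \<in> carrier R \<Longrightarrow> \<tau> (r x) = x"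
      using Gam_inv[OF \<tau>] by blast
    have "r (s (\<tau> x)) = x" if "x \<in> set xs" for x
    proof -
      have "\<tau> x \<in> adjoin xs"
        using st \<tau> finite_extension_props(3)[OF xs] that unfolding stable_def by blast
      then have "s (\<tau> x) = \<tau> x" using s fixes_on_finite_extension[OF xs] by (auto simp: fixes_on_def)
      then show ?thesis using r(2) that xs by auto
    qed
    then have "r \<circ> s \<circ> \<tau> \<in> ?H" using Gam_comp r(1) s HG \<tau> by (auto simp: fixes_on_def)
    moreover have "s (\<tau> x) = \<tau> ((r \<circ> s \<circ> \<tau>) x)" if "x \<in> carrier R" for x
      using r(3)[of "s (\<tau> x)"] that Gam_closed \<tau> s HG by auto
    ultimately show ?thesis by blast
  qed
  have cardB: "card (B \<tau>) = card ?O" if \<tau>: "\<tau> \<in> Gam" for \<tau>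
  proof -
    have "B \<tau> = map \<tau> ` ?O"
    proof safe
      fix v assume "v \<in> B \<tau>"
      then obtain s where s: "s \<in> ?H" "v = map (s \<circ> \<tau>) ys" by (auto simp: B_def)
      then obtain t where t: "t \<in> ?H" "\<forall>x\<in>carrier R. s (\<tau> x) = \<tau> (t x)" using Hconj \<tau> by blast
      then have "v = map \<tau> (map t ys)" using s(2) ys by auto
      then show "v \<in> map \<tau> ` ?O" using t(1) by blast
    next
      fix s assume s: "s \<in> ?H"
      obtain r where r: "r \<in> Gam" "\<And>x. x \<in> carrier R \<Longrightarrow> r (\<tau> x) = x" "\<And>x. x \<in> carrier R \<Longrightarrow> \<tau> (r x) = x"
        using Gam_inv[OF \<tau>] by blast
      obtain t where t: "t \<in> ?H" "\<forall>x\<in>carrier R. s (r x) = r (t x)" using Hconj[OF s r(1)] by blast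
      have "\<tau> (s x) = t (\<tau> x)" if x: "x \<in> carrier R" for x
      proof -
        have "s x = r (t (\<tau> x))" using t(2) Gam_closed[OF \<tau> x] r(2)[OF x] by metis
        then show ?thesis using r(3) Gam_closed \<tau> t(1) HG x by auto
      qed
      then have "map \<tau> (map s ys) = map (t \<circ> \<tau>) ys" using ys by auto
      then show "map \<tau> (map s ys) \<in> B \<tau>" using t(1) by (auto simp: B_def)
    qed
    moreover have "inj_on (map \<tau>) ?O"
    proof (rule inj_onI)
      fix v w assume vw: "v \<in> ?O" "w \<in> ?O" "map \<tau> v = map \<tau> w"
      then have "set v \<union> set w \<subseteq> carrier R" using subsetD[OF ys] Gam_closed subsetD[OF HG] by auto
      then show "v = w" using inj_on_map_eq_map[of \<tau> v w] inj_on_subset[OF Gam_inj[OF \<tau>]] vw(3) by blast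
    qed
    ultimately show ?thesis by (simp add: card_image)
  qed
  have disj: "B \<tau> \<subseteq> B \<tau>'" if \<tau>: "\<tau> \<in> Gam" "\<tau>' \<in> Gam" and ne: "B \<tau> \<inter> B \<tau>' \<noteq> {}" for \<tau> \<tau>'
  proof
    fix v assume "v \<in> B \<tau>"
    then obtain q where q: "q \<in> ?H" "v = map (q \<circ> \<tau>) ys" by (auto simp: B_def)
    from ne obtain s s' where s: "s \<in> ?H" "s' \<in> ?H" "map (s \<circ> \<tau>) ys = map (s' \<circ> \<tau>') ys" by (auto simp: B_def)
    obtain t where t: "t \<in> ?H" "\<forall>x\<in>carrier R. t (s x) = x \<and> s (t x) = x" using Hinv[OF s(1)] by blast
    have "(q \<circ> \<tau>) y = (q \<circ> t \<circ> s' \<circ> \<tau>') y" if y: "y \<in> set ys" for y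
    proof -
      have "s (\<tau> y) = s' (\<tau>' y)" using s(3) y by (auto simp: map_eq_conv)
      moreover have "\<tau> y = t (s (\<tau> y))" using t(2) Gam_closed[OF \<tau>(1)] ys y by auto
      ultimately show ?thesis by simp
    qed
    then have "v = map (q \<circ> t \<circ> s' \<circ> \<tau>') ys" using q(2) by auto
    moreover have "q \<circ> t \<circ> s' \<in> ?H" using Hcomp q(1) t(1) s(2) by blast
    ultimately show "v \<in> B \<tau>'" unfolding B_def by blast
  qed
  have U: "\<Union>(B ` Gam) = (\<lambda>s. map s ys) ` Gam"
  proof safe
    fix v \<tau> assume "v \<in> B \<tau>" "\<tau> \<in> Gam"
    then show "v \<in> (\<lambda>s. map s ys) ` Gam" using Gam_comp HG unfolding B_def by blast
  next
    fix s assume s: "s \<in> Gam"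
    have "id \<in> ?H" using Gam_id by (auto simp: fixes_on_def)
    then have "map (id \<circ> s) ys \<in> B s" unfolding B_def by blast
    then show "map s ys \<in> \<Union>(B ` Gam)" using s by auto
  qed
  have fin: "finite (\<Union>(B ` Gam))" unfolding U by (rule finite_conj[OF ys])
  have "card ?O * card (B ` Gam) = card (\<Union>(B ` Gam))"
  proof (rule card_partition)
    show "finite (B ` Gam)" using fin by (rule finite_UnionD)
    show "c1 \<inter> c2 = {}" if "c1 \<in> B ` Gam" "c2 \<in> B ` Gam" "c1 \<noteq> c2" for c1 c2
      using that disj by (metis (no_types, lifting) Int_commute imageE subset_antisym)
  qed (use fin cardB in auto)
  then show ?thesis unfolding U conj_count_def by (metis dvd_triv_left)
qed

section \<open>Finite Galois p-extensions and their compositum\<close>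

lemma galois_p_extI:
  assumes xs: "set xs \<subseteq> carrier R" and st: "stable (adjoin xs)" and N: "conj_count xs = p ^ m"
  shows "galois_p_ext R K p (adjoin xs)"
proof -
  note P = finite_extension_props[OF xs]
  have "y \<in> adjoin xs"
    if xy: "x \<in> adjoin xs" "y \<in> carrier R" "eval (Irr K x) y = \<zero>" for x y
  proof -
    have "x \<in> carrier R" using xy subfieldE(3)[OF P(1)] by blast
    then obtain s where "s \<in> Gam" "s x = y" using conjugate_Gam[OF K_subfield subset_refl _ xy(2,3)] by metis
    then show ?thesis using st xy(1) by (auto simp: stable_def)
  qed
  moreover have "\<forall>x\<in>adjoin xs. separable_elem R K x"
    using separable subfieldE(3)[OF P(1)] by blast
  ultimately show ?thesis
    unfolding galois_p_ext_def using P dimension_conj_count[OF xs] N by auto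
qed

text \<open>A basis of \<open>L\<close> over \<open>K\<close> also generates it as a field. The
  normality clause becomes stability because orbits are the full sets of conjugates, and
  \<open>conj_count\<close> is the given power of \<open>p\<close> by uniqueness of the
  dimension.\<close>

lemma galois_p_extE:
  assumes "galois_p_ext R K p L"
  obtains xs m where "set xs \<subseteq> carrier R" "L = adjoin xs" "stable L" "conj_count xs = p ^ m"
proof -
  have L: "subfield L R" "K \<subseteq> L"
    and nor: "\<And>x y. x \<in> L \<Longrightarrow> y \<in> carrier R \<Longrightarrow> eval (Irr K x) y = \<zero> \<Longrightarrow> y \<in> L"
    using assms by (auto simp: galois_p_ext_def)
  obtain m where m: "dimension (p ^ m) K L" using assms by (auto simp: galois_p_ext_def)
  obtain Vs where Vs: "set Vs \<subseteq> carrier R" "Span K Vs = L" using exists_base[OF K_subfield m] by blast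
  have VL: "set Vs \<subseteq> L" using Span_base_incl[OF K_subfield Vs(1)] Vs(2) by simp
  note P = finite_extension_props[OF Vs(1)]
  have "Span K Vs \<subseteq> adjoin Vs"
  proof (rule Span_min[OF K_subfield])
    show "subgroup (adjoin Vs) (add_monoid R)" using subring.axioms(1)[OF subfieldE(1)[OF P(1)]] .
    show "K <#> set Vs \<subseteq> adjoin Vs"
      using P(2,3) subringE(6)[OF subfieldE(1)[OF P(1)]] unfolding set_mult_def by blast
  qed (rule Vs(1))
  then have e: "L = adjoin Vs"
    using finite_extension_subset[OF Vs(1) subfieldE(1)[OF L(1)] L(2) VL] Vs(2) by blast
  have "stable L"
  proof -
    have "s x \<in> L" if s: "s \<in> Gam" and x: "x \<in> L" for s x
    proof -
      have xc: "x \<in> carrier R" using x subfieldE(3)[OF L(1)] by blast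
      have "s x \<in> (\<lambda>s. s x) ` fixes_on K" using s by (simp add: fixes_on_K)
      then show ?thesis using nor[OF x] orbit_eq_roots[OF K_subfield subset_refl xc] by blast
    qed
    then show ?thesis by (simp add: stable_def)
  qed
  moreover have "conj_count Vs = p ^ m"
    using dimension_is_inj[OF K_subfield _ m] dimension_conj_count[OF Vs(1)] e by simp
  ultimately show ?thesis using that Vs(1) e by blast
qed

text \<open>The degree of the compositum is that of \<open>L\<close> times a relative degree. By
  \<open>card_relative_dvd\<close> the latter divides the degree of \<open>L'\<close>, so it is a
  power of \<open>p\<close>.\<close>

lemma galois_p_ext_compositum:
  assumes p: "Factorial_Ring.prime p" and L: "galois_p_ext R K p L" "galois_p_ext R K p L'"
  obtains M where "galois_p_ext R K p M" "L \<subseteq> M" "L' \<subseteq> M"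
proof -
  obtain xs m where xs: "set xs \<subseteq> carrier R" "L = adjoin xs" "stable L" "conj_count xs = p ^ m"
    using galois_p_extE[OF L(1)] .
  obtain ys m' where ys: "set ys \<subseteq> carrier R" "L' = adjoin ys" "stable L'" "conj_count ys = p ^ m'"
    using galois_p_extE[OF L(2)] .
  let ?M = "adjoin (ys @ xs)"
  have yx: "set (ys @ xs) \<subseteq> carrier R" using xs ys by auto
  note P = finite_extension_props[OF yx] and Px = finite_extension_props[OF xs(1)] and Py = finite_extension_props[OF ys(1)]
  have LM: "L \<subseteq> ?M" "L' \<subseteq> ?M"
    unfolding xs(2) ys(2)
    using finite_extension_subset[OF xs(1) subfieldE(1)[OF P(1)] P(2)]
      finite_extension_subset[OF ys(1) subfieldE(1)[OF P(1)] P(2)] P(3) by auto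
  have "stable ?M"
  proof (rule stable_finite_extension[OF yx])
    fix s x assume "s \<in> Gam" "x \<in> set (ys @ xs)"
    then have "s x \<in> L \<union> L'" using Px(3) Py(3) xs(2,3) ys(2,3) unfolding stable_def by auto
    then show "s x \<in> ?M" using LM by blast
  qed
  moreover obtain d where d: "conj_count (ys @ xs) = p ^ d"
  proof -
    have "card ((\<lambda>s. map s ys) ` fixes_on (set xs)) dvd p ^ m'"
      using card_relative_dvd[OF xs(1) ys(1)] xs(2,3) ys(4) by simp
    then obtain i where "card ((\<lambda>s. map s ys) ` fixes_on (set xs)) = p ^ i"
      using divides_primepow_nat[OF p] by blast
    then have "conj_count (ys @ xs) = p ^ (m + i)"
      using conj_count_append[OF xs(1) ys(1)] xs(4) by (simp add: power_add)
    then show ?thesis using that by blast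
  qed
  ultimately show ?thesis using that[OF galois_p_extI[OF yx]] LM by blast
qed

lemma galois_p_ext_K: "galois_p_ext R K p K"
proof -
  have "conj_count [] = p ^ 0" by (simp add: conj_count_Nil)
  moreover have "stable (adjoin [])" by (simp add: finite_extension_Nil stable_def Gam_fix)
  ultimately have "galois_p_ext R K p (adjoin [])" by (intro galois_p_extI[of "[]" p 0]) auto
  then show ?thesis by (simp add: finite_extension_Nil)
qed

text \<open>Compositums make the family of finite Galois \<open>p\<close>-extensions directed, so
  its union is a field; it is stable because every member is.\<close>

lemma max_p_ext_subfield:
  assumes p: "Factorial_Ring.prime p"
  shows "subfield (max_p_ext R K p) R" "K \<subseteq> max_p_ext R K p" "stable (max_p_ext R K p)"
proof -
  let ?M = "max_p_ext R K p"
  show KM: "K \<subseteq> ?M" using galois_p_ext_K by (auto simp: max_p_ext_def)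
  have sub: "subfield L R" if "galois_p_ext R K p L" for L using that by (simp add: galois_p_ext_def)
  have common: "\<exists>L. galois_p_ext R K p L \<and> x \<in> L \<and> y \<in> L" if xy: "x \<in> ?M" "y \<in> ?M" for x y
  proof -
    obtain L L' where L: "galois_p_ext R K p L" "x \<in> L" "galois_p_ext R K p L'" "y \<in> L'"
      using xy by (auto simp: max_p_ext_def)
    obtain M where "galois_p_ext R K p M" "L \<subseteq> M" "L' \<subseteq> M" using galois_p_ext_compositum[OF p L(1,3)] .
    then show ?thesis using L by blast
  qed
  have LM: "L \<subseteq> ?M" if "galois_p_ext R K p L" for L using that by (auto simp: max_p_ext_def)
  show "subfield ?M R"
  proof (rule directed_union_subfield)
    show "?M \<noteq> {}" using KM subringE(3)[OF K_subring] by blast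
    show "\<exists>L. subfield L R \<and> L \<subseteq> ?M \<and> x \<in> L \<and> y \<in> L" if "x \<in> ?M" "y \<in> ?M" for x y
      using common[OF that] sub LM by blast
  qed
  show "stable ?M"
  proof -
    have "s x \<in> ?M" if s: "s \<in> Gam" and x: "x \<in> ?M" for s x
    proof -
      obtain L where L: "galois_p_ext R K p L" "x \<in> L" using x by (auto simp: max_p_ext_def)
      obtain xs m where "stable L" using galois_p_extE[OF L(1)] by metis
      then show ?thesis using s L LM by (auto simp: stable_def)
    qed
    then show ?thesis by (simp add: stable_def)
  qed
qed

end

section \<open>Kummer and Artin-Schreier equations\<close>

lemma (in cring) binomial_expansion:
  assumes x: "x \<in> carrier R" and y: "y \<in> carrier R"
  shows "(x \<oplus> y) [^] (n::nat) = (\<Oplus>k\<in>{..n}. add_pow R (n choose k) (x [^] k \<otimes> y [^] (n - k)))"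
proof (induction n)
  case 0 then show ?case by simp
next
  case (Suc n)
  let ?t = "\<lambda>k. add_pow R (n choose k) (x [^] k \<otimes> y [^] (n - k))"
  let ?S1 = "\<Oplus>k\<in>{..n}. add_pow R (n choose k) (x [^] Suc k \<otimes> y [^] (n - k))"
  let ?S2 = "\<Oplus>k\<in>{..n}. add_pow R (n choose k) (x [^] k \<otimes> y [^] (Suc n - k))"
  let ?S3 = "\<Oplus>k\<in>{..n}. add_pow R (n choose Suc k) (x [^] Suc k \<otimes> y [^] (n - k))"
  have c: "add_pow R (m::nat) (x [^] (i::nat) \<otimes> y [^] (j::nat)) \<in> carrier R" for m i j
    using x y by simp
  have "(x \<oplus> y) [^] Suc n = (\<Oplus>k\<in>{..n}. ?t k) \<otimes> (x \<oplus> y)"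
    using Suc.IH by simp
  also have "\<dots> = (\<Oplus>k\<in>{..n}. ?t k) \<otimes> x
      \<oplus> (\<Oplus>k\<in>{..n}. ?t k) \<otimes> y"
    using x y by (intro r_distr finsum_closed) auto
  also have "(\<Oplus>k\<in>{..n}. ?t k) \<otimes> x = ?S1"
  proof -
    have "?t k \<otimes> x
       = add_pow R (n choose k) (x [^] Suc k \<otimes> y [^] (n - k))" for k
      using x y by (subst add_pow_ldistr) (auto simp: m_ac)
    then show ?thesis by (subst finsum_ldistr) (use x y in auto)
  qed
  also have "(\<Oplus>k\<in>{..n}. ?t k) \<otimes> y = ?S2"
  proof -
    have "(\<Oplus>k\<in>{..n}. ?t k) \<otimes> y
       = (\<Oplus>k\<in>{..n}. ?t k \<otimes> y)"
      by (rule finsum_ldistr) (use x y in auto)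
    also have "\<dots> = ?S2"
    proof (rule finsum_cong')
      fix k assume "k \<in> {..n}"
      then have "Suc n - k = Suc (n - k)" by auto
      then show "?t k \<otimes> y
        = add_pow R (n choose k) (x [^] k \<otimes> y [^] (Suc n - k))"
        using x y by (subst add_pow_ldistr) (auto simp: m_ac)
    qed (use x y in auto)
    finally show ?thesis .
  qed
  \<comment> \<open>Add the vanishing term \<open>k = n + 1\<close>, then split off
    \<open>k = 0\<close>: the shifted sum has the monomials of \<open>?S1\<close>, ready for
    Pascal's rule.\<close>
  also have "?S2 = ?S3 \<oplus> y [^] Suc n"
  proof -
    have "(\<Oplus>k\<in>{..Suc n}. add_pow R (n choose k) (x [^] k \<otimes> y [^] (Suc n - k))) = ?S2"
      using c finsum_closed[of "\<lambda>k. add_pow R (n choose k) (x [^] k \<otimes> y [^] (Suc n - k))" "{..n}"]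
      by (subst finsum_Suc) (auto simp: binomial_eq_0)
    moreover have "(\<Oplus>k\<in>{..Suc n}. add_pow R (n choose k) (x [^] k \<otimes> y [^] (Suc n - k))) = ?S3 \<oplus> y [^] Suc n"
      using x y c by (subst finsum_Suc2) auto
    ultimately show ?thesis by simp
  qed
  also have "?S1 \<oplus> (?S3 \<oplus> y [^] Suc n) = (?S1 \<oplus> ?S3) \<oplus> y [^] Suc n"
    using x y c by (intro a_assoc[symmetric] finsum_closed) auto
  also have "?S1 \<oplus> ?S3 = (\<Oplus>k\<in>{..n}. add_pow R (Suc n choose Suc k) (x [^] Suc k \<otimes> y [^] (n - k)))"
  proof -
    have "add_pow R (Suc n choose Suc k) (x [^] Suc k \<otimes> y [^] (n - k)) =
      add_pow R (n choose k) (x [^] Suc k \<otimes> y [^] (n - k)) \<oplus> add_pow R (n choose Suc k) (x [^] Suc k \<otimes> y [^] (n - k))" for k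
      unfolding binomial_Suc_Suc using x y by (intro add.nat_pow_mult[symmetric]) auto
    then show ?thesis using c x y by (subst finsum_addf[symmetric]) auto
  qed
  also have "\<dots> \<oplus> y [^] Suc n = (\<Oplus>k\<in>{..Suc n}. add_pow R (Suc n choose k) (x [^] k \<otimes> y [^] (Suc n - k)))"
    using x y c by (subst finsum_Suc2) (auto simp del: binomial_Suc_Suc)
  finally show ?case .
qed

lemma (in ring) add_pow_char:
  assumes "natr (p::nat) = \<zero>" "p dvd m" "x \<in> carrier R" shows "add_pow R m x = \<zero>"
proof -
  obtain q where q: "m = p * q" using assms by auto
  have "add_pow R p x = natr p \<otimes> x" using assms(3) by (simp add: add_pow_ldistr)
  then have "add_pow R p x = \<zero>" using assms by simp
  then show ?thesis using q assms(3) add.nat_pow_pow[of x q p] by (simp add: mult.commute)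
qed

lemma (in cring) frobenius_add:
  assumes p: "Factorial_Ring.prime (p::nat)" and ch: "natr p = \<zero>" and x: "x \<in> carrier R" and y: "y \<in> carrier R"
  shows "(x \<oplus> y) [^] p = x [^] p \<oplus> y [^] p"
proof -
  obtain q where q: "p = Suc q" using prime_gt_0_nat[OF p] gr0_implies_Suc by blast
  let ?f = "\<lambda>k. add_pow R (p choose k) (x [^] k \<otimes> y [^] (p - k))"
  have c: "?f k \<in> carrier R" for k using x y by simp
  have "(x \<oplus> y) [^] p = (\<Oplus>k\<in>{..Suc q}. ?f k)" using binomial_expansion[OF x y, of p] q by simp
  also have "\<dots> = ?f (Suc q) \<oplus> (\<Oplus>k\<in>{..q}. ?f k)" using c by (intro finsum_Suc) auto
  also have "(\<Oplus>k\<in>{..q}. ?f k) = (\<Oplus>k\<in>{..q}. if 0 = k then ?f 0 else \<zero>)"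
  proof (rule finsum_cong')
    fix k assume k: "k \<in> {..q}"
    have "?f k = \<zero>" if "k \<noteq> 0"
      using dvd_choose_prime[of k p] that k q p x y by (intro add_pow_char[OF ch]) auto
    then show "?f k = (if 0 = k then ?f 0 else \<zero>)" by auto
  qed (use x y in auto)
  also have "\<dots> = ?f 0" by (rule finsum_singleton) (use x y in auto)
  finally show ?thesis using q x y by simp
qed

lemma (in field) card_roots_le:
  assumes f: "f \<in> carrier (poly_ring R)" "f \<noteq> []"
  shows "finite {x \<in> carrier R. eval f x = \<zero>}" "card {x \<in> carrier R. eval f x = \<zero>} \<le> Polynomials.degree f"
proof -
  have e: "{x \<in> carrier R. eval f x = \<zero>} = set_mset (roots f)"
    using roots_mem_iff_is_root[OF f(1)] f(2) by (auto simp: is_root_def)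
  show "finite {x \<in> carrier R. eval f x = \<zero>}" unfolding e by simp
  have "card (set_mset (roots f)) \<le> size (roots f)"
    by (metis mset_set_set_mset_msubset size_mset_mono size_mset_set)
  then show "card {x \<in> carrier R. eval f x = \<zero>} \<le> Polynomials.degree f"
    unfolding e using size_roots_le_degree[OF f(1)] by simp
qed

text \<open>For \<open>2 \<le> n\<close> this is \<open>X ^ n + b X + c\<close>, which covers the
  Kummer and Artin-Schreier polynomials as well as \<open>X ^ p - 1\<close> and
  \<open>X ^ p - X\<close>.\<close>

definition (in ring) trinomial :: "nat \<Rightarrow> 'a \<Rightarrow> 'a \<Rightarrow> 'a list" where
  "trinomial n b c = \<one> # replicate (n - 2) \<zero> @ [b, c]"

context field
begin

lemma trinomial_closed:
  "b \<in> carrier R \<Longrightarrow> c \<in> carrier R \<Longrightarrow> trinomial n b c \<in> carrier (poly_ring R)"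
  unfolding trinomial_def univ_poly_carrier[symmetric] polynomial_def by auto

lemma degree_trinomial: "2 \<le> n \<Longrightarrow> Polynomials.degree (trinomial n b c) = n"
  by (simp add: trinomial_def)

lemma eval_trinomial:
  assumes "2 \<le> n" "b \<in> carrier R" "c \<in> carrier R" "x \<in> carrier R"
  shows "eval (trinomial n b c) x = x [^] n \<oplus> (b \<otimes> x \<oplus> c)"
proof -
  have "eval (replicate (n - 2) \<zero> @ [b, c]) x = eval [b, c] x"
    by (rule eval_replicate) (use assms in auto)
  moreover have "eval [b, c] x = b \<otimes> x \<oplus> c" using assms by simp
  moreover have "length (replicate (n - 2) \<zero> @ [b, c]) = n" using assms(1) by simp
  ultimately show ?thesis using assms(4) by (subst trinomial_def, subst eval.simps(2)) (simp del: eval.simps)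
qed

lemma coeff_trinomial:
  assumes "2 \<le> n"
  shows "coeff (trinomial n b c) i = (if i = 0 then c else if i = 1 then b else if i = n then \<one> else \<zero>)"
  using assms unfolding trinomial_def coeff_Cons append_coeff by auto

lemma separable_polyI_coeff:
  assumes f: "f \<in> carrier (poly_ring R)" and de: "d \<in> carrier R" "e \<in> carrier R" "u \<in> carrier (poly_ring R)"
    and u: "u = [] \<or> u = [d]" and v: "v = [e] \<or> v = [e, \<zero>]" "e \<noteq> \<zero>"
    and eq: "\<And>i. coeff (u \<otimes>\<^sub>P f) i \<oplus> coeff (v \<otimes>\<^sub>P poly_deriv R f) i = (if i = 0 then \<one> else \<zero>)"
  shows "separable_poly R (carrier R) f"
proof -
  interpret P: cring "poly_ring R" by (rule poly_cring)
  have vc: "v \<in> carrier (poly_ring R)" using v de unfolding univ_poly_carrier[symmetric] polynomial_def by auto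
  have f': "poly_deriv R f \<in> carrier (poly_ring R)" by (rule poly_deriv_polynomial[OF poly_ring_set[OF f]])
  have m: "u \<otimes>\<^sub>P f \<in> carrier (poly_ring R)" "v \<otimes>\<^sub>P poly_deriv R f \<in> carrier (poly_ring R)"
    using de f vc f' by simp_all
  have "coeff ((u \<otimes>\<^sub>P f) \<oplus>\<^sub>P (v \<otimes>\<^sub>P poly_deriv R f)) i = coeff [\<one>] i" for i
    using poly_add_coeff[OF poly_ring_set[OF m(1)] poly_ring_set[OF m(2)]] eq[of i] by (simp add: univ_poly_add del: poly_add.simps)
  then have "(u \<otimes>\<^sub>P f) \<oplus>\<^sub>P (v \<otimes>\<^sub>P poly_deriv R f) = [\<one>]"
    using coeff_iff_polynomial_cond[of "carrier R"] P.a_closed[OF m] P.one_closed univ_poly_carrier univ_poly_one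
    by (metis ext)
  then show ?thesis unfolding separable_poly_def using f de vc by (auto simp: univ_poly_one)
qed

lemma artin_schreier_root:
  assumes cl: "separably_closed R" and p: "2 \<le> (p::nat)" "natr p = \<zero>" and c: "c \<in> carrier R"
  obtains x where "x \<in> carrier R" "x [^] p = x \<oplus> c"
proof -
  let ?f = "trinomial p (\<ominus> \<one>) (\<ominus> c)"
  interpret P: cring "poly_ring R" by (rule poly_cring)
  have f: "?f \<in> carrier (poly_ring R)" using c by (intro trinomial_closed) auto
  have f': "poly_deriv R ?f \<in> carrier (poly_ring R)" by (rule poly_deriv_polynomial[OF poly_ring_set[OF f]])
  \<comment> \<open>In characteristic \<open>p\<close> the derivative of
    \<open>X ^ p - X - c\<close> is \<open>- 1\<close>, so the certificate is
    \<open>0 f + (- 1) f' = 1\<close>.\<close>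
  have "separable_poly R (carrier R) ?f"
  proof (rule separable_polyI_coeff[OF f _ _ _ disjI1[OF refl] disjI1[OF refl], of \<zero> "\<ominus> \<one>"])
    show "coeff ([] \<otimes>\<^sub>P ?f) i \<oplus> coeff ([\<ominus> \<one>] \<otimes>\<^sub>P poly_deriv R ?f) i = (if i = 0 then \<one> else \<zero>)" for i
    proof -
      have "[] \<otimes>\<^sub>P ?f = []" by (simp add: univ_poly_mult)
      moreover have "add_pow R (Suc i) (coeff ?f (Suc i)) = (if i = 0 then \<ominus> \<one> else \<zero>)"
        using p by (auto simp: coeff_trinomial simp del: add.nat_pow_Suc) (simp)
      ultimately show ?thesis using f'
        by (simp add: coeff_const_mult coeff_poly_deriv l_minus del: add.nat_pow_Suc)
    qed
  qed (auto simp: univ_poly_zero_closed)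
  then obtain x where x: "x \<in> carrier R" "eval ?f x = \<zero>"
    using cl degree_trinomial[OF p(1)] p unfolding separably_closed_def by (metis One_nat_def Suc_1 Suc_leD)
  then have "x [^] p \<oplus> (\<ominus> x \<oplus> \<ominus> c) = \<zero>" using eval_trinomial[OF p(1), of "\<ominus> \<one>" "\<ominus> c" x] c by (simp add: l_minus)
  then have "x [^] p = x \<oplus> c" using x c by (metis a_inv_closed add.inv_mult add.m_comm local.minus_minus minus_equality a_closed nat_pow_closed)
  then show ?thesis using that x by blast
qed

lemma kummer_root:
  assumes cl: "separably_closed R" and p: "2 \<le> (p::nat)" "natr p \<noteq> \<zero>" and a: "a \<in> carrier R"
  obtains x where "x \<in> carrier R" "x [^] p = a"
proof (cases "a = \<zero>")
  case True then show ?thesis using that[of \<zero>] p by (simp add: nat_pow_zero)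
next
  case False
  let ?f = "trinomial p \<zero> (\<ominus> a)" and ?q = "natr p"
  interpret P: cring "poly_ring R" by (rule poly_cring)
  have f: "?f \<in> carrier (poly_ring R)" using a by (intro trinomial_closed) auto
  have f': "poly_deriv R ?f \<in> carrier (poly_ring R)" by (rule poly_deriv_polynomial[OF poly_ring_set[OF f]])
  have ia: "inv a \<in> carrier R" "a \<otimes> inv a = \<one>" "inv a \<otimes> a = \<one>" "inv a \<noteq> \<zero>"
    using inverse_nonzero[OF a False] by auto
  have iq: "inv ?q \<in> carrier R" "inv ?q \<otimes> ?q = \<one>" "inv ?q \<noteq> \<zero>"
    using inverse_nonzero[of ?q] p by auto
  \<comment> \<open>For \<open>f = X ^ p - a\<close> and \<open>f' = p X ^ (p - 1)\<close> the
    certificate is \<open>- a^-1 f + (p a)^-1 X f' = 1\<close>.\<close>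
  have "separable_poly R (carrier R) ?f"
  proof (rule separable_polyI_coeff[OF f, of "\<ominus> (inv a)" "inv ?q \<otimes> inv a" "[\<ominus> (inv a)]" "[inv ?q \<otimes> inv a, \<zero>]"])
    show "coeff ([\<ominus> (inv a)] \<otimes>\<^sub>P ?f) i \<oplus> coeff ([inv ?q \<otimes> inv a, \<zero>] \<otimes>\<^sub>P poly_deriv R ?f) i
      = (if i = 0 then \<one> else \<zero>)" for i
    proof (cases "i = 0")
      case True
      then show ?thesis using ia iq a f f' coeff_in_carrier[OF poly_ring_set[OF f']]
        by (simp add: coeff_linear_mult coeff_const_mult coeff_trinomial[OF p(1)] l_minus r_minus)
    next
      case False
      then obtain j where j: "i = Suc j" using not0_implies_Suc by blast
      have d: "coeff (poly_deriv R ?f) j = (if i = p then ?q else \<zero>)"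
        using p j by (auto simp: coeff_poly_deriv coeff_trinomial simp del: add.nat_pow_Suc)
      have "inv ?q \<otimes> inv a \<otimes> ?q = inv a"
      proof -
        have "inv ?q \<otimes> inv a \<otimes> ?q = (inv ?q \<otimes> ?q) \<otimes> inv a"
          using ia(1) iq(1) add.nat_pow_closed[OF one_closed] by (metis m_assoc m_comm)
        then show ?thesis using ia iq by simp
      qed
      then show ?thesis using j d ia iq a f f' coeff_in_carrier[OF poly_ring_set[OF f']] p
        by (auto simp: coeff_linear_mult coeff_const_mult coeff_trinomial[OF p(1)] l_minus l_neg)
    qed
    show "[\<ominus> (inv a)] \<in> carrier (poly_ring R)"
      using ia unfolding univ_poly_carrier[symmetric] polynomial_def by (auto dest: arg_cong[where f="\<lambda>x. \<ominus> x"])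
    show "inv ?q \<otimes> inv a \<noteq> \<zero>" using ia iq integral by blast
  qed (use ia iq in auto)
  then obtain x where x: "x \<in> carrier R" "eval ?f x = \<zero>"
    using cl degree_trinomial[OF p(1)] p unfolding separably_closed_def by (metis One_nat_def Suc_1 Suc_leD)
  then have "x [^] p \<oplus> \<ominus> a = \<zero>" using eval_trinomial[OF p(1), of \<zero> "\<ominus> a" x] a by simp
  then have "x [^] p = a" using x a by (metis a_inv_closed local.minus_minus minus_equality nat_pow_closed)
  then show ?thesis using that x by blast
qed

end

section \<open>Roots of unity, the prime field and independence of characters\<close>

lemma card_image_eq_kernel:
  assumes "\<And>x y. x \<in> A \<Longrightarrow> y \<in> A \<Longrightarrow> f x = f y \<longleftrightarrow> g x = g y"
  shows "card (f ` A) = card (g ` A)"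
proof -
  let ?h = "\<lambda>v. g (inv_into A f v)"
  have h: "?h (f a) = g a" if "a \<in> A" for a
    using assms[of "inv_into A f (f a)" a] that inv_into_into[of "f a" f A] f_inv_into_f[of "f a" f A] by auto
  have "inj_on ?h (f ` A)" by (rule inj_onI) (use h assms in auto)
  moreover have "?h ` f ` A = g ` A" using h by force
  ultimately show ?thesis by (metis card_image)
qed

text \<open>\<open>canc\<close> demands cancellation only at powers of \<open>z\<close>. In this
  form the lemma applies to the multiplicative monoid of a field, zero included.\<close>

lemma (in monoid) pow_eq_iff_cong:
  assumes z: "z \<in> carrier G" "z [^] N = \<one>" and prim: "\<And>k::nat. 0 < k \<Longrightarrow> k < N \<Longrightarrow> z [^] k \<noteq> \<one>" and N: "0 < (N::nat)"
    and canc: "\<And>i x. x \<in> carrier G \<Longrightarrow> z [^] (i::nat) = z [^] i \<otimes> x \<Longrightarrow> x = \<one>"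
  shows "z [^] i = z [^] j \<longleftrightarrow> [i = j] (mod N)"
proof -
  have red: "z [^] (i::nat) = z [^] (i mod N)" for i
  proof -
    have "z [^] i = z [^] (N * (i div N) + i mod N)" by simp
    also have "\<dots> = z [^] (N * (i div N)) \<otimes> z [^] (i mod N)" by (rule nat_pow_mult[symmetric]) (rule z(1))
    also have "z [^] (N * (i div N)) = (z [^] N) [^] (i div N)" by (rule nat_pow_pow[symmetric]) (rule z(1))
    finally show ?thesis using z by simp
  qed
  have inj: "i = j" if ij: "z [^] i = z [^] j" "i \<le> j" "j < N" for i j
  proof -
    have "z [^] j = z [^] i \<otimes> z [^] (j - i)" using nat_pow_mult[OF z(1), of i "j - i"] ij(2) by simp
    then have "z [^] i = z [^] i \<otimes> z [^] (j - i)" using ij(1) by simp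
    then have "z [^] (j - i) = \<one>" using canc z by simp
    then show ?thesis using prim[of "j - i"] ij by (metis diff_le_self le_eq_less_or_eq le_less_trans zero_less_diff)
  qed
  have "z [^] i = z [^] j \<longleftrightarrow> z [^] (i mod N) = z [^] (j mod N)" using red by simp
  also have "\<dots> \<longleftrightarrow> i mod N = j mod N"
    using inj[of "i mod N" "j mod N"] inj[of "j mod N" "i mod N"] mod_less_divisor[OF N] by (metis nat_le_linear)
  finally show ?thesis by (simp add: cong_def)
qed

context field
begin

lemma root_pow_eq_iff:
  assumes z: "z \<in> carrier R" "z [^] N = \<one>" and prim: "\<And>k::nat. 0 < k \<Longrightarrow> k < N \<Longrightarrow> z [^] k \<noteq> \<one>" and N: "0 < (N::nat)"
  shows "z [^] i = z [^] j \<longleftrightarrow> [i = j] (mod N)"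
proof (rule pow_eq_iff_cong[OF z prim N])
  have nz: "z \<noteq> \<zero>" using z N nat_pow_zero[of N] by auto
  fix i :: nat and x assume x: "x \<in> carrier R" "z [^] i = z [^] i \<otimes> x"
  have "z [^] i \<noteq> \<zero>" using nz z(1) by (induction i) (auto simp: integral_iff)
  then show "x = \<one>" using x z(1) m_lcancel[of "z [^] i" \<one> x] by simp
qed auto

lemma pow_eq_imp_root_of_unity:
  assumes x: "x \<in> carrier R" "y \<in> carrier R" "y \<noteq> \<zero>" "x [^] (q::nat) = y [^] q"
  obtains u where "u \<in> carrier R" "u [^] q = \<one>" "x = u \<otimes> y"
proof -
  have iy: "inv y \<in> carrier R" "inv y \<otimes> y = \<one>" "y \<otimes> inv y = \<one>"
    using inverse_nonzero[OF x(2,3)] by auto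
  have "(x \<otimes> inv y) [^] q = y [^] q \<otimes> inv y [^] q" using x iy by (simp add: nat_pow_distrib)
  also have "\<dots> = \<one>" using x iy by (simp add: nat_pow_distrib[symmetric])
  finally show ?thesis using that[of "x \<otimes> inv y"] x iy by (simp add: m_assoc)
qed

text \<open>The powers \<open>\<zeta> ^ k\<close> with \<open>k < p\<close> are \<open>p\<close>
  different roots of \<open>X ^ p - 1\<close>, so they exhaust its roots.\<close>

lemma pth_roots_of_unity:
  assumes z: "\<zeta> \<in> carrier R" "\<zeta> [^] p = \<one>" and prim: "\<And>k::nat. 0 < k \<Longrightarrow> k < p \<Longrightarrow> \<zeta> [^] k \<noteq> \<one>"
    and p: "2 \<le> (p::nat)" and w: "w \<in> carrier R" "w [^] p = \<one>"
  obtains k :: nat where "w = \<zeta> [^] k"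
proof -
  let ?f = "trinomial p \<zero> (\<ominus> \<one>)"
  let ?Z = "{x \<in> carrier R. eval ?f x = \<zero>}"
  have f: "?f \<in> carrier (poly_ring R)" "?f \<noteq> []" by (intro trinomial_closed) (auto simp: trinomial_def)
  have mem: "x \<in> ?Z" if "x \<in> carrier R" "x [^] p = \<one>" for x
    using that eval_trinomial[OF p, of \<zero> "\<ominus> \<one>" x] by (simp add: r_neg)
  have sub: "(\<lambda>k::nat. \<zeta> [^] k) ` {..<p} \<subseteq> ?Z"
  proof safe
    fix k :: nat
    have "(\<zeta> [^] k) [^] p = (\<zeta> [^] p) [^] k" using z(1) by (simp add: nat_pow_pow mult.commute)
    then show "eval ?f (\<zeta> [^] k) = \<zero>" using mem[of "\<zeta> [^] k"] z by simp
  qed (use z in auto)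
  have "inj_on (\<lambda>k::nat. \<zeta> [^] k) {..<p}"
    using root_pow_eq_iff[OF z prim] p by (auto intro!: inj_onI simp: cong_less_modulus_unique_nat)
  then have "card ((\<lambda>k::nat. \<zeta> [^] k) ` {..<p}) = p" by (simp add: card_image)
  then have "(\<lambda>k::nat. \<zeta> [^] k) ` {..<p} = ?Z"
    using card_roots_le[OF f] sub degree_trinomial[OF p, of \<zero> "\<ominus> \<one>"] by (metis card_seteq)
  then show ?thesis using mem[OF w] that by blast
qed

lemma prime_field_add_pow_eq_iff:
  assumes p: "Factorial_Ring.prime (p::nat)" "natr p = \<zero>"
  shows "natr i = natr j \<longleftrightarrow> [i = j] (mod p)"
proof -
  have red: "natr i = natr (i mod p)" for i
  proof -
    have "natr (p * (i div p) + i mod p) = natr (p * (i div p)) \<oplus> natr (i mod p)"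
      by (simp add: add.nat_pow_mult)
    then show ?thesis using add_pow_char[OF p(2), of "p * (i div p)" \<one>] by simp
  qed
  \<comment> \<open>\<open>k\<close> is invertible modulo \<open>p\<close>, so
    \<open>natr k = \<zero>\<close> would force \<open>\<one> = \<zero>\<close>.\<close>
  have nz: "natr k \<noteq> \<zero>" if k: "0 < k" "k < p" for k
  proof
    assume z: "natr k = \<zero>"
    have "coprime k p" using p(1) k by (metis coprime_commute dvd_imp_le leD prime_imp_coprime)
    then obtain x where x: "[k * x = Suc 0] (mod p)" using cong_solve_coprime_nat by blast
    have "natr (k * x) = \<zero>" using add_pow_char[OF z, of "k * x" \<one>] by simp
    moreover have "natr (k * x) = natr (Suc 0)"
      using red[of "k * x"] red[of "Suc 0"] x by (simp add: cong_def)
    ultimately show False by simp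
  qed
  have inj: "i = j" if ij: "natr i = natr j" "i \<le> j" "j < p" for i j
  proof (rule ccontr)
    assume "i \<noteq> j"
    have "natr (i + (j - i)) = natr i \<oplus> natr (j - i)"
      by (simp only: add.nat_pow_mult[OF one_closed])
    then have "natr (j - i) = \<zero>" using ij
      by (metis add.nat_pow_closed add.r_cancel_one' le_add_diff_inverse one_closed add.m_comm)
    then show False using nz[of "j - i"] ij \<open>i \<noteq> j\<close> by auto
  qed
  have "natr i = natr j \<longleftrightarrow> natr (i mod p) = natr (j mod p)" using red by metis
  also have "\<dots> \<longleftrightarrow> i mod p = j mod p"
    using inj[of "i mod p" "j mod p"] inj[of "j mod p" "i mod p"] prime_gt_0_nat[OF p(1)] mod_less_divisor
    by (metis nat_le_linear)
  finally show ?thesis by (simp add: cong_def)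
qed

lemma frobenius_prime_field:
  assumes p: "Factorial_Ring.prime (p::nat)" "natr p = \<zero>"
  shows "(natr (n::nat)) [^] p = natr n"
proof (induction n)
  case 0 then show ?case using prime_gt_0_nat[OF p(1)] by (simp add: nat_pow_zero)
next
  case (Suc n) then show ?case using frobenius_add[OF p, of "natr n" \<one>] by simp
qed

text \<open>The same count for \<open>X ^ p - X\<close>: the \<open>p\<close> elements of the prime
  field are already all its roots.\<close>

lemma frobenius_fixed:
  assumes p: "Factorial_Ring.prime (p::nat)" "natr p = \<zero>" and w: "w \<in> carrier R" "w [^] p = w"
  obtains k :: nat where "w = natr k"
proof -
  have p2: "2 \<le> p" using p prime_ge_2_nat by blast
  let ?f = "trinomial p (\<ominus> \<one>) \<zero>"
  let ?Z = "{x \<in> carrier R. eval ?f x = \<zero>}"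
  have f: "?f \<in> carrier (poly_ring R)" "?f \<noteq> []" by (intro trinomial_closed) (auto simp: trinomial_def)
  have mem: "x \<in> ?Z" if "x \<in> carrier R" "x [^] p = x" for x
    using that eval_trinomial[OF p2, of "\<ominus> \<one>" \<zero> x] by (simp add: r_neg l_minus)
  have sub: "(\<lambda>k::nat. natr k) ` {..<p} \<subseteq> ?Z"
    using mem frobenius_prime_field[OF p] by blast
  have "inj_on (\<lambda>k::nat. natr k) {..<p}"
    using prime_field_add_pow_eq_iff[OF p] by (auto intro!: inj_onI simp: cong_less_modulus_unique_nat)
  then have "card ((\<lambda>k::nat. natr k) ` {..<p}) = p" by (simp add: card_image)
  then have "(\<lambda>k::nat. natr k) ` {..<p} = ?Z"
    using card_roots_le[OF f] sub degree_trinomial[OF p2, of "\<ominus> \<one>" \<zero>] by (metis card_seteq)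
  then show ?thesis using mem[OF w] that by blast
qed

text \<open>Dedekind's argument: take the relation at \<open>y x\<close> and subtract
  \<open>f j y\<close> times the relation at \<open>x\<close>. The term of \<open>j\<close>
  disappears and each other coefficient is multiplied by \<open>f i y - f j y\<close>, which is
  nonzero for a suitable \<open>y\<close>.\<close>

lemma characters_independent:
  assumes "finite I"
    and F: "F \<subseteq> carrier R" "\<one> \<in> F" "\<And>x y. x \<in> F \<Longrightarrow> y \<in> F \<Longrightarrow> x \<otimes> y \<in> F"
    and f: "\<And>i x. i \<in> I \<Longrightarrow> x \<in> F \<Longrightarrow> f i x \<in> carrier R" "\<And>i. i \<in> I \<Longrightarrow> f i \<one> = \<one>"
      "\<And>i x y. i \<in> I \<Longrightarrow> x \<in> F \<Longrightarrow> y \<in> F \<Longrightarrow> f i (x \<otimes> y) = f i x \<otimes> f i y"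
    and d: "\<And>i j. i \<in> I \<Longrightarrow> j \<in> I \<Longrightarrow> i \<noteq> j \<Longrightarrow> \<exists>x\<in>F. f i x \<noteq> f j x"
    and c: "\<And>i. i \<in> I \<Longrightarrow> c i \<in> carrier R" "\<And>x. x \<in> F \<Longrightarrow> (\<Oplus>i\<in>I. c i \<otimes> f i x) = \<zero>"
  shows "\<forall>i\<in>I. c i = \<zero>"
  using assms(1) f d c
proof (induction I arbitrary: c rule: finite_induct)
  case empty then show ?case by simp
next
  case (insert j I)
  note f = insert.prems(1-3) and d = insert.prems(4) and c = insert.prems(5,6)
  have cI: "c i = \<zero>" if i: "i \<in> I" for i
  proof -
    obtain y where y: "y \<in> F" "f i y \<noteq> f j y" using d[of i j] i insert.hyps by auto
    let ?c = "\<lambda>i. c i \<otimes> (f i y \<ominus> f j y)"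
    have "\<forall>i\<in>I. ?c i = \<zero>"
    proof (rule insert.IH)
      fix x assume x: "x \<in> F"
      have cl: "c k \<in> carrier R" "f k x \<in> carrier R" "f k y \<in> carrier R" if "k \<in> insert j I" for k
        using that c(1) f(1) x y by auto
      have mi: "\<ominus> f j y \<in> carrier R" using cl by simp
      have 1: "(\<Oplus>k\<in>insert j I. c k \<otimes> f k (y \<otimes> x)) = \<zero>" by (rule c(2)) (use F(3) x y in auto)
      have 2: "(\<Oplus>k\<in>insert j I. (\<ominus> f j y) \<otimes> (c k \<otimes> f k x)) = \<zero>"
        using c(2)[OF x] finsum_rdistr[of "insert j I" "\<ominus> f j y" "\<lambda>k. c k \<otimes> f k x"] insert.hyps(1) cl mi by auto
      have "(\<Oplus>k\<in>insert j I. c k \<otimes> f k (y \<otimes> x) \<oplus> (\<ominus> f j y) \<otimes> (c k \<otimes> f k x)) = \<zero>"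
        using insert.hyps(1) cl mi f(1) F(3) x y 1 2 by (subst finsum_addf) (auto simp: f(3))
      moreover have "(\<Oplus>k\<in>insert j I. c k \<otimes> f k (y \<otimes> x) \<oplus> (\<ominus> f j y) \<otimes> (c k \<otimes> f k x)) = (\<Oplus>k\<in>insert j I. ?c k \<otimes> f k x)"
      proof (rule finsum_cong')
        fix k assume k: "k \<in> insert j I"
        have "c k \<otimes> (f k y \<otimes> f k x) \<oplus> (\<ominus> f j y) \<otimes> (c k \<otimes> f k x) = c k \<otimes> (f k y \<ominus> f j y) \<otimes> f k x"
          using cl[OF k] cl[OF insertI1] by algebra
        then show "c k \<otimes> f k (y \<otimes> x) \<oplus> (\<ominus> f j y) \<otimes> (c k \<otimes> f k x) = ?c k \<otimes> f k x" using f(3)[OF k y(1) x] by simp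
      qed (use cl in auto)
      ultimately have "(\<Oplus>k\<in>insert j I. ?c k \<otimes> f k x) = \<zero>" by simp
      then show "(\<Oplus>k\<in>I. ?c k \<otimes> f k x) = \<zero>"
        using insert.hyps cl by (subst (asm) finsum_insert) (auto simp: a_minus_def r_neg)
    qed (use f d c y F in auto)
    then have "c i \<otimes> (f i y \<ominus> f j y) = \<zero>" using i by blast
    moreover have "f i y \<ominus> f j y \<noteq> \<zero>" using y f(1) i by simp
    ultimately show ?thesis using c(1) f(1) i y by (metis insertCI integral minus_closed)
  qed
  have "(\<Oplus>k\<in>insert j I. c k \<otimes> f k \<one>) = c j"
  proof -
    have "(\<Oplus>k\<in>I. c k \<otimes> f k \<one>) = (\<Oplus>k\<in>I. \<zero>)" by (rule finsum_cong') (use cI f F in auto)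
    then show ?thesis using insert.hyps c(1) f F(2) by (subst finsum_insert) auto
  qed
  then show ?case using cI c(2)[OF F(2)] by auto
qed

end

section \<open>Towers with steps of degree 1 or p\<close>

context separable_closure
begin

lemma Gam_ring_hom: "s \<in> Gam \<Longrightarrow> ring_hom_cring R R s"
  by (intro ring_hom_cring.intro ring_hom_cring_axioms.intro) (auto intro: is_cring Gam_hom)

lemma Gam_pow: "s \<in> Gam \<Longrightarrow> x \<in> carrier R \<Longrightarrow> s (x [^] (n::nat)) = s x [^] n"
  using ring_hom_ring.hom_nat_pow[OF ring_hom_ringI2[OF ring_axioms ring_axioms Gam_hom]] by blast

lemma Gam_add: "s \<in> Gam \<Longrightarrow> x \<in> carrier R \<Longrightarrow> y \<in> carrier R \<Longrightarrow> s (x \<oplus> y) = s x \<oplus> s y"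
  and Gam_mult: "s \<in> Gam \<Longrightarrow> x \<in> carrier R \<Longrightarrow> y \<in> carrier R \<Longrightarrow> s (x \<otimes> y) = s x \<otimes> s y"
  by (simp_all add: ring_hom_add[OF Gam_hom] ring_hom_mult[OF Gam_hom])

lemma Gam_one: "s \<in> Gam \<Longrightarrow> s \<one> = \<one>"
  using ring_hom_one[OF Gam_hom] .

lemma Gam_add_pow: "s \<in> Gam \<Longrightarrow> s (natr (n::nat)) = natr n"
  by (induction n) (auto simp: Gam_add Gam_one Gam_zero)

lemma fixes_on_Gam: "s \<in> fixes_on S \<Longrightarrow> s \<in> Gam"
  by (simp add: fixes_on_def)

lemma fixes_on_comp: "s \<in> fixes_on S \<Longrightarrow> t \<in> fixes_on S \<Longrightarrow> s \<circ> t \<in> fixes_on S"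
  using Gam_comp by (auto simp: fixes_on_def)

text \<open>\<open>c\<close> induces a homomorphism from the stabiliser of \<open>xs\<close> to the
  integers modulo \<open>p\<close>, and the orbit of \<open>y\<close> is in bijection with its
  image. A subgroup of a group of prime order is trivial or everything, so adjoining
  \<open>y\<close> multiplies the degree by \<open>1\<close> or \<open>p\<close>.\<close>

lemma conj_count_step:
  assumes p: "Factorial_Ring.prime p" and xs: "set xs \<subseteq> carrier R" and y: "y \<in> carrier R"
    and c: "\<And>s t. s \<in> fixes_on (set xs) \<Longrightarrow> t \<in> fixes_on (set xs) \<Longrightarrow> s y = t y \<longleftrightarrow> [c s = c t] (mod p)"
      "\<And>s t. s \<in> fixes_on (set xs) \<Longrightarrow> t \<in> fixes_on (set xs) \<Longrightarrow> [c (s \<circ> t) = c s + c t] (mod p)"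
    and N: "conj_count xs = p ^ m"
  obtains m' where "conj_count (y # xs) = p ^ m'"
proof -
  let ?H = "fixes_on (set xs)"
  let ?A = "(\<lambda>s. c s mod p) ` ?H"
  have id: "id \<in> ?H" using Gam_id by (simp add: fixes_on_def)
  have p0: "0 < p" using prime_gt_0_nat[OF p] .
  have card: "card ((\<lambda>s. s y) ` ?H) = card ?A"
    by (rule card_image_eq_kernel) (use c(1) in \<open>simp add: cong_def\<close>)
  have "card ?A = 1 \<or> card ?A = p"
  proof (cases "\<forall>s\<in>?H. c s mod p = 0")
    case True
    then have "?A = {0}" using id by auto
    then show ?thesis by simp
  next
    case False
    then obtain s where s: "s \<in> ?H" "c s mod p \<noteq> 0" by blast
    have c0: "[c id = 0] (mod p)" using c(2)[OF id id] by (metis comp_id cong_add_lcancel_0_nat cong_sym)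
    have pw: "s ^^ k \<in> ?H \<and> [c (s ^^ k) = k * c s] (mod p)" for k
    proof (induction k)
      case 0 then show ?case using id c0 by (simp add: id_def)
    next
      case (Suc k)
      have "[c (s \<circ> s ^^ k) = c s + c (s ^^ k)] (mod p)" using c(2) s(1) Suc by blast
      also have "[c s + c (s ^^ k) = c s + k * c s] (mod p)" using Suc.IH by (intro cong_add[OF cong_refl]) blast
      finally show ?case
        using fixes_on_comp[OF s(1)] Suc.IH unfolding funpow.simps(2) mult_Suc by blast
    qed
    have "coprime (c s) p" using s(2) p by (metis coprime_commute dvd_imp_mod_0 prime_imp_coprime)
    then obtain x where x: "[c s * x = Suc 0] (mod p)" using cong_solve_coprime_nat by blast
    have "r \<in> ?A" if r: "r < p" for r
    proof -
      have "[c (s ^^ (x * r)) = (x * r) * c s] (mod p)" using pw by blast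
      also have "(x * r) * c s = (c s * x) * r" by simp
      also have "[(c s * x) * r = Suc 0 * r] (mod p)" using x by (intro cong_mult) auto
      finally have "c (s ^^ (x * r)) mod p = r" using r by (simp add: cong_def)
      then show ?thesis using pw[of "x * r"] by force
    qed
    then have "?A = {..<p}" using p0 by auto
    then show ?thesis by simp
  qed
  then show ?thesis
    using conj_count_Cons[OF xs y] N card that[of m] that[of "Suc m"] by (auto simp: mult.commute)
qed

text \<open>Write \<open>s y\<close> as \<open>\<zeta> ^ c(s)\<close> times \<open>y\<close>. The
  exponents add up under composition because \<open>\<zeta>\<close> lies in \<open>K\<close> and is
  therefore fixed.\<close>

lemma conj_count_kummer:
  assumes p: "Factorial_Ring.prime p" and xs: "set xs \<subseteq> carrier R" and y: "y \<in> carrier R" "y \<noteq> \<zero>"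
    and z: "\<zeta> \<in> K" "\<zeta> [^] p = \<one>" "\<And>k::nat. 0 < k \<Longrightarrow> k < p \<Longrightarrow> \<zeta> [^] k \<noteq> \<one>"
    and fx: "\<And>s. s \<in> fixes_on (set xs) \<Longrightarrow> s (y [^] p) = y [^] p"
    and N: "conj_count xs = p ^ m"
  obtains m' where "conj_count (y # xs) = p ^ m'"
proof -
  let ?H = "fixes_on (set xs)"
  have p2: "2 \<le> p" and p0: "0 < p" using prime_ge_2_nat[OF p] by auto
  have zc: "\<zeta> \<in> carrier R" using z(1) K_carrier by blast
  define c where "c s = (SOME k::nat. s y = \<zeta> [^] k \<otimes> y)" for s
  have c: "s y = \<zeta> [^] c s \<otimes> y" if s: "s \<in> ?H" for s
  proof -
    have sG: "s \<in> Gam" using s by (simp add: fixes_on_def)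
    have sy: "s y \<in> carrier R" "(s y) [^] p = y [^] p" using fx[OF s] Gam_pow[OF sG y(1)] Gam_closed[OF sG y(1)] by auto
    obtain v where v: "v \<in> carrier R" "v [^] p = \<one>" "s y = v \<otimes> y"
      using pow_eq_imp_root_of_unity[OF sy(1) y sy(2)] .
    then obtain k :: nat where "s y = \<zeta> [^] k \<otimes> y" using pth_roots_of_unity[OF zc z(2,3) p2 v(1,2)] by metis
    then show ?thesis unfolding c_def by (rule someI)
  qed
  have z_fix: "s (\<zeta> [^] (k::nat)) = \<zeta> [^] k" if "s \<in> ?H" for s k
    using that Gam_pow[of s \<zeta> k] zc Gam_fix[of s \<zeta>] z(1) by (auto simp: fixes_on_def)
  show ?thesis
  proof (rule conj_count_step[OF p xs y(1) _ _ N])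
    fix s t assume st: "s \<in> ?H" "t \<in> ?H"
    have "s y = t y \<longleftrightarrow> \<zeta> [^] c s = \<zeta> [^] c t"
      unfolding c[OF st(1)] c[OF st(2)] using y zc by (simp add: m_rcancel)
    then show "s y = t y \<longleftrightarrow> [c s = c t] (mod p)" using root_pow_eq_iff[OF zc z(2,3) p0] by simp
    have "\<zeta> [^] c (s \<circ> t) \<otimes> y = s (t y)" using c[OF fixes_on_comp[OF st]] by simp
    also have "\<dots> = \<zeta> [^] c t \<otimes> (\<zeta> [^] c s \<otimes> y)"
      using c[OF st(1)] c[OF st(2)] st Gam_mult[of s "\<zeta> [^] c t" y] z_fix[OF st(1)] zc y(1) by (simp add: fixes_on_def)
    also have "\<dots> = \<zeta> [^] (c s + c t) \<otimes> y" using zc y(1) by (simp add: nat_pow_mult[symmetric] m_ac)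
    finally have "\<zeta> [^] c (s \<circ> t) = \<zeta> [^] (c s + c t)" using y zc by (simp add: m_rcancel)
    then show "[c (s \<circ> t) = c s + c t] (mod p)" using root_pow_eq_iff[OF zc z(2,3) p0] by simp
  qed (rule that)
qed

text \<open>The difference of two solutions is fixed by Frobenius, hence lies in the prime
  field.\<close>

lemma artin_schreier_translate:
  assumes p: "Factorial_Ring.prime (p::nat)" "natr p = \<zero>" and y: "y \<in> carrier R" "w \<in> carrier R" "d \<in> carrier R"
    and e: "y [^] p = y \<oplus> d" "w [^] p = w \<oplus> d"
  obtains k :: nat where "w = y \<oplus> natr k"
proof -
  let ?u = "w \<ominus> y"
  have "w = ?u \<oplus> y" using y by (simp add: a_minus_def a_assoc l_neg)
  then have "w [^] p = ?u [^] p \<oplus> y [^] p" using frobenius_add[OF p, of ?u y] y by simp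
  then have "w \<oplus> d = ?u [^] p \<oplus> (y \<oplus> d)" using e by simp
  moreover have "w \<oplus> d = ?u \<oplus> (y \<oplus> d)" using y by algebra
  ultimately have "?u [^] p = ?u" using y by (metis a_closed add.right_cancel minus_closed nat_pow_closed)
  then obtain k :: nat where "?u = natr k" using frobenius_fixed[OF p] y minus_closed by metis
  then show ?thesis using that[of k] y \<open>w = ?u \<oplus> y\<close> by (metis add.m_comm minus_closed)
qed

lemma conj_count_artin_schreier:
  assumes p: "Factorial_Ring.prime (p::nat)" "natr p = \<zero>" and xs: "set xs \<subseteq> carrier R"
    and y: "y \<in> carrier R" "d \<in> carrier R" "y [^] p = y \<oplus> d"
    and fx: "\<And>s. s \<in> fixes_on (set xs) \<Longrightarrow> s d = d"
    and N: "conj_count xs = p ^ m"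
  obtains m' where "conj_count (y # xs) = p ^ m'"
proof -
  let ?H = "fixes_on (set xs)"
  define c where "c s = (SOME k::nat. s y = y \<oplus> natr k)" for s
  have c: "s y = y \<oplus> natr (c s)" if s: "s \<in> ?H" for s
  proof -
    have sG: "s \<in> Gam" using s by (simp add: fixes_on_def)
    have "s y [^] p = s y \<oplus> d" using Gam_pow[OF sG y(1), of p] y(3) Gam_add[OF sG y(1,2)] fx[OF s] by simp
    then obtain k :: nat where "s y = y \<oplus> natr k"
      using artin_schreier_translate[OF p y(1) Gam_closed[OF sG y(1)] y(2,3)] by blast
    then show ?thesis unfolding c_def by (rule someI)
  qed
  show ?thesis
  proof (rule conj_count_step[OF p(1) xs y(1) _ _ N])
    fix s t assume st: "s \<in> ?H" "t \<in> ?H"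
    have "s y = t y \<longleftrightarrow> natr (c s) = natr (c t)"
      unfolding c[OF st(1)] c[OF st(2)] using y by simp
    then show "s y = t y \<longleftrightarrow> [c s = c t] (mod p)" using prime_field_add_pow_eq_iff[OF p] by simp
    have sG: "s \<in> Gam" using st by (simp add: fixes_on_def)
    have "y \<oplus> natr (c (s \<circ> t)) = s (t y)" using c[OF fixes_on_comp[OF st]] by simp
    also have "\<dots> = (y \<oplus> natr (c s)) \<oplus> natr (c t)"
      using c[OF st(1)] c[OF st(2)] y(1) by (simp add: Gam_add[OF sG] Gam_add_pow[OF sG])
    also have "\<dots> = y \<oplus> natr (c s + c t)" using y(1) by (simp add: a_assoc add.nat_pow_mult)
    finally have "natr (c (s \<circ> t)) = natr (c s + c t)" using y by simp
    then show "[c (s \<circ> t) = c s + c t] (mod p)" using prime_field_add_pow_eq_iff[OF p] by simp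
  qed (rule that)
qed

end

section \<open>Resolvents of a character\<close>

text \<open>A character \<open>e\<close> of the Galois group with values in \<open>\<int>/p\<close> and with open kernel: \<open>e\<close> is trivial
  on the stabiliser of the finite list \<open>xs\<close>.\<close>
locale galois_character = separable_closure +
  fixes p :: nat and e :: "('a \<Rightarrow> 'a) \<Rightarrow> nat" and xs :: "'a list"
  assumes p: "Factorial_Ring.prime p"
    and e_cong: "\<And>s t. s \<in> Gam \<Longrightarrow> t \<in> Gam \<Longrightarrow> (\<And>x. x \<in> carrier R \<Longrightarrow> s x = t x) \<Longrightarrow> e s = e t"
    and e_comp: "\<And>s t. s \<in> Gam \<Longrightarrow> t \<in> Gam \<Longrightarrow> [e (s \<circ> t) = e s + e t] (mod p)"
    and xs: "set xs \<subseteq> carrier R"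
    and e_ker: "\<And>s. s \<in> fixes_on (set xs) \<Longrightarrow> [e s = 0] (mod p)"
begin

text \<open>A left coset of the stabiliser of \<open>xs\<close> is encoded by the common image of
  \<open>xs\<close> under its elements, so sums over cosets become finite sums over tuples.\<close>

definition "cosets = (\<lambda>s. map s xs) ` Gam"

definition "coset_rep v = (SOME s. s \<in> Gam \<and> map s xs = v)"

definition "coset_sum T = (\<Oplus>v\<in>cosets. T (coset_rep v))"

definition "fixed_ring = {y \<in> carrier R. \<forall>s\<in>fixes_on (set xs). s y = y}"

lemma coset_rep:
  assumes v: "v \<in> cosets" shows "coset_rep v \<in> Gam" "map (coset_rep v) xs = v"
proof -
  obtain s where "s \<in> Gam \<and> map s xs = v" using v by (auto simp: cosets_def)
  then have "coset_rep v \<in> Gam \<and> map (coset_rep v) xs = v"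
    unfolding coset_rep_def by (rule someI[where P="\<lambda>s. s \<in> Gam \<and> map s xs = v"])
  then show "coset_rep v \<in> Gam" "map (coset_rep v) xs = v" by auto
qed

lemma finite_cosets: "finite cosets"
  unfolding cosets_def by (rule finite_conj[OF xs])

lemma same_coset:
  assumes st: "s \<in> Gam" "t \<in> Gam" "map s xs = map t xs"
  obtains h where "h \<in> fixes_on (set xs)" "\<And>x. x \<in> carrier R \<Longrightarrow> s x = t (h x)"
proof -
  obtain r where r: "r \<in> Gam" "\<And>x. x \<in> carrier R \<Longrightarrow> r (t x) = x" "\<And>x. x \<in> carrier R \<Longrightarrow> t (r x) = x"
    using Gam_inv[OF st(2)] by blast
  have "r (s x) = x" if "x \<in> set xs" for x
    using st(3) r(2)[of x] that xs by (auto simp: map_eq_conv)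
  then have "r \<circ> s \<in> fixes_on (set xs)" using Gam_comp[OF r(1) st(1)] by (simp add: fixes_on_def)
  moreover have "s x = t ((r \<circ> s) x)" if "x \<in> carrier R" for x using r(3) Gam_closed[OF st(1) that] by simp
  ultimately show ?thesis using that by blast
qed

lemma e_same_coset:
  assumes st: "s \<in> Gam" "t \<in> Gam" "map s xs = map t xs"
  shows "[e s = e t] (mod p)"
proof -
  obtain h where h: "h \<in> fixes_on (set xs)" "\<And>x. x \<in> carrier R \<Longrightarrow> s x = t (h x)" using same_coset[OF st] by blast
  have hG: "h \<in> Gam" using h(1) by (simp add: fixes_on_def)
  have "e s = e (t \<circ> h)" using h(2) st Gam_comp[OF st(2) hG] by (intro e_cong) auto
  also have "[\<dots> = e t + e h] (mod p)" by (rule e_comp[OF st(2) hG])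
  also have "[e t + e h = e t + 0] (mod p)" using e_ker[OF h(1)] by (intro cong_add) auto
  finally show ?thesis by simp
qed

lemma fixed_ring_same_coset:
  assumes "s \<in> Gam" "t \<in> Gam" "map s xs = map t xs" "y \<in> fixed_ring"
  shows "s y = t y"
proof -
  obtain h where "h \<in> fixes_on (set xs)" "\<And>x. x \<in> carrier R \<Longrightarrow> s x = t (h x)" using same_coset[OF assms(1-3)] by blast
  then show ?thesis using assms(4) by (auto simp: fixed_ring_def)
qed

text \<open>Left multiplication by \<open>s\<close> permutes the cosets, and the hypothesis that
  \<open>T\<close> is constant on cosets makes the choice of representatives harmless.\<close>

lemma coset_sum_shift:
  assumes s: "s \<in> Gam" and T: "\<And>t. t \<in> Gam \<Longrightarrow> T t \<in> carrier R"
    "\<And>t t'. t \<in> Gam \<Longrightarrow> t' \<in> Gam \<Longrightarrow> map t xs = map t' xs \<Longrightarrow> T t = T t'"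
  shows "coset_sum (\<lambda>t. T (s \<circ> t)) = coset_sum T"
proof -
  have sub: "map s ` cosets \<subseteq> cosets"

  proof
    fix v assume "v \<in> map s ` cosets"
    then obtain t where "t \<in> Gam" "v = map (s \<circ> t) xs" by (auto simp: cosets_def)
    then show "v \<in> cosets" using Gam_comp[OF s] unfolding cosets_def by blast
  qed
  have inj: "inj_on (map s) cosets"
  proof (rule inj_onI)
    fix v w assume vw: "v \<in> cosets" "w \<in> cosets" "map s v = map s w"
    have "set v \<union> set w \<subseteq> carrier R" using vw subsetD[OF xs] Gam_closed by (auto simp: cosets_def)
    then show "v = w" using inj_on_map_eq_map[of s v w] inj_on_subset[OF Gam_inj[OF s]] vw(3) by blast
  qed
  have im: "map s ` cosets = cosets" using endo_inj_surj[OF finite_cosets sub inj] .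
  have mem: "map s v \<in> cosets" if "v \<in> cosets" for v using sub that by blast
  have "coset_sum T = (\<Oplus>v\<in>map s ` cosets. T (coset_rep v))" by (simp add: coset_sum_def im)
  also have "\<dots> = (\<Oplus>v\<in>cosets. T (coset_rep (map s v)))"
    using inj im coset_rep(1) T(1) by (intro finsum_reindex) auto
  also have "\<dots> = coset_sum (\<lambda>t. T (s \<circ> t))"
    unfolding coset_sum_def
  proof (rule finsum_cong')
    fix v assume v: "v \<in> cosets"
    have "map (coset_rep (map s v)) xs = map s v" by (rule coset_rep(2)[OF mem[OF v]])
    also have "\<dots> = map (s \<circ> coset_rep v) xs" using coset_rep(2)[OF v] by (metis map_map)
    finally show "T (coset_rep (map s v)) = T (s \<circ> coset_rep v)"
      using T(2) coset_rep(1)[OF mem[OF v]] Gam_comp[OF s coset_rep(1)[OF v]] by blast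
  qed (use T(1) Gam_comp[OF s] coset_rep(1) in auto)
  finally show ?thesis by simp
qed

text \<open>Coset representatives are multiplicative on \<open>fixed_ring\<close>, and different
  cosets already disagree on an entry of \<open>xs\<close>, so they are independent
  characters.\<close>

lemma coset_sum_nonzero:
  assumes c: "\<And>t. t \<in> Gam \<Longrightarrow> c t \<in> carrier R - {\<zero>}"
  obtains y where "y \<in> fixed_ring" "coset_sum (\<lambda>t. c t \<otimes> t y) \<noteq> \<zero>"
proof (rule ccontr)
  assume "\<not> thesis"
  then have z: "\<And>y. y \<in> fixed_ring \<Longrightarrow> (\<Oplus>v\<in>cosets. c (coset_rep v) \<otimes> coset_rep v y) = \<zero>"
    using that unfolding coset_sum_def by blast
  have "\<forall>v\<in>cosets. c (coset_rep v) = \<zero>"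
  proof (rule characters_independent[OF finite_cosets, where F=fixed_ring and f=coset_rep])
    show "fixed_ring \<subseteq> carrier R" by (auto simp: fixed_ring_def)
    show "\<one> \<in> fixed_ring" by (auto simp: fixed_ring_def fixes_on_def Gam_one)
    show "x \<otimes> y \<in> fixed_ring" if "x \<in> fixed_ring" "y \<in> fixed_ring" for x y
      using that by (auto simp: fixed_ring_def) (metis Gam_mult fixes_on_Gam)
    show "\<exists>x\<in>fixed_ring. coset_rep v x \<noteq> coset_rep w x" if vw: "v \<in> cosets" "w \<in> cosets" "v \<noteq> w" for v w
    proof -
      have "map (coset_rep v) xs \<noteq> map (coset_rep w) xs" using coset_rep(2) vw by simp
      then obtain x where "x \<in> set xs" "coset_rep v x \<noteq> coset_rep w x" by (auto simp: map_eq_conv)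
      moreover have "set xs \<subseteq> fixed_ring" using xs by (auto simp: fixed_ring_def fixes_on_def)
      ultimately show ?thesis by blast
    qed
  qed (use coset_rep Gam_closed Gam_one Gam_mult c z in \<open>auto simp: fixed_ring_def\<close>)
  moreover have "map id xs \<in> cosets" unfolding cosets_def by (rule imageI[OF Gam_id])
  ultimately show False using c coset_rep(1) by blast
qed

text \<open>Hilbert 90 by Lagrange resolvents.\<close>
lemma kummer_element:
  assumes z: "\<zeta> \<in> K" "\<zeta> [^] p = \<one>" "\<And>k::nat. 0 < k \<Longrightarrow> k < p \<Longrightarrow> \<zeta> [^] k \<noteq> \<one>"
  obtains \<alpha> where "\<alpha> \<in> carrier R" "\<alpha> \<noteq> \<zero>" "\<And>s. s \<in> Gam \<Longrightarrow> \<zeta> [^] e s \<otimes> s \<alpha> = \<alpha>"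
proof -
  have p0: "0 < p" using prime_gt_0_nat[OF p] .
  have zc: "\<zeta> \<in> carrier R" using z(1) K_carrier by blast
  have zn: "\<zeta> \<noteq> \<zero>" using z(2) p0 nat_pow_zero[of p] by auto
  have zk: "\<zeta> [^] k \<noteq> \<zero>" for k :: nat using zn zc by (induction k) (auto simp: integral_iff)
  obtain y where y: "y \<in> fixed_ring" "coset_sum (\<lambda>t. \<zeta> [^] e t \<otimes> t y) \<noteq> \<zero>"
    using coset_sum_nonzero[of "\<lambda>t. \<zeta> [^] e t"] zk zc by auto
  have yc: "y \<in> carrier R" using y by (simp add: fixed_ring_def)
  let ?T = "\<lambda>t. \<zeta> [^] e t \<otimes> t y"
  have Tc: "?T t \<in> carrier R" if "t \<in> Gam" for t using that zc yc Gam_closed by auto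
  show ?thesis
  proof (rule that[of "coset_sum ?T"])
    show cc: "coset_sum ?T \<in> carrier R" unfolding coset_sum_def using Tc coset_rep(1) by (intro finsum_closed) auto
    show "coset_sum ?T \<noteq> \<zero>" by (rule y(2))
    fix s assume s: "s \<in> Gam"
    interpret h: ring_hom_cring R R s by (rule Gam_ring_hom[OF s])
    have "s (coset_sum ?T) = (\<Oplus>v\<in>cosets. s (?T (coset_rep v)))"
      unfolding coset_sum_def using Tc coset_rep(1) by (subst h.hom_finsum) (auto simp: comp_def)
    then have "\<zeta> [^] e s \<otimes> s (coset_sum ?T) = (\<Oplus>v\<in>cosets. \<zeta> [^] e s \<otimes> s (?T (coset_rep v)))"
      using finite_cosets Tc coset_rep(1) Gam_closed[OF s] zc by (simp add: finsum_rdistr Pi_def)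
    \<comment> \<open>\<open>s\<close> fixes \<open>\<zeta>\<close> and \<open>e\<close> is additive
      modulo \<open>p\<close>, so the factor \<open>\<zeta> ^ e(s)\<close> turns the image of the
      term at \<open>t\<close> into the term at \<open>s \<circ> t\<close>; the sum is only
      permuted.\<close>
    also have "\<dots> = coset_sum (\<lambda>t. ?T (s \<circ> t))"
      unfolding coset_sum_def
    proof (rule finsum_cong')
      fix v assume "v \<in> cosets"
      then have t: "coset_rep v \<in> Gam" by (rule coset_rep(1))
      have tyc: "coset_rep v y \<in> carrier R" using Gam_closed[OF t yc] .
      have "\<zeta> [^] e (s \<circ> coset_rep v) = \<zeta> [^] (e s + e (coset_rep v))"
        using root_pow_eq_iff[OF zc z(2,3) p0] e_comp[OF s t] by blast
      then show "\<zeta> [^] e s \<otimes> s (?T (coset_rep v)) = ?T (s \<circ> coset_rep v)"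
        using zc tyc Gam_closed[OF s] Gam_fix[OF s z(1)]
        by (simp add: Gam_mult[OF s] Gam_pow[OF s] nat_pow_mult[symmetric] m_assoc)
    qed (use Tc[OF Gam_comp[OF s coset_rep(1)]] in auto)
    also have "\<dots> = coset_sum ?T"
    proof (rule coset_sum_shift[OF s])
      fix t t' assume t: "t \<in> Gam" "t' \<in> Gam" "map t xs = map t' xs"
      show "?T t = ?T t'"
        using root_pow_eq_iff[OF zc z(2,3) p0] e_same_coset[OF t] fixed_ring_same_coset[OF t y(1)] by metis
    qed (rule Tc)
    finally show "\<zeta> [^] e s \<otimes> s (coset_sum ?T) = coset_sum ?T" .
  qed
qed

text \<open>Additive Hilbert 90. The trace \<open>u\<close> of a suitable \<open>y\<close> is
  nonzero and fixed by \<open>Gam\<close>. Weighting its terms by \<open>e t\<close> gives a sum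
  \<open>w\<close> with \<open>s w + e(s) u = w\<close>, and \<open>w / u\<close> is the required
  element.\<close>

lemma artin_schreier_element:
  assumes ch: "natr p = \<zero>"
  obtains x where "x \<in> carrier R" "\<And>s. s \<in> Gam \<Longrightarrow> x = s x \<oplus> natr (e s)"
proof -
  obtain y where y: "y \<in> fixed_ring" "coset_sum (\<lambda>t. \<one> \<otimes> t y) \<noteq> \<zero>"
    using coset_sum_nonzero[of "\<lambda>t. \<one>"] by auto
  have yc: "y \<in> carrier R" using y by (simp add: fixed_ring_def)
  have tyc: "t y \<in> carrier R" if "t \<in> Gam" for t using that yc Gam_closed by auto
  define u where "u = coset_sum (\<lambda>t. t y)"
  have "coset_sum (\<lambda>t. \<one> \<otimes> t y) = u"
    unfolding u_def coset_sum_def by (rule finsum_cong') (use tyc coset_rep(1) in auto)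
  then have un: "u \<noteq> \<zero>" using y(2) by simp
  have uc: "u \<in> carrier R" unfolding u_def coset_sum_def using tyc coset_rep(1) by (intro finsum_closed) auto
  let ?T = "\<lambda>t. natr (e t) \<otimes> t y"
  have Tc: "?T t \<in> carrier R" if "t \<in> Gam" for t using that tyc by simp
  let ?w = "coset_sum ?T"
  have wc: "?w \<in> carrier R" unfolding coset_sum_def using Tc coset_rep(1) by (intro finsum_closed) auto
  have iu: "inv u \<in> carrier R" "inv u \<otimes> u = \<one>" "u \<otimes> inv u = \<one>"
    using inverse_nonzero[OF uc un] by auto
  have su: "coset_sum (\<lambda>t. (s \<circ> t) y) = u" if s: "s \<in> Gam" for s
    unfolding u_def using coset_sum_shift[OF s, of "\<lambda>t. t y"] tyc fixed_ring_same_coset y(1) by blast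
  have su': "s u = u" if s: "s \<in> Gam" for s
  proof -
    interpret h: ring_hom_cring R R s by (rule Gam_ring_hom[OF s])
    have "s u = coset_sum (\<lambda>t. (s \<circ> t) y)"
      unfolding u_def coset_sum_def using tyc coset_rep(1) by (subst h.hom_finsum) (auto simp: comp_def)
    then show ?thesis using su[OF s] by simp
  qed
  have siu: "s (inv u) = inv u" if s: "s \<in> Gam" for s
  proof -
    have "s (inv u) \<otimes> u = \<one>" using Gam_mult[OF s iu(1) uc] su'[OF s] iu(2) Gam_one[OF s] by simp
    then show ?thesis using iu uc Gam_closed[OF s iu(1)] by (metis inv_unique' m_comm)
  qed
  have sw: "s ?w \<oplus> natr (e s) \<otimes> u = ?w" if s: "s \<in> Gam" for s
  proof -
    interpret h: ring_hom_cring R R s by (rule Gam_ring_hom[OF s])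
    have "s ?w = (\<Oplus>v\<in>cosets. s (?T (coset_rep v)))"
      unfolding coset_sum_def using Tc coset_rep(1) by (subst h.hom_finsum) (auto simp: comp_def)
    moreover have "natr (e s) \<otimes> u = (\<Oplus>v\<in>cosets. natr (e s) \<otimes> (s \<circ> coset_rep v) y)"
      using su[OF s] finite_cosets tyc Gam_comp[OF s] coset_rep(1) unfolding coset_sum_def
      by (subst finsum_rdistr[symmetric]) auto
    ultimately have "s ?w \<oplus> natr (e s) \<otimes> u
        = (\<Oplus>v\<in>cosets. s (?T (coset_rep v)) \<oplus> natr (e s) \<otimes> (s \<circ> coset_rep v) y)"
      using Tc tyc coset_rep(1) Gam_comp[OF s] Gam_closed[OF s] by (subst finsum_addf) auto
    also have "\<dots> = coset_sum (\<lambda>t. ?T (s \<circ> t))"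
      unfolding coset_sum_def
    proof (rule finsum_cong')
      fix v assume "v \<in> cosets"
      then have t: "coset_rep v \<in> Gam" by (rule coset_rep(1))
      have stc: "s (coset_rep v y) \<in> carrier R" "coset_rep v y \<in> carrier R" using Gam_closed[OF s] tyc[OF t] by auto
      have "natr (e (s \<circ> coset_rep v)) = natr (e s + e (coset_rep v))"
        using prime_field_add_pow_eq_iff[OF p ch] e_comp[OF s t] by blast
      also have "\<dots> = natr (e (coset_rep v)) \<oplus> natr (e s)"
        by (simp add: add.nat_pow_mult add.commute)
      finally show "s (?T (coset_rep v)) \<oplus> natr (e s) \<otimes> (s \<circ> coset_rep v) y = ?T (s \<circ> coset_rep v)"
        using stc by (simp add: Gam_mult[OF s] Gam_add_pow[OF s] l_distr del: add.nat_pow_mult)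
    qed (use Tc[OF Gam_comp[OF s coset_rep(1)]] in auto)
    also have "\<dots> = ?w"
    proof (rule coset_sum_shift[OF s])
      fix t t' assume t: "t \<in> Gam" "t' \<in> Gam" "map t xs = map t' xs"
      show "?T t = ?T t'"
        using prime_field_add_pow_eq_iff[OF p ch] e_same_coset[OF t] fixed_ring_same_coset[OF t y(1)] by metis
    qed (rule Tc)
    finally show ?thesis .
  qed
  show ?thesis
  proof (rule that[of "inv u \<otimes> ?w"])
    show "inv u \<otimes> ?w \<in> carrier R" using iu wc by simp
    fix s assume s: "s \<in> Gam"
    let ?a = "natr (e s)"
    have a: "?a \<in> carrier R" by simp
    have swc: "s ?w \<in> carrier R" using Gam_closed[OF s wc] .
    have "inv u \<otimes> ?w = inv u \<otimes> (s ?w \<oplus> ?a \<otimes> u)" using sw[OF s] by simp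
    also have "\<dots> = inv u \<otimes> s ?w \<oplus> (inv u \<otimes> u) \<otimes> ?a" using iu(1) uc swc a by (simp add: r_distr m_ac del: add.nat_pow_Suc)
    also have "\<dots> = s (inv u \<otimes> ?w) \<oplus> ?a" using iu(2) a Gam_mult[OF s iu(1) wc] siu[OF s] by simp
    finally show "inv u \<otimes> ?w = s (inv u \<otimes> ?w) \<oplus> ?a" .
  qed
qed

end

section \<open>Unipotent representations of the affine group\<close>

text \<open>The substitution \<open>f(T) \<mapsto> (1 + T) ^ b * f((1 + T) ^ u - 1)\<close> is an action (with the order of
  composition reversed on matrices) of the affine group \<open>x \<mapsto> b + u x\<close>; the polynomial below is the image of \<open>T ^ i\<close>.\<close>
definition affine_row :: "nat \<Rightarrow> nat \<Rightarrow> nat \<Rightarrow> int poly" where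
  "affine_row b u i = [:1, 1:] ^ b * ([:1, 1:] ^ u - 1) ^ i"

abbreviation "affine_entry b u i j \<equiv> Polynomial.coeff (affine_row b u i) j"

lemma pcompose_power: "pcompose (f ^ n) g = pcompose f g ^ n" for f g :: "int poly"
  by (induction n) (auto simp: pcompose_mult pcompose_1)

text \<open>Following \<open>x \<mapsto> b' + u' x\<close> by \<open>x \<mapsto> b + u x\<close>
  gives \<open>x \<mapsto> (b + u b') + u u' x\<close>, and substituting
  \<open>(1 + T) ^ u - 1\<close> for \<open>T\<close> replaces \<open>1 + T\<close> by
  \<open>(1 + T) ^ u\<close>.\<close>

lemma affine_row_comp:
  "affine_row (b + u * b') (u * u') i = [:1, 1:] ^ b * pcompose (affine_row b' u' i) ([:1, 1:] ^ u - 1)"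
proof -
  have l: "pcompose [:1, 1:] ([:1, 1:] ^ u - 1) = ([:1, 1:] ^ u :: int poly)"
    by (simp add: pcompose_pCons)
  show ?thesis
    by (simp add: affine_row_def pcompose_mult pcompose_power pcompose_diff pcompose_1 l power_mult power_add mult.assoc)
qed

lemma pcompose_as_sum: "pcompose f g = (\<Sum>l\<le>Polynomial.degree f. smult (Polynomial.coeff f l) (g ^ l))" for f g :: "int poly"
proof -
  have "pcompose f g = pcompose (\<Sum>l\<le>Polynomial.degree f. Polynomial.monom (Polynomial.coeff f l) l) g"
    by (simp add: poly_as_sum_of_monoms)
  also have "\<dots> = (\<Sum>l\<le>Polynomial.degree f. smult (Polynomial.coeff f l) (g ^ l))"
    unfolding pcompose_sum
  proof (rule sum.cong[OF refl])
    fix l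
    have "Polynomial.monom (Polynomial.coeff f l) l = smult (Polynomial.coeff f l) ([:0, 1:] ^ l)"
      by (simp add: monom_altdef)
    then show "pcompose (Polynomial.monom (Polynomial.coeff f l) l) g = smult (Polynomial.coeff f l) (g ^ l)"
      by (simp add: pcompose_smult pcompose_power pcompose_pCons)
  qed
  finally show ?thesis .
qed

lemma coeff_one_plus_T_power: "Polynomial.coeff ([:1, 1:] ^ n :: int poly) k = int (n choose k)"
proof (cases "k \<le> n")
  case True then show ?thesis by (simp add: coeff_linear_poly_power)
next
  case False
  have "Polynomial.degree ([:1, 1:] ^ n :: int poly) \<le> n" using degree_power_le[of "[:1, 1:] :: int poly" n] by simp
  then show ?thesis using False by (simp add: coeff_eq_0 binomial_eq_0)
qed

lemma coeff_1_mult: "Polynomial.coeff (f * g) 1 = Polynomial.coeff f 0 * Polynomial.coeff g 1 + Polynomial.coeff f 1 * Polynomial.coeff g 0"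
  for f g :: "int poly"
  by (simp add: coeff_mult)

lemma coeff_1_power: "Polynomial.coeff (f ^ n) 1 = int n * Polynomial.coeff f 0 ^ (n - 1) * Polynomial.coeff f 1"
  for f :: "int poly"
proof (induction n)
  case (Suc n)
  then show ?case by (cases n) (auto simp: coeff_1_mult coeff_0_power coeff_mult_0 algebra_simps simp del: One_nat_def)
qed auto

text \<open>Since \<open>(1 + T) ^ u - 1 = T q\<close> with
  \<open>q = u + (u choose 2) T + ...\<close>, row \<open>i\<close> is \<open>T ^ i\<close> times
  \<open>(1 + T) ^ b q ^ i\<close>. The first factor gives triangularity, the two lowest
  coefficients of the second are the diagonal and superdiagonal entries.\<close>

lemma affine_row_shift:
  obtains h where "affine_row b u i = Polynomial.monom 1 i * h"
    "Polynomial.coeff h 0 = int u ^ i" "Polynomial.coeff h 1 = int b * int u ^ i + int i * int u ^ (i - 1) * int (u choose 2)"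
proof -
  let ?g = "[:1, 1:] ^ u - 1 :: int poly"
  obtain q where q: "?g = pCons 0 q"
  proof -
    have "Polynomial.coeff ?g 0 = 0" by (simp add: coeff_0_power)
    then show ?thesis using that by (metis coeff_pCons_0 pCons_cases)
  qed
  have qc: "Polynomial.coeff q k = int (u choose Suc k)" for k
  proof -
    have "Polynomial.coeff q k = Polynomial.coeff ?g (Suc k)" unfolding q by simp
    then show ?thesis by (simp add: coeff_one_plus_T_power)
  qed
  have "?g = Polynomial.monom 1 1 * q" unfolding q by (simp add: monom_altdef)
  then have "?g ^ i = Polynomial.monom 1 i * q ^ i" by (simp add: power_mult_distrib monom_power)
  then have "affine_row b u i = Polynomial.monom 1 i * ([:1, 1:] ^ b * q ^ i)"
    by (simp add: affine_row_def algebra_simps)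
  moreover have "Polynomial.coeff ([:1, 1:] ^ b * q ^ i) 0 = int u ^ i"
    by (simp add: coeff_mult_0 coeff_0_power qc)
  moreover have "Polynomial.coeff ([:1, 1:] ^ b * q ^ i) 1 = int b * int u ^ i + int i * int u ^ (i - 1) * int (u choose 2)"
    using coeff_1_mult[of "[:1, 1:] ^ b" "q ^ i"] qc[of 0] qc[of 1]
    by (simp add: coeff_1_power[of q i, simplified] coeff_0_power coeff_one_plus_T_power numeral_2_eq_2)
  ultimately show ?thesis by (rule that)
qed

lemma affine_row_below: "j < i \<Longrightarrow> affine_entry b u i j = 0"
  by (rule affine_row_shift[of b u i]) (simp add: coeff_monom_mult)

lemma affine_row_diag: "affine_entry b u i i = int u ^ i"
  by (rule affine_row_shift[of b u i]) (simp add: coeff_monom_mult)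

lemma affine_row_super:
  "affine_entry b u i (Suc i) = int b * int u ^ i + int i * int u ^ (i - 1) * int (u choose 2)"
  by (rule affine_row_shift[of b u i]) (simp add: coeff_monom_mult)

text \<open>Expand the inner row in powers of \<open>T\<close> and let \<open>(b, u)\<close> act on
  each power: this is a matrix product in which the factor of \<open>(b', u')\<close> comes first.
  Triangularity cuts the sum down to \<open>i..j\<close>.\<close>

lemma affine_row_comp_coeff:
  "affine_entry (b + u * b') (u * u') i j =
    (\<Sum>l=i..j. affine_entry b' u' i l * affine_entry b u l j)"
proof -
  let ?f = "affine_row b' u' i"
  have "affine_row (b + u * b') (u * u') i = (\<Sum>l\<le>Polynomial.degree ?f. smult (Polynomial.coeff ?f l) (affine_row b u l))"
    unfolding affine_row_comp pcompose_as_sum sum_distrib_left by (simp add: affine_row_def)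
  then have "affine_entry (b + u * b') (u * u') i j
     = (\<Sum>l\<le>Polynomial.degree ?f. Polynomial.coeff ?f l * affine_entry b u l j)"
    by (simp add: coeff_sum)
  also have "\<dots> = (\<Sum>l\<le>max (Polynomial.degree ?f) j. Polynomial.coeff ?f l * affine_entry b u l j)"
    by (rule sum.mono_neutral_left) (auto simp: coeff_eq_0)
  also have "\<dots> = (\<Sum>l=i..j. Polynomial.coeff ?f l * affine_entry b u l j)"
    by (rule sum.mono_neutral_right) (auto simp: affine_row_below)
  finally show ?thesis .
qed

text \<open>From \<open>k (N choose k) = N (N - 1 choose k - 1)\<close> with
  \<open>N = p ^ m\<close>: if \<open>p\<close> did not divide the binomial coefficient, all of
  \<open>N\<close> would divide the smaller number \<open>k\<close>.\<close>

lemma prime_dvd_prime_power_choose: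
  assumes p: "Factorial_Ring.prime (p::nat)" and k: "0 < k" "k < p ^ m"
  shows "p dvd (p ^ m choose k)"
proof (rule ccontr)
  assume "\<not> p dvd (p ^ m choose k)"
  then have "coprime (p ^ m) (p ^ m choose k)" using p by (simp add: prime_imp_coprime)
  moreover have "k * (p ^ m choose k) = p ^ m * ((p ^ m - 1) choose (k - 1))"
    using times_binomial_minus1_eq[of k "p ^ m"] k by simp
  then have "p ^ m dvd k * (p ^ m choose k)" by simp
  ultimately have "p ^ m dvd k" using coprime_dvd_mult_left_iff by blast
  then show False using k by (simp add: nat_dvd_not_less)
qed

text \<open>Congruence modulo the ideal generated by \<open>p\<close> and
  \<open>T ^ (n + 1)\<close>.\<close>

definition cong_upto :: "nat \<Rightarrow> nat \<Rightarrow> int poly \<Rightarrow> int poly \<Rightarrow> bool" where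
  "cong_upto p n f g \<longleftrightarrow> (\<forall>j\<le>n. [Polynomial.coeff f j = Polynomial.coeff g j] (mod int p))"

lemma cong_upto_mult: "cong_upto p n f g \<Longrightarrow> cong_upto p n f' g' \<Longrightarrow> cong_upto p n (f * f') (g * g')"
  unfolding cong_upto_def coeff_mult by (auto intro!: cong_sum cong_mult)

lemma cong_upto_power: "cong_upto p n f g \<Longrightarrow> cong_upto p n (f ^ k) (g ^ k)"
  by (induction k) (auto intro: cong_upto_mult simp: cong_upto_def[of _ _ 1 1])

text \<open>In this sense the \<open>p ^ m\<close>-th power of \<open>1 + T\<close> is
  \<open>1\<close>: its inner binomial coefficients are divisible by \<open>p\<close>, and
  \<open>T ^ (p ^ m)\<close> is cut off. So exponents matter only modulo
  \<open>p ^ m\<close>.\<close>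

lemma cong_upto_one_plus_T:
  assumes p: "Factorial_Ring.prime (p::nat)" and n: "n < p ^ m" and c: "[b = b'] (mod p ^ m)"
  shows "cong_upto p n ([:1, 1:] ^ b) ([:1, 1:] ^ b')"
proof -
  let ?N = "p ^ m"
  have 1: "cong_upto p n ([:1, 1:] ^ ?N) 1"
    unfolding cong_upto_def
  proof safe
    fix j assume j: "j \<le> n"
    show "[Polynomial.coeff ([:1, 1:] ^ ?N) j = Polynomial.coeff 1 j] (mod int p)"
      using prime_dvd_prime_power_choose[OF p, of j m] j n
      by (cases "j = 0") (auto simp: coeff_one_plus_T_power cong_0_iff)
  qed
  have "cong_upto p n ([:1, 1:] ^ b) ([:1, 1:] ^ (b mod ?N))" for b
  proof -
    have "cong_upto p n (([:1, 1:] ^ ?N) ^ (b div ?N) * [:1, 1:] ^ (b mod ?N)) (1 ^ (b div ?N) * [:1, 1:] ^ (b mod ?N))"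
      by (intro cong_upto_mult cong_upto_power 1) (simp add: cong_upto_def)
    moreover have "([:1, 1:] ^ ?N) ^ (b div ?N) * [:1, 1:] ^ (b mod ?N) = ([:1, 1:] ^ b :: int poly)"
      by (simp flip: power_mult power_add)
    ultimately show ?thesis by simp
  qed
  then show ?thesis using c unfolding cong_upto_def cong_def by metis
qed

text \<open>Needed because the \<open>b\<close> and \<open>u\<close> of an automorphism are chosen
  representatives whose composition laws hold only modulo \<open>p ^ m\<close>.\<close>

lemma affine_row_cong:
  assumes "Factorial_Ring.prime (p::nat)" "n < p ^ m" "[b = b'] (mod p ^ m)" "[u = u'] (mod p ^ m)"
  shows "cong_upto p n (affine_row b u i) (affine_row b' u' i)"
proof -
  have "cong_upto p n ([:1, 1:] ^ u - 1) ([:1, 1:] ^ u' - 1)"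
    using cong_upto_one_plus_T[OF assms(1,2,4)] by (auto simp: cong_upto_def intro: cong_diff)
  then show ?thesis
    unfolding affine_row_def by (intro cong_upto_mult cong_upto_power cong_upto_one_plus_T[OF assms(1-3)])
qed

section \<open>The representation attached to a Kummer element\<close>

context galois_character
begin

text \<open>The rows and columns of the unipotent matrices \<open>\<rho> s\<close> are numbered from \<open>0\<close> to \<open>n\<close>; entries below the
  diagonal are junk.\<close>
definition unipotent_rep :: "nat \<Rightarrow> 'a list \<Rightarrow> (('a \<Rightarrow> 'a) \<Rightarrow> nat \<Rightarrow> nat \<Rightarrow> int) \<Rightarrow> bool" where
  "unipotent_rep n zs \<rho> \<longleftrightarrow> set zs \<subseteq> carrier R \<and> galois_p_ext R K p (adjoin zs) \<and>
    (\<forall>s\<in>Gam. \<forall>t\<in>Gam. (\<forall>x\<in>set zs. s x = t x) \<longrightarrow> (\<forall>i j. i \<le> j \<longrightarrow> j \<le> n \<longrightarrow> [\<rho> s i j = \<rho> t i j] (mod int p))) \<and>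
    (\<forall>s\<in>Gam. \<forall>t\<in>Gam. \<forall>i j. i \<le> j \<longrightarrow> j \<le> n \<longrightarrow> [\<rho> (s \<circ> t) i j = (\<Sum>l=i..j. \<rho> s i l * \<rho> t l j)] (mod int p)) \<and>
    (\<forall>s\<in>Gam. \<forall>i\<le>n. [\<rho> s i i = 1] (mod int p)) \<and>
    (\<forall>s\<in>Gam. \<forall>i<n. [\<rho> s i (Suc i) = - int (e s)] (mod int p))"

lemma Gam_fixed_imp_K:
  assumes "x \<in> carrier R" "\<And>s. s \<in> Gam \<Longrightarrow> s x = x" shows "x \<in> K"
  using fixed_imp_mem[OF K_subfield subset_refl assms(1)] assms(2) by (simp add: fixes_on_K)

text \<open>The affine maps \<open>x \<mapsto> b + u x\<close> of \<open>\<int>/p ^ (n + 1)\<close> come from the action on the \<open>p ^ (n + 1)\<close>-th roots of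
  \<open>\<alpha> ^ p \<in> K\<close>.\<close>
lemma unipotent_rep_kummer:
  assumes ch: "natr p \<noteq> \<zero>" and n: "3 \<le> n"
    and z: "\<zeta> \<in> K" "\<zeta> [^] p = \<one>" "\<And>k::nat. 0 < k \<Longrightarrow> k < p \<Longrightarrow> \<zeta> [^] k \<noteq> \<one>"
    and sq: "p = 2 \<Longrightarrow> \<exists>x\<in>K. x \<otimes> x = \<ominus> \<one>"
  obtains zs \<rho> where "unipotent_rep n zs \<rho>"
proof -
  have p2: "2 \<le> p" and p0: "0 < p" using prime_ge_2_nat[OF p] by auto
  have zc: "\<zeta> \<in> carrier R" using z(1) K_carrier by blast
  have zn: "\<zeta> \<noteq> \<zero>" using z(2) p0 nat_pow_zero[of p] by auto
  obtain \<alpha> where \<alpha>: "\<alpha> \<in> carrier R" "\<alpha> \<noteq> \<zero>" "\<And>s. s \<in> Gam \<Longrightarrow> \<zeta> [^] e s \<otimes> s \<alpha> = \<alpha>"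
    using kummer_element[OF z] by blast
  have ze: "(\<zeta> [^] (k::nat)) [^] p = \<one>" for k
  proof -
    have "(\<zeta> [^] k) [^] p = (\<zeta> [^] p) [^] k" using zc by (simp add: nat_pow_pow mult.commute)
    then show ?thesis using z(2) by simp
  qed
  have aK: "\<alpha> [^] p \<in> K"
  proof (rule Gam_fixed_imp_K)
    fix s assume s: "s \<in> Gam"
    have "\<alpha> [^] p = (\<zeta> [^] e s \<otimes> s \<alpha>) [^] p" using \<alpha>(3)[OF s] by simp
    also have "\<dots> = s \<alpha> [^] p" using ze zc Gam_closed[OF s \<alpha>(1)] by (simp add: nat_pow_distrib)
    finally show "s (\<alpha> [^] p) = \<alpha> [^] p" unfolding Gam_pow[OF s \<alpha>(1)] by (rule sym)
  qed (use \<alpha> in simp)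
  have "\<forall>x. \<exists>w. x \<in> carrier R \<longrightarrow> w \<in> carrier R \<and> w [^] p = x"
    using kummer_root[OF closed p2 ch] by metis
  then obtain rt where rt: "x \<in> carrier R \<Longrightarrow> rt x \<in> carrier R" "x \<in> carrier R \<Longrightarrow> rt x [^] p = x" for x
    by metis
  \<comment> \<open>A compatible system of iterated \<open>p\<close>-th roots. Below,
    \<open>zz i\<close> is a primitive \<open>p ^ (i + 1)\<close>-th root of unity starting from
    \<open>\<zeta>\<close>, and \<open>bb i\<close> is a \<open>p ^ (i + 1)\<close>-th root of
    \<open>\<alpha> ^ p\<close> starting from \<open>\<alpha>\<close>.\<close>
  define tower where "tower x i = (rt ^^ i) x" for x i
  have tower: "tower x i \<in> carrier R" "tower x 0 = x" "tower x (Suc i) [^] p = tower x i" if x: "x \<in> carrier R" for x i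
  proof -
    show c: "tower x i \<in> carrier R" for i by (induction i) (auto simp: tower_def x rt(1))
    show "tower x 0 = x" by (simp add: tower_def)
    show "tower x (Suc i) [^] p = tower x i" using rt(2)[OF c[of i]] by (simp add: tower_def)
  qed
  have tower_nonzero: "tower x i \<noteq> \<zero>" if x: "x \<in> carrier R" "x \<noteq> \<zero>" for x i
  proof (induction i)
    case (Suc i) then show ?case using tower(3)[OF x(1), of i] p0 nat_pow_zero[of p] by auto
  qed (simp add: tower x)
  have tower_pow: "tower x (i + j) [^] (p ^ j) = tower x i" if x: "x \<in> carrier R" for x i j
  proof (induction j)
    case (Suc j)
    have "tower x (i + Suc j) [^] (p ^ Suc j) = (tower x (Suc (i + j)) [^] p) [^] (p ^ j)"
      using tower(1)[OF x] by (simp add: nat_pow_pow)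
    then show ?case using tower(3)[OF x, of "i + j"] Suc by simp
  qed (use tower(1)[OF x] in simp)
  define zz where "zz = tower \<zeta>"
  define bb where "bb = tower \<alpha>"
  note zz = tower[OF zc, folded zz_def] and bb = tower[OF \<alpha>(1), folded bb_def]
  note zzn = tower_nonzero[OF zc zn, folded zz_def] and bbn = tower_nonzero[OF \<alpha>(1,2), folded bb_def]
  note zz_pow = tower_pow[OF zc, folded zz_def] and bb_pow = tower_pow[OF \<alpha>(1), folded bb_def]
  have zz_one: "zz i [^] (p ^ Suc i) = \<one>" for i
  proof -
    have "zz i [^] (p ^ Suc i) = (zz i [^] (p ^ i)) [^] p" using zz(1) by (simp add: nat_pow_pow mult.commute)
    then show ?thesis using zz_pow[of 0 i] zz(2) z(2) by simp
  qed
  \<comment> \<open>Taking \<open>p\<close>-th powers descends to \<open>zz i\<close> and gives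
    \<open>k = p ^ (i + 1) k'\<close>; then \<open>zz (i + 1) ^ k\<close> equals
    \<open>\<zeta> ^ k'\<close>, so \<open>p\<close> divides \<open>k'\<close>.\<close>
  have zz_ord: "p ^ Suc i dvd k" if "zz i [^] k = \<one>" for i k :: nat
    using that
  proof (induction i arbitrary: k)
    case 0
    then have "[k = 0] (mod p)" using root_pow_eq_iff[OF zc z(2,3) p0, of k 0] zz(2) by simp
    then show ?case by (simp add: cong_0_iff)
  next
    case (Suc i)
    have "(zz (Suc i) [^] k) [^] p = (zz (Suc i) [^] p) [^] k" using zz(1) by (simp only: nat_pow_pow mult.commute)
    then have "zz i [^] k = (zz (Suc i) [^] k) [^] p" by (simp only: zz(3))
    then have "zz i [^] k = \<one>" using Suc.prems by simp
    then obtain k' where k': "k = p ^ Suc i * k'" using Suc.IH by blast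
    have "zz (Suc i) [^] k = (zz (Suc i) [^] (p ^ Suc i)) [^] k'" using k' zz(1) by (simp only: nat_pow_pow)
    then have "\<zeta> [^] k' = \<one>" using zz_pow[of 0 "Suc i"] zz(2) Suc.prems by simp
    then have "[k' = 0] (mod p)" using root_pow_eq_iff[OF zc z(2,3) p0, of k' 0] by simp
    then show ?case using k' by (auto simp: cong_0_iff mult.commute)
  qed
  have zz_iff: "zz i [^] (k::nat) = zz i [^] (l::nat) \<longleftrightarrow> [k = l] (mod p ^ Suc i)" for i k l
  proof (rule root_pow_eq_iff[OF zz(1) zz_one])
    show "zz i [^] (k::nat) \<noteq> \<one>" if "0 < k" "k < p ^ Suc i" for k
      using zz_ord[of i k] that by (auto dest: nat_dvd_not_less)
  qed (use p0 in simp)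
  \<comment> \<open>By induction \<open>w ^ p\<close> is a power of \<open>zz i\<close>, so
    \<open>w\<close> differs from the same power of \<open>zz (i + 1)\<close> by a
    \<open>p\<close>-th root of unity, which is a power of \<open>\<zeta>\<close>.\<close>
  have roots: "\<exists>k::nat. w = zz i [^] k" if "w \<in> carrier R" "w [^] (p ^ Suc i) = \<one>" for w i
    using that
  proof (induction i arbitrary: w)
    case 0
    then have "w [^] p = \<one>" by simp
    then obtain k :: nat where "w = \<zeta> [^] k" using pth_roots_of_unity[OF zc z(2,3) p2 0(1)] by blast
    then show ?case unfolding zz(2) by blast
  next
    case (Suc i)
    have "(w [^] p) [^] (p ^ Suc i) = \<one>" using Suc.prems by (simp add: nat_pow_pow)
    then obtain k :: nat where k: "w [^] p = zz i [^] k" using Suc.IH[of "w [^] p"] Suc.prems by auto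
    have "(zz (Suc i) [^] k) [^] p = (zz (Suc i) [^] p) [^] k"
      using zz(1) by (simp only: nat_pow_pow mult.commute)
    then have "w [^] p = (zz (Suc i) [^] k) [^] p" using k by (simp only: zz(3))
    moreover have "zz (Suc i) [^] k \<noteq> \<zero>" using zzn[of "Suc i"] zz(1) by (induction k) (auto simp: integral_iff)
    ultimately obtain u where u: "u \<in> carrier R" "u [^] p = \<one>" "w = u \<otimes> zz (Suc i) [^] k"
      using pow_eq_imp_root_of_unity Suc.prems(1) zz(1) by (metis nat_pow_closed)
    obtain l :: nat where l: "u = \<zeta> [^] l" using pth_roots_of_unity[OF zc z(2,3) p2 u(1,2)] by blast
    have "u = zz (Suc i) [^] (p ^ Suc i * l)" using l zz_pow[of 0 "Suc i"] zz by (metis add_0 nat_pow_pow)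
    then have "w = zz (Suc i) [^] (p ^ Suc i * l + k)" using u(3) zz(1) by (simp only: nat_pow_mult)
    then show ?case by blast
  qed
  have s_zz: "\<exists>k::nat. s (zz i) = zz i [^] k" if s: "s \<in> Gam" for s i
  proof (rule roots)
    show "s (zz i) \<in> carrier R" using Gam_closed[OF s zz(1)] .
    show "s (zz i) [^] (p ^ Suc i) = \<one>" using Gam_pow[OF s zz(1), symmetric] zz_one Gam_one[OF s] by metis
  qed
  have s_bb: "\<exists>k::nat. s (bb i) = zz i [^] k \<otimes> bb i" if s: "s \<in> Gam" for s i
  proof -
    have ba: "bb i [^] (p ^ Suc i) = \<alpha> [^] p"
    proof -
      have "bb i [^] (p ^ Suc i) = (bb i [^] (p ^ i)) [^] p" using bb(1) by (simp add: nat_pow_pow mult.commute)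
      then show ?thesis using bb_pow[of 0 i] bb(2) by simp
    qed
    have "s (bb i) [^] (p ^ Suc i) = bb i [^] (p ^ Suc i)"
      using Gam_pow[OF s bb(1), symmetric] ba Gam_fix[OF s aK] by metis
    then obtain u where u: "u \<in> carrier R" "u [^] (p ^ Suc i) = \<one>" "s (bb i) = u \<otimes> bb i"
      using pow_eq_imp_root_of_unity[OF Gam_closed[OF s bb(1)] bb(1) bbn] by blast
    then show ?thesis using roots by blast
  qed
  \<comment> \<open>\<open>conj_count_kummer\<close> adjoins at the head, so the lists are reversed:
    first all the roots of unity, then the roots of \<open>\<alpha>\<close>. At each stage the
    \<open>p\<close>-th power of the new element is already fixed.\<close>
  define zl where "zl i = map zz (rev [0..<i])" for i
  define bl where "bl i = map bb (rev [0..<i]) @ zl (Suc n)" for i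
  have zl_c: "set (zl i) \<subseteq> carrier R" and bl_c: "set (bl i) \<subseteq> carrier R" for i
    using zz(1) bb(1) by (auto simp: zl_def bl_def)
  have zl_N: "\<exists>m. conj_count (zl i) = p ^ m" for i
  proof (induction i)
    case 0
    show ?case by (intro exI[of _ 0]) (simp add: zl_def conj_count_Nil)
  next
    case (Suc i)
    then obtain m where m: "conj_count (zl i) = p ^ m" by blast
    have "s (zz i [^] p) = zz i [^] p" if s: "s \<in> fixes_on (set (zl i))" for s
    proof (cases i)
      case 0 then show ?thesis using zz(2) z(2) Gam_one[OF fixes_on_Gam[OF s]] by simp
    next
      case (Suc j)
      then have "zz j \<in> set (zl i)" by (simp add: zl_def)
      then show ?thesis using s zz(3)[of j] Suc by (simp add: fixes_on_def)
    qed
    then obtain m' where "conj_count (zz i # zl i) = p ^ m'"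
      using conj_count_kummer[OF p zl_c zz(1) zzn z _ m] by blast
    then show ?case by (auto simp: zl_def)
  qed
  have bl_N: "\<exists>m. conj_count (bl i) = p ^ m" for i
  proof (induction i)
    case 0 then show ?case using zl_N by (simp add: bl_def)
  next
    case (Suc i)
    then obtain m where m: "conj_count (bl i) = p ^ m" by blast
    have "s (bb i [^] p) = bb i [^] p" if s: "s \<in> fixes_on (set (bl i))" for s
    proof (cases i)
      case 0 then show ?thesis using bb(2) Gam_fix[OF fixes_on_Gam[OF s] aK] by simp
    next
      case (Suc j)
      then have "bb j \<in> set (bl i)" by (simp add: bl_def)
      then show ?thesis using s bb(3)[of j] Suc by (simp add: fixes_on_def)
    qed
    then obtain m' where "conj_count (bb i # bl i) = p ^ m'"
      using conj_count_kummer[OF p bl_c bb(1) bbn z _ m] by blast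
    then show ?case by (auto simp: bl_def)
  qed
  define zs where "zs = bl (Suc n)"
  have zs_c: "set zs \<subseteq> carrier R" unfolding zs_def by (rule bl_c)
  note P = finite_extension_props[OF zs_c]
  have set_zs: "set zs = bb ` {..<Suc n} \<union> zz ` {..<Suc n}"
    by (simp only: zs_def bl_def zl_def set_append set_map set_rev set_upt atLeast0LessThan)
  have zs_mem: "zz i \<in> set zs" "bb i \<in> set zs" if "i \<le> n" for i
    using that unfolding set_zs by auto
  have pw: "zz i [^] (k::nat) \<in> adjoin zs" if "i \<le> n" for i k
  proof (induction k)
    case 0 then show ?case using subringE(3)[OF subfieldE(1)[OF P(1)]] by simp
  next
    case (Suc k) then show ?case using subringE(6)[OF subfieldE(1)[OF P(1)]] zs_mem(1)[OF that] P(3) by auto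
  qed
  have st: "stable (adjoin zs)"
  proof (rule stable_finite_extension[OF zs_c])
    fix s x assume s: "s \<in> Gam" and x: "x \<in> set zs"
    have "\<exists>i\<le>n. x = zz i \<or> x = bb i" using x unfolding set_zs by (force simp: less_Suc_eq_le)
    then consider i where "i \<le> n" "x = zz i" | i where "i \<le> n" "x = bb i" by blast
    then show "s x \<in> adjoin zs"
    proof cases
      case 1 then show ?thesis using s_zz[OF s, of i] pw by auto
    next
      case 2
      then have "bb i \<in> adjoin zs" using zs_mem P(3) by blast
      then show ?thesis using s_bb[OF s, of i] pw[OF 2(1)] 2 subringE(6)[OF subfieldE(1)[OF P(1)]] by auto
    qed
  qed
  obtain m where "conj_count zs = p ^ m" using bl_N zs_def by blast
  then have gal: "galois_p_ext R K p (adjoin zs)" by (rule galois_p_extI[OF zs_c st])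
  let ?Z = "zz n" and ?B = "bb n" and ?N = "p ^ Suc n"
  \<comment> \<open>\<open>u\<close> is the cyclotomic character and \<open>b\<close> the Kummer
    cocycle modulo \<open>p ^ (n + 1)\<close>. They are picked from the values \<open>s ?Z\<close>
    and \<open>s ?B\<close> alone, so automorphisms that agree on \<open>zs\<close> get identical
    choices.\<close>
  define u where "u s = (SOME k::nat. s ?Z = ?Z [^] k)" for s
  define b where "b s = (SOME k::nat. s ?B = ?Z [^] k \<otimes> ?B)" for s
  have u: "s ?Z = ?Z [^] u s" if "s \<in> Gam" for s unfolding u_def by (rule someI_ex[OF s_zz[OF that]])
  have b: "s ?B = ?Z [^] b s \<otimes> ?B" if "s \<in> Gam" for s unfolding b_def by (rule someI_ex[OF s_bb[OF that]])
  have Zpow: "s (?Z [^] k) = ?Z [^] (u s * k)" if "s \<in> Gam" for s and k :: nat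
    using Gam_pow[OF that zz(1)] u[OF that] zz(1) by (simp add: nat_pow_pow)
  have u_comp: "[u (s \<circ> t) = u s * u t] (mod ?N)" if st: "s \<in> Gam" "t \<in> Gam" for s t
  proof -
    have "?Z [^] u (s \<circ> t) = s (t ?Z)" using u[OF Gam_comp[OF st]] by simp
    also have "\<dots> = ?Z [^] (u s * u t)" using u[OF st(2)] Zpow[OF st(1)] by simp
    finally show ?thesis using zz_iff by blast
  qed
  have b_comp: "[b (s \<circ> t) = b s + u s * b t] (mod ?N)" if st: "s \<in> Gam" "t \<in> Gam" for s t
  proof -
    have "?Z [^] b (s \<circ> t) \<otimes> ?B = s (t ?B)" using b[OF Gam_comp[OF st]] by simp
    also have "\<dots> = ?Z [^] (u s * b t) \<otimes> (?Z [^] b s \<otimes> ?B)"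
      using b[OF st(2)] b[OF st(1)] Zpow[OF st(1)] Gam_mult[OF st(1)] zz(1) bb(1) by simp
    also have "\<dots> = ?Z [^] (b s + u s * b t) \<otimes> ?B"
      using zz(1) bb(1) by (simp add: nat_pow_mult[symmetric] m_ac)
    finally have "?Z [^] b (s \<circ> t) = ?Z [^] (b s + u s * b t)" using bbn zz(1) bb(1) by (simp add: m_rcancel)
    then show ?thesis using zz_iff by blast
  qed
  \<comment> \<open>\<open>zz i\<close> is a power of \<open>zz n\<close>, so an automorphism fixing
    it has \<open>u\<close> equal to \<open>1\<close> modulo its order. This is applied to
    \<open>zz 0 = \<zeta>\<close> and, for \<open>p = 2\<close>, to \<open>zz 1\<close>.\<close>
  have u_fix: "[u s = 1] (mod p ^ Suc i)" if s: "s \<in> Gam" and i: "i \<le> n" and fx: "s (zz i) = zz i" for s i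
  proof -
    have e: "?Z [^] (p ^ (n - i)) = zz i" using zz_pow[of i "n - i"] i by simp
    have "zz i [^] u s = (?Z [^] u s) [^] (p ^ (n - i))" using zz(1) e by (metis mult.commute nat_pow_pow)
    also have "\<dots> = s (?Z [^] (p ^ (n - i)))" using Zpow[OF s, of "p ^ (n - i)"] zz(1) by (simp add: nat_pow_pow)
    also have "\<dots> = zz i [^] (1::nat)" using e fx zz(1) by simp
    finally show ?thesis using zz_iff by blast
  qed
  have u1: "[u s = 1] (mod p)" if s: "s \<in> Gam" for s
    using u_fix[OF s, of 0] zz(2) Gam_fix[OF s z(1)] by simp
  \<comment> \<open>This kills the second term of \<open>affine_row_super\<close>. For odd
    \<open>p\<close> use \<open>2 (u choose 2) = u (u - 1)\<close>, where \<open>p\<close> divides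
    \<open>u - 1\<close>.\<close>
  have choose2: "p dvd (u s choose 2)" if s: "s \<in> Gam" for s
  proof (cases "p = 2")
    case False
    have "p dvd u s * (u s - 1)" using u1[OF s]
      by (metis cong_altdef_nat cong_sym dvd_mult linorder_le_cases mult.commute mult_zero_left nat_minus_add_max
          cong_to_1_nat diff_is_0_eq dvd_0_right)
    moreover have "2 * (u s choose 2) = u s * (u s - 1)"
      using times_binomial_minus1_eq[of 2 "u s"] by simp
    ultimately have "p dvd 2 * (u s choose 2)" by simp
    moreover have "\<not> p dvd 2" using False p by (metis primes_dvd_imp_eq two_is_prime_nat)
    ultimately show ?thesis using p by (metis prime_dvd_mult_iff)
  next
    case True
    \<comment> \<open>Now \<open>\<zeta>\<close> is \<open>- 1\<close>, so \<open>zz 1\<close> and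
      the given \<open>x\<close> have the same square and agree up to sign. Hence
      \<open>zz 1\<close> lies in \<open>K\<close> and \<open>u\<close> is \<open>1\<close> modulo
      \<open>4\<close>.\<close>
    obtain x where x: "x \<in> K" "x \<otimes> x = \<ominus> \<one>" using sq True by blast
    have xc: "x \<in> carrier R" using x K_carrier by blast
    have "\<zeta> \<otimes> \<zeta> = \<one>" using z(2) True zc by (simp add: numeral_2_eq_2)
    then have "\<zeta> = \<ominus> \<one>" using square_eq_one[OF zc] z(3)[of 1] True zc by auto
    then have "zz 1 \<otimes> zz 1 = x \<otimes> x" using zz(3)[of 0] zz(1)[of 1] zz(2) True x by (simp add: numeral_2_eq_2)
    then have "(zz 1 \<ominus> x) \<otimes> (zz 1 \<oplus> x) = \<zero>"
    proof -
      have "(zz 1 \<ominus> x) \<otimes> (zz 1 \<oplus> x) = zz 1 \<otimes> zz 1 \<ominus> x \<otimes> x" using zz(1)[of 1] xc by algebra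
      then show ?thesis using \<open>zz 1 \<otimes> zz 1 = x \<otimes> x\<close> xc by (simp add: a_minus_def r_neg)
    qed
    then have "zz 1 \<ominus> x = \<zero> \<or> zz 1 \<oplus> x = \<zero>" using integral[OF _ minus_closed a_closed] zz(1)[of 1] xc by blast
    then have "zz 1 = x \<or> zz 1 = \<ominus> x" using zz(1)[of 1] xc by (metis minus_equality a_comm r_right_minus_eq)
    then have "zz 1 \<in> K" using x(1) subringE(5)[OF K_subring] by auto
    then have "[u s = 1] (mod 4)" using u_fix[OF s, of 1] n Gam_fix[OF s] True by simp
    then have "u s mod 4 = 1" by (simp add: cong_def)
    then obtain q where "u s = 4 * q + 1" using mod_mult_div_eq[of "u s" 4, symmetric] by (metis add.commute)
    then have "u s choose 2 = 2 * (q * (4 * q + 1))" by (simp add: choose_two)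
    then show ?thesis using True by simp
  qed
  \<comment> \<open>The \<open>p ^ n\<close>-th power of \<open>?B\<close> is
    \<open>\<alpha>\<close>, so \<open>s\<close> multiplies \<open>\<alpha>\<close> by
    \<open>\<zeta> ^ b(s)\<close>; comparison with the choice of \<open>\<alpha>\<close> gives
    \<open>b = - e\<close> modulo \<open>p\<close>.\<close>
  have be: "p dvd b s + e s" if s: "s \<in> Gam" for s
  proof -
    have "\<zeta> [^] b s = (?Z [^] b s) [^] (p ^ n)" using zz_pow[of 0 n] zz by (metis add_0 mult.commute nat_pow_pow)
    then have "s \<alpha> = \<zeta> [^] b s \<otimes> \<alpha>"
      using bb_pow[of 0 n] bb(2) Gam_pow[OF s bb(1)[of n], of "p ^ n"] b[OF s] zz(1) bb(1)[of n]
      by (simp add: nat_pow_distrib)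
    then have "\<zeta> [^] e s \<otimes> \<zeta> [^] b s \<otimes> \<alpha> = \<one> \<otimes> \<alpha>" using \<alpha>(3)[OF s] zc \<alpha>(1) by (simp add: m_assoc)
    then have "\<zeta> [^] e s \<otimes> \<zeta> [^] b s = \<one>" using \<alpha> zc by (metis m_rcancel nat_pow_closed m_closed one_closed)
    then have "\<zeta> [^] (b s + e s) = \<zeta> [^] (0::nat)" using zc by (simp add: nat_pow_mult add.commute)
    then have "[b s + e s = 0] (mod p)" using root_pow_eq_iff[OF zc z(2,3) p0] by blast
    then show ?thesis by (simp add: cong_0_iff)
  qed
  have nN: "n < ?N"
  proof -
    have "n < 2 ^ n" by (rule less_exp)
    also have "(2::nat) ^ n \<le> p ^ n" using p2 by (rule power_mono) simp
    also have "p ^ n \<le> ?N" using p0 by simp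
    finally show ?thesis .
  qed
  \<comment> \<open>\<open>affine_entry\<close> reverses composition. Reflecting the matrix in its
    antidiagonal restores the order and keeps it upper triangular.\<close>
  define \<rho> where "\<rho> s i j = affine_entry (b s) (u s) (n - j) (n - i)" for s i j
  have "unipotent_rep n zs \<rho>"
    unfolding unipotent_rep_def
  proof (intro conjI ballI allI impI)
    show "set zs \<subseteq> carrier R" "galois_p_ext R K p (adjoin zs)" by (fact zs_c, fact gal)
  next
    fix s t i j assume "s \<in> Gam" "t \<in> Gam" "\<forall>x\<in>set zs. s x = t x"
    then have "b s = b t" "u s = u t" using zs_mem[of n] by (simp_all add: b_def u_def)
    then show "[\<rho> s i j = \<rho> t i j] (mod int p)" by (simp add: \<rho>_def)
  next
    fix s t i j assume st: "s \<in> Gam" "t \<in> Gam" and ij: "i \<le> j" "j \<le> n"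
    have "[\<rho> (s \<circ> t) i j = affine_entry (b s + u s * b t) (u s * u t) (n - j) (n - i)] (mod int p)"
      using affine_row_cong[OF p nN b_comp[OF st] u_comp[OF st], of "n - j"] by (simp add: cong_upto_def \<rho>_def)
    also have "affine_entry (b s + u s * b t) (u s * u t) (n - j) (n - i)
      = (\<Sum>l=n - j..n - i. affine_entry (b t) (u t) (n - j) l * affine_entry (b s) (u s) l (n - i))"
      by (rule affine_row_comp_coeff)
    also have "\<dots> = (\<Sum>l=i..j. \<rho> s i l * \<rho> t l j)"
      by (rule sum.reindex_bij_witness[of _ "\<lambda>l. n - l" "\<lambda>l. n - l"]) (use ij in \<open>auto simp: \<rho>_def\<close>)
    finally show "[\<rho> (s \<circ> t) i j = (\<Sum>l=i..j. \<rho> s i l * \<rho> t l j)] (mod int p)" .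
  next
    fix s i assume s: "s \<in> Gam" and i: "i \<le> n"
    have "[int (u s) ^ (n - i) = 1 ^ (n - i)] (mod int p)"
      using u1[OF s] by (intro cong_pow) (metis cong_int_iff of_nat_1)
    then show "[\<rho> s i i = 1] (mod int p)" by (simp add: \<rho>_def affine_row_diag)
  next
    fix s i assume s: "s \<in> Gam" and i: "i < n"
    let ?k = "n - Suc i"
    have "\<rho> s i (Suc i) = affine_entry (b s) (u s) ?k (Suc ?k)"
      using i by (simp add: \<rho>_def Suc_diff_Suc)
    also have "\<dots> = int (b s) * int (u s) ^ ?k + int ?k * int (u s) ^ (?k - 1) * int (u s choose 2)"
      by (rule affine_row_super)
    also have "[\<dots> = int (b s) * 1 ^ ?k + 0] (mod int p)"
    proof (intro cong_add cong_mult cong_refl cong_pow)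
      show "[int (u s) = 1] (mod int p)" using u1[OF s] by (metis cong_int_iff of_nat_1)
      show "[int ?k * int (u s) ^ (?k - 1) * int (u s choose 2) = 0] (mod int p)"
        using choose2[OF s] by (simp add: cong_0_iff)
    qed
    also have "[int (b s) * 1 ^ ?k + 0 = - int (e s)] (mod int p)"
      using be[OF s] by (simp add: cong_iff_dvd_diff flip: of_nat_add)
    finally show "[\<rho> s i (Suc i) = - int (e s)] (mod int p)" .
  qed
  then show ?thesis by (rule that)
qed

end

section \<open>Sums in characteristic p and the Artin-Schreier representation\<close>

lemma (in abelian_monoid) finsum_triangle:
  assumes "\<And>k i. F k i \<in> carrier G"
  shows "(\<Oplus>k\<in>{..n::nat}. \<Oplus>i\<in>{..k}. F i (k - i)) = (\<Oplus>k\<in>{..n}. \<Oplus>i\<in>{..n - k}. F k i)"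
proof (induction n)
  case 0 then show ?case using assms by simp
next
  case (Suc n)
  have "(\<Oplus>k\<in>{..Suc n}. \<Oplus>i\<in>{..Suc n - k}. F k i) = F (Suc n) 0 \<oplus> (\<Oplus>k\<in>{..n}. \<Oplus>i\<in>{..Suc n - k}. F k i)"
    using assms by (subst finsum_Suc) auto
  also have "(\<Oplus>k\<in>{..n}. \<Oplus>i\<in>{..Suc n - k}. F k i) = (\<Oplus>k\<in>{..n}. F k (Suc n - k) \<oplus> (\<Oplus>i\<in>{..n - k}. F k i))"
  proof (rule finsum_cong')
    fix k assume "k \<in> {..n}"
    then have "Suc n - k = Suc (n - k)" by auto
    then show "(\<Oplus>i\<in>{..Suc n - k}. F k i) = F k (Suc n - k) \<oplus> (\<Oplus>i\<in>{..n - k}. F k i)"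
      using assms by (simp add: finsum_Suc Pi_def)
  qed (use assms in auto)
  also have "\<dots> = (\<Oplus>k\<in>{..n}. F k (Suc n - k)) \<oplus> (\<Oplus>k\<in>{..n}. \<Oplus>i\<in>{..n - k}. F k i)"
    using assms by (intro finsum_addf) auto
  finally have r: "(\<Oplus>k\<in>{..Suc n}. \<Oplus>i\<in>{..Suc n - k}. F k i) =
     F (Suc n) 0 \<oplus> ((\<Oplus>k\<in>{..n}. F k (Suc n - k)) \<oplus> (\<Oplus>k\<in>{..n}. \<Oplus>i\<in>{..n - k}. F k i))" .
  have "(\<Oplus>k\<in>{..Suc n}. \<Oplus>i\<in>{..k}. F i (k - i)) = (\<Oplus>i\<in>{..Suc n}. F i (Suc n - i)) \<oplus> (\<Oplus>k\<in>{..n}. \<Oplus>i\<in>{..k}. F i (k - i))"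
    using assms by (subst finsum_Suc) auto
  also have "(\<Oplus>i\<in>{..Suc n}. F i (Suc n - i)) = F (Suc n) 0 \<oplus> (\<Oplus>i\<in>{..n}. F i (Suc n - i))"
    using assms by (subst finsum_Suc) auto
  also have "F (Suc n) 0 \<oplus> (\<Oplus>i\<in>{..n}. F i (Suc n - i)) \<oplus> (\<Oplus>k\<in>{..n}. \<Oplus>i\<in>{..k}. F i (k - i))
     = F (Suc n) 0 \<oplus> ((\<Oplus>i\<in>{..n}. F i (Suc n - i)) \<oplus> (\<Oplus>k\<in>{..n}. \<Oplus>i\<in>{..k}. F i (k - i)))"
    by (rule a_assoc) (use assms in \<open>auto intro: finsum_closed\<close>)
  finally show ?case unfolding r Suc.IH .
qed

lemma (in ring) subring_finsum:
  assumes L: "subring L R" and "finite A" "\<And>x. x \<in> A \<Longrightarrow> f x \<in> L"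
  shows "(\<Oplus>x\<in>A. f x) \<in> L"
  using assms(2,3)
proof (induction A rule: finite_induct)
  case empty then show ?case using subringE(2)[OF L] by simp
next
  case (insert a A)
  then have "(\<Oplus>x\<in>insert a A. f x) = f a \<oplus> (\<Oplus>x\<in>A. f x)"
    using subringE(1)[OF L] by (subst finsum_insert) auto
  then show ?case using subringE(7)[OF L] insert by auto
qed

lemma (in cring) frobenius_finsum:
  assumes p: "Factorial_Ring.prime (p::nat)" "natr p = \<zero>" and "finite A" "\<And>x. x \<in> A \<Longrightarrow> f x \<in> carrier R"
  shows "(\<Oplus>x\<in>A. f x) [^] p = (\<Oplus>x\<in>A. f x [^] p)"
  using assms(3,4)
proof (induction A rule: finite_induct)
  case empty then show ?case using prime_gt_0_nat[OF p(1)] by (simp add: nat_pow_zero)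
next
  case (insert a A)
  have "(\<Oplus>x\<in>insert a A. f x) = f a \<oplus> (\<Oplus>x\<in>A. f x)"
    using insert by (subst finsum_insert) auto
  moreover have "(\<Oplus>x\<in>insert a A. f x [^] p) = f a [^] p \<oplus> (\<Oplus>x\<in>A. f x [^] p)"
    using insert by (subst finsum_insert) auto
  ultimately show ?case using insert frobenius_add[OF p, of "f a" "\<Oplus>x\<in>A. f x"] by simp
qed

lemma (in ring) add_pow_sum: "natr (\<Sum>l\<le>(m::nat). g l :: nat) = (\<Oplus>l\<in>{..m}. natr (g l))"
proof (induction m)
  case (Suc m)
  have "natr (\<Sum>l\<le>Suc m. g l) = natr (g (Suc m)) \<oplus> natr (\<Sum>l\<le>m. g l)"
    by (simp add: add.nat_pow_mult add.commute)
  then show ?case using Suc by (simp add: finsum_Suc Pi_def)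
qed simp

lemma (in ring) add_pow_mult_one: "natr (a::nat) \<otimes> natr (b::nat) = natr (a * b)"
  by (simp add: add_pow_ldistr add.nat_pow_pow mult.commute)

context galois_character
begin

text \<open>In characteristic \<open>p\<close> the power series \<open>\<Sum> f k T ^ k\<close> solves \<open>Frob f = (1 + a T) f\<close>,
  where \<open>a = x ^ p - x\<close> is the Artin-Schreier constant of \<open>e\<close>.
  Hence \<open>s f / f\<close> has coefficients in the prime field, and these define the representation.\<close>
lemma unipotent_rep_artin_schreier:
  assumes ch: "natr p = \<zero>"
  obtains zs \<rho> where "unipotent_rep n zs \<rho>"
proof -
  have p2: "2 \<le> p" and p0: "0 < p" using prime_ge_2_nat[OF p] by auto
  obtain x where x: "x \<in> carrier R" "\<And>s. s \<in> Gam \<Longrightarrow> x = s x \<oplus> natr (e s)"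
    using artin_schreier_element[OF ch] by blast
  define a where "a = x [^] p \<ominus> x"
  have ac: "a \<in> carrier R" using x by (simp add: a_def)
  have xp: "x [^] p = x \<oplus> a" using x(1) by (simp add: a_def a_minus_def a_assoc[symmetric] a_comm r_neg1 a_lcomm r_neg)
  have aK: "a \<in> K"
  proof (rule Gam_fixed_imp_K[OF ac])
    fix s assume s: "s \<in> Gam"
    have sc: "s x \<in> carrier R" "s a \<in> carrier R" using Gam_closed[OF s] x ac by auto
    have "s x [^] p \<oplus> natr (e s) = x [^] p"
      using frobenius_add[OF p ch sc(1), of "natr (e s)"] x(2)[OF s] frobenius_prime_field[OF p ch, of "e s"] by simp
    moreover have "s x [^] p = s x \<oplus> s a" using Gam_pow[OF s x(1), of p] xp Gam_add[OF s x(1) ac] by simp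
    ultimately have "s x \<oplus> s a \<oplus> natr (e s) = x \<oplus> a" using xp by simp
    moreover have "s x \<oplus> s a \<oplus> natr (e s) = (s x \<oplus> natr (e s)) \<oplus> s a"
      using sc by (simp add: a_ac)
    ultimately have "x \<oplus> s a = x \<oplus> a" using x(2)[OF s] by simp
    then show "s a = a" using x(1) sc ac by simp
  qed
  have "\<forall>c. \<exists>w. c \<in> carrier R \<longrightarrow> w \<in> carrier R \<and> w [^] p = w \<oplus> c"
    using artin_schreier_root[OF closed p2 ch] by metis
  then obtain rt where rt: "c \<in> carrier R \<Longrightarrow> rt c \<in> carrier R" "c \<in> carrier R \<Longrightarrow> rt c [^] p = rt c \<oplus> c" for c
    by metis
  \<comment> \<open>Comparing coefficients in \<open>Frob f = (1 + a T) f\<close> gives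
    \<open>f (k + 1) ^ p = f (k + 1) + a f k\<close>. In degree \<open>1\<close> the solution is
    taken to be \<open>x\<close> itself, since \<open>x - s x\<close> records \<open>e s\<close>;
    above that any root will do.\<close>
  define f where "f = rec_nat \<one> (\<lambda>k y. if k = 0 then x else rt (a \<otimes> y))"
  have f0: "f 0 = \<one>" and f1: "f 1 = x" by (simp_all add: f_def)
  have fSuc: "f (Suc k) = (if k = 0 then x else rt (a \<otimes> f k))" for k by (simp add: f_def)
  have fc: "f k \<in> carrier R" for k
    by (induction k) (auto simp: f0 fSuc x ac rt(1))
  have fp: "f (Suc k) [^] p = f (Suc k) \<oplus> a \<otimes> f k" for k
    using xp rt(2)[of "a \<otimes> f k"] fc[of k] ac by (cases "k = 0") (auto simp: fSuc f0)
  \<comment> \<open>Coefficient \<open>j\<close> of the product of \<open>f\<close> with the power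
    series whose coefficients are the images of \<open>c\<close> in the prime field.\<close>
  define D where "D c j = (\<Oplus>l\<in>{..j}. natr (c l) \<otimes> f (j - l))" for c :: "nat \<Rightarrow> nat" and j
  have Dc: "D c j \<in> carrier R" for c j unfolding D_def using fc by (intro finsum_closed) auto
  \<comment> \<open>The coefficients of \<open>s f / f\<close> are found one degree at a time. The
    part \<open>g\<close> of coefficient \<open>k + 1\<close> that is already determined and
    \<open>s (f (Suc k))\<close> solve the same Artin-Schreier equation, so they differ by an
    element \<open>m\<close> of the prime field; this is the next coefficient.\<close>
  have ex: "\<exists>c. c 0 = 1 \<and> (\<forall>j\<le>k. s (f j) = D c j)" if s: "s \<in> Gam" for s k
  proof (induction k)
    case 0
    show ?case using Gam_one[OF s] by (intro exI[of _ "\<lambda>_. 1"]) (simp add: D_def f0)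
  next
    case (Suc k)
    then obtain c where c: "c 0 = 1" "\<And>j. j \<le> k \<Longrightarrow> s (f j) = D c j" by blast
    let ?x = "\<lambda>l. natr (c l) \<otimes> f (Suc k - l)" and ?y = "\<lambda>l. natr (c l) \<otimes> f (k - l)"
    define g where "g = (\<Oplus>l\<in>{..k}. ?x l)"
    have gc: "g \<in> carrier R" unfolding g_def using fc by (intro finsum_closed) auto
    have "g [^] p = (\<Oplus>l\<in>{..k}. ?x l [^] p)"
      unfolding g_def using fc by (intro frobenius_finsum[OF p ch]) auto
    also have "\<dots> = (\<Oplus>l\<in>{..k}. ?x l \<oplus> a \<otimes> ?y l)"
    proof (rule finsum_cong')
      fix l assume "l \<in> {..k}"
      then have e: "Suc k - l = Suc (k - l)" by auto
      have "?x l [^] p = natr (c l) \<otimes> (f (Suc k - l) \<oplus> a \<otimes> f (k - l))"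
        using fc frobenius_prime_field[OF p ch, of "c l"] fp[of "k - l"] unfolding e by (subst nat_pow_distrib) auto
      also have "\<dots> = ?x l \<oplus> a \<otimes> ?y l"
        using fc[of "Suc k - l"] fc[of "k - l"] ac add.nat_pow_closed[OF one_closed, of "c l"] by algebra
      finally show "?x l [^] p
        = ?x l \<oplus> a \<otimes> ?y l" .
    qed (use fc ac in auto)
    also have "\<dots> = g \<oplus> (\<Oplus>l\<in>{..k}. a \<otimes> ?y l)"
      unfolding g_def using fc ac by (intro finsum_addf) auto
    also have "(\<Oplus>l\<in>{..k}. a \<otimes> ?y l) = a \<otimes> D c k"
      unfolding D_def using fc ac by (intro finsum_rdistr[symmetric]) auto
    also have "D c k = s (f k)" using c(2) by simp
    finally have gp: "g [^] p = g \<oplus> a \<otimes> s (f k)" .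
    have "s (f (Suc k)) [^] p = s (f (Suc k)) \<oplus> a \<otimes> s (f k)"
      using Gam_pow[OF s fc, symmetric] fp[of k] fc ac by (simp add: Gam_add[OF s] Gam_mult[OF s] Gam_fix[OF s aK])
    then obtain m :: nat where m: "s (f (Suc k)) = g \<oplus> natr m"
      using artin_schreier_translate[OF p ch gc Gam_closed[OF s fc] _ gp] Gam_closed[OF s fc] ac by auto
    define c' where "c' = c(Suc k := m)"
    have "D c' j = D c j" if "j \<le> k" for j
      unfolding D_def by (rule finsum_cong') (use that fc in \<open>auto simp: c'_def\<close>)
    moreover have "D c' (Suc k) = s (f (Suc k))"
    proof -
      have "D c' (Suc k) = natr m \<otimes> f 0 \<oplus> (\<Oplus>l\<in>{..k}. natr (c' l) \<otimes> f (Suc k - l))"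
        unfolding D_def using fc by (subst finsum_Suc) (auto simp: c'_def)
      also have "(\<Oplus>l\<in>{..k}. natr (c' l) \<otimes> f (Suc k - l)) = g"
        unfolding g_def by (rule finsum_cong') (use fc in \<open>auto simp: c'_def\<close>)
      finally show ?thesis unfolding m using gc f0 by (simp add: a_comm[OF gc])
    qed
    moreover have "c' 0 = 1" using c(1) by (simp add: c'_def)
    ultimately show ?case using c(2) by (intro exI[of _ c']) (metis le_Suc_eq)
  qed
  \<comment> \<open>\<open>f\<close> has constant term \<open>\<one>\<close>, so a product with
    \<open>f\<close> determines the other factor recursively, here modulo \<open>p\<close>.\<close>
  have unique: "[c l = c' l] (mod p)" if eq: "\<And>j. j \<le> l \<Longrightarrow> D c j = D c' j" for c c' l
    using eq
  proof (induction l rule: less_induct)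
    case (less l)
    have IH: "natr (c i) = natr (c' i)" if "i < l" for i
      using less.IH[of i] less.prems that prime_field_add_pow_eq_iff[OF p ch] by simp
    have "natr (c l) = natr (c' l)"
    proof (cases l)
      case 0 then show ?thesis using less.prems[of 0] by (simp add: D_def f0)
    next
      case (Suc k)
      have split: "D c l = natr (c l) \<oplus> (\<Oplus>i\<in>{..k}. natr (c i) \<otimes> f (l - i))" for c
        unfolding D_def Suc using fc by (subst finsum_Suc) (auto simp: f0)
      have "(\<Oplus>i\<in>{..k}. natr (c i) \<otimes> f (l - i)) = (\<Oplus>i\<in>{..k}. natr (c' i) \<otimes> f (l - i))"
        by (rule finsum_cong') (use IH fc Suc in auto)
      moreover have "(\<Oplus>i\<in>{..k}. natr (c' i) \<otimes> f (l - i)) \<in> carrier R" using fc by (intro finsum_closed) auto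
      ultimately show ?thesis using less.prems[of l] split[of c] split[of c'] by simp
    qed
    then show ?case using prime_field_add_pow_eq_iff[OF p ch] by simp
  qed
  define c where "c s = (SOME c. c 0 = 1 \<and> (\<forall>j\<le>n. s (f j) = D c j))" for s
  have c: "c s 0 = 1" "j \<le> n \<Longrightarrow> s (f j) = D (c s) j" if "s \<in> Gam" for s j
    using someI_ex[OF ex[OF that, of n]] unfolding c_def by auto
  \<comment> \<open>Apply \<open>s\<close> to \<open>t f = c(t) f\<close>: the coefficients of
    \<open>c(t)\<close> lie in the prime field and are fixed, so the result is
    \<open>c(t) c(s) f\<close>, and \<open>unique\<close> cancels \<open>f\<close>.\<close>
  have c_comp: "[c (s \<circ> t) m = (\<Sum>l\<le>m. c t l * c s (m - l))] (mod p)" if st: "s \<in> Gam" "t \<in> Gam" and m: "m \<le> n" for s t m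
  proof (rule unique[of m "c (s \<circ> t)" "\<lambda>m. \<Sum>l\<le>m. c t l * c s (m - l)"])
    fix j assume "j \<le> m"
    then have j: "j \<le> n" using m by simp
    let ?b = "\<lambda>l. natr (c t l)" and ?d = "\<lambda>l. natr (c s l)"
    interpret h: ring_hom_cring R R s by (rule Gam_ring_hom[OF st(1)])
    have "D (c (s \<circ> t)) j = s (D (c t) j)" using c(2)[OF Gam_comp[OF st] j] c(2)[OF st(2) j] by simp
    also have "\<dots> = (\<Oplus>l\<in>{..j}. s (?b l \<otimes> f (j - l)))"
      unfolding D_def using fc by (subst h.hom_finsum) (auto simp: comp_def)
    also have "\<dots> = (\<Oplus>l\<in>{..j}. \<Oplus>i\<in>{..j - l}. ?b l \<otimes> ?d i \<otimes> f (j - l - i))"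
    proof (rule finsum_cong')
      fix l assume "l \<in> {..j}"
      have "s (?b l \<otimes> f (j - l)) = ?b l \<otimes> D (c s) (j - l)"
        using fc j c(2)[OF st(1), of "j - l"] by (simp add: Gam_mult[OF st(1)] Gam_add_pow[OF st(1)])
      also have "\<dots> = (\<Oplus>i\<in>{..j - l}. ?b l \<otimes> (?d i \<otimes> f (j - l - i)))"
        unfolding D_def using fc by (intro finsum_rdistr) auto
      also have "\<dots> = (\<Oplus>i\<in>{..j - l}. ?b l \<otimes> ?d i \<otimes> f (j - l - i))"
        by (rule finsum_cong') (use fc in \<open>auto simp: m_assoc\<close>)
      finally show "s (?b l \<otimes> f (j - l)) = (\<Oplus>i\<in>{..j - l}. ?b l \<otimes> ?d i \<otimes> f (j - l - i))" .
    qed (use fc in auto)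
    \<comment> \<open>Regroup by the total degree \<open>k\<close> of the two prime field
      coefficients, so that their convolution appears.\<close>
    also have "\<dots> = (\<Oplus>k\<in>{..j}. \<Oplus>i\<in>{..k}. ?b i \<otimes> ?d (k - i) \<otimes> f (j - i - (k - i)))"
      using fc by (intro finsum_triangle[symmetric]) auto
    also have "\<dots> = D (\<lambda>m. \<Sum>l\<le>m. c t l * c s (m - l)) j"
      unfolding D_def
    proof (rule finsum_cong')
      fix k assume "k \<in> {..j}"
      have "(\<Oplus>i\<in>{..k}. ?b i \<otimes> ?d (k - i) \<otimes> f (j - i - (k - i))) = (\<Oplus>i\<in>{..k}. natr (c t i * c s (k - i)) \<otimes> f (j - k))"
        by (rule finsum_cong') (use fc in \<open>auto simp: add_pow_mult_one\<close>)
      also have "\<dots> = (\<Oplus>i\<in>{..k}. natr (c t i * c s (k - i))) \<otimes> f (j - k)"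
        using fc by (intro finsum_ldistr[symmetric]) auto
      finally show "(\<Oplus>i\<in>{..k}. ?b i \<otimes> ?d (k - i) \<otimes> f (j - i - (k - i)))
        = natr (\<Sum>l\<le>k. c t l * c s (k - l)) \<otimes> f (j - k)"
        by (simp add: add_pow_sum)
    qed (use fc in auto)
    finally show "D (c (s \<circ> t)) j = D (\<lambda>m. \<Sum>l\<le>m. c t l * c s (m - l)) j" .
  qed
  define ys where "ys i = map f (rev [0..<i])" for i
  have ys_c: "set (ys i) \<subseteq> carrier R" for i using fc by (auto simp: ys_def)
  have set_ys: "set (ys i) = f ` {..<i}" for i by (simp only: ys_def set_map set_rev set_upt atLeast0LessThan)
  have ys_N: "\<exists>m. conj_count (ys (Suc i)) = p ^ m" for i
  proof (induction i)
    case 0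
    have "(\<lambda>s. map s [\<one>]) ` Gam = {[\<one>]}" using Gam_id Gam_one by (auto intro!: image_eqI[of _ _ id])
    then show ?case by (intro exI[of _ 0]) (simp add: ys_def f0 conj_count_def)
  next
    case (Suc i)
    then obtain m where m: "conj_count (ys (Suc i)) = p ^ m" by blast
    have "s (a \<otimes> f i) = a \<otimes> f i" if s: "s \<in> fixes_on (set (ys (Suc i)))" for s
      using s fc ac unfolding set_ys by (auto simp: Gam_mult[OF fixes_on_Gam[OF s]] Gam_fix[OF fixes_on_Gam[OF s] aK] fixes_on_def)
    then obtain m' where "conj_count (f (Suc i) # ys (Suc i)) = p ^ m'"
      using conj_count_artin_schreier[OF p ch ys_c fc _ fp _ m] fc ac by auto
    then show ?case by (auto simp: ys_def)
  qed
  define zs where "zs = ys (Suc n)"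
  have zs_c: "set zs \<subseteq> carrier R" unfolding zs_def by (rule ys_c)
  have zs_mem: "f j \<in> set zs" if "j \<le> n" for j using that unfolding zs_def set_ys by auto
  note P = finite_extension_props[OF zs_c]
  note sr = subfieldE(1)[OF P(1)]
  have ap: "natr (k::nat) \<in> adjoin zs" for k
    by (induction k) (use subringE(2,3,7)[OF sr] in auto)
  have st: "stable (adjoin zs)"
  proof (rule stable_finite_extension[OF zs_c])
    fix s x assume s: "s \<in> Gam" and x: "x \<in> set zs"
    have "\<exists>j\<le>n. x = f j" using x unfolding zs_def set_ys by (force simp: less_Suc_eq_le)
    then obtain j where j: "j \<le> n" "x = f j" by blast
    have "D (c s) j \<in> adjoin zs"
      unfolding D_def using zs_mem j P(3) ap by (intro subring_finsum[OF sr] subringE(6)[OF sr]) auto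
    then show "s x \<in> adjoin zs" using c(2)[OF s j(1)] j(2) by simp
  qed
  obtain m where "conj_count zs = p ^ m" using ys_N zs_def by blast
  then have gal: "galois_p_ext R K p (adjoin zs)" by (rule galois_p_extI[OF zs_c st])
  \<comment> \<open>The upper triangular Toeplitz matrix of multiplication by \<open>s f / f\<close>
    modulo \<open>T ^ (n + 1)\<close>.\<close>
  define \<rho> where "\<rho> s i j = int (c s (j - i))" for s and i j :: nat
  have "unipotent_rep n zs \<rho>"
    unfolding unipotent_rep_def
  proof (intro conjI ballI allI impI)
    show "set zs \<subseteq> carrier R" "galois_p_ext R K p (adjoin zs)" by (fact zs_c, fact gal)
  next
    fix s t i j assume st: "s \<in> Gam" "t \<in> Gam" "\<forall>x\<in>set zs. s x = t x" and ij: "i \<le> j" "j \<le> n"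
    have "[c s (j - i) = c t (j - i)] (mod p)"
    proof (rule unique[of _ "c s" "c t"])
      fix l assume "l \<le> j - i"
      then have "l \<le> n" using ij by simp
      then show "D (c s) l = D (c t) l" using c(2)[OF st(1)] c(2)[OF st(2)] st(3) zs_mem by metis
    qed
    then show "[\<rho> s i j = \<rho> t i j] (mod int p)" by (simp add: \<rho>_def cong_int_iff)
  next
    fix s t i j assume st: "s \<in> Gam" "t \<in> Gam" and ij: "i \<le> j" "j \<le> n"
    have "[\<rho> (s \<circ> t) i j = int (\<Sum>l\<le>j - i. c t l * c s (j - i - l))] (mod int p)"
      using c_comp[OF st, of "j - i"] ij unfolding \<rho>_def cong_int_iff by simp
    also have "int (\<Sum>l\<le>j - i. c t l * c s (j - i - l)) = (\<Sum>l\<le>j - i. int (c t l) * int (c s (j - i - l)))" by simp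
    also have "\<dots> = (\<Sum>l=i..j. \<rho> s i l * \<rho> t l j)"
      by (rule sum.reindex_bij_witness[of _ "\<lambda>l. j - l" "\<lambda>l. j - l"]) (use ij in \<open>auto simp: \<rho>_def mult.commute diff_right_commute add.commute\<close>)
    finally show "[\<rho> (s \<circ> t) i j = (\<Sum>l=i..j. \<rho> s i l * \<rho> t l j)] (mod int p)" .
  next
    fix s i assume "s \<in> Gam"
    then show "[\<rho> s i i = 1] (mod int p)" using c(1) by (simp add: \<rho>_def)
  next
    fix s i assume s: "s \<in> Gam" and i: "i < n"
    \<comment> \<open>In degree \<open>1\<close> the relation reads \<open>s x = c_1 + x\<close>,
      while \<open>x = s x + e(s)\<close> by the choice of \<open>x\<close>; hence
      \<open>c_1 = - e(s)\<close>.\<close>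
    have "s x = D (c s) 1" using c(2)[OF s, of 1] i f1 by simp
    also have "\<dots> = natr (c s 1) \<oplus> x"
      unfolding D_def using fc c(1)[OF s] x(1) by (simp add: finsum_Suc f0 f1[simplified])
    finally have "x = natr (c s 1) \<oplus> x \<oplus> natr (e s)" using x(2)[OF s] by simp
    then have "x \<oplus> \<zero> = x \<oplus> (natr (c s 1) \<oplus> natr (e s))" using x(1) by (simp add: a_ac)
    then have "natr (c s 1 + e s) = natr (0::nat)" using x(1) by (simp add: add.nat_pow_mult del: add.nat_pow_Suc)
    then have "p dvd c s 1 + e s" using prime_field_add_pow_eq_iff[OF p ch, of "c s 1 + e s" 0] by (simp add: cong_0_iff)
    then show "[\<rho> s i (Suc i) = - int (e s)] (mod int p)"
      by (simp add: \<rho>_def cong_iff_dvd_diff flip: of_nat_add)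
  qed
  then show ?thesis by (rule that)
qed

end

section \<open>The Krull topology and the Massey product\<close>

lemma gal_subset_PiE: "carrier (gal E K) \<subseteq> PiE (carrier E) (\<lambda>_. carrier E)"
  by (auto simp: gal_def ring_iso_def ring_hom_def PiE_def)

lemma topspace_krull: "topspace (krull_topology E K) = carrier (gal E K)"
  using gal_subset_PiE[of E K] unfolding krull_topology_def by auto

lemma cochain1_range:
  assumes "cochain1 p (krull_topology E K) a" "g \<in> carrier (gal E K)" shows "a g \<in> {0..<int p}"
proof -
  have "a ` topspace (krull_topology E K) \<subseteq> {0..<int p}"
    using assms(1) continuous_map_image_subset_topspace unfolding cochain1_def by fastforce
  then show ?thesis using assms(2) unfolding topspace_krull by blast
qed

text \<open>Prescribing the values on a finite set \<open>S\<close> cuts out a basic open set of the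
  product topology, so a function that depends only on these values is locally constant.\<close>

lemma cochain1_krullI:
  assumes S: "finite S" "S \<subseteq> carrier E"
    and a: "\<And>g. g \<in> carrier (gal E K) \<Longrightarrow> a g \<in> {0..<int p}"
      "\<And>g h. g \<in> carrier (gal E K) \<Longrightarrow> h \<in> carrier (gal E K) \<Longrightarrow> (\<And>x. x \<in> S \<Longrightarrow> g x = h x) \<Longrightarrow> a g = a h"
  shows "cochain1 p (krull_topology E K) a"
proof -
  let ?G = "carrier (gal E K)" and ?P = "product_topology (\<lambda>_. discrete_topology (carrier E)) (carrier E)"
  note GP = gal_subset_PiE[of E K] and top = topspace_krull[of E K]
  have "openin (krull_topology E K) {g \<in> ?G. a g \<in> V}" for V
  proof (subst openin_subopen, intro ballI)
    fix g assume g: "g \<in> {g \<in> ?G. a g \<in> V}"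
    let ?W = "PiE (carrier E) (\<lambda>x. if x \<in> S then {g x} else carrier E)"
    have cl: "g x \<in> carrier E" if "x \<in> carrier E" for x
      using g that PiE_mem[OF subsetD[OF GP], of g x] by blast
    have "{i \<in> carrier E. (if i \<in> S then {g i} else carrier E) \<noteq> carrier E} \<subseteq> S" by auto
    then have "finite {i \<in> carrier E. (if i \<in> S then {g i} else carrier E) \<noteq> carrier E}"
      using S(1) by (rule finite_subset)
    then have "openin ?P ?W" using cl by (auto simp: openin_PiE_gen)
    then have o: "openin (krull_topology E K) (?W \<inter> ?G)"
      unfolding krull_topology_def by (rule openin_subtopology_Int)
    have "g \<in> ?W \<inter> ?G" using g GP by (auto simp: PiE_iff)
    moreover have "?W \<inter> ?G \<subseteq> {g \<in> ?G. a g \<in> V}"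
    proof
      fix h assume h: "h \<in> ?W \<inter> ?G"
      have "h x = g x" if x: "x \<in> S" for x
      proof -
        have "h x \<in> (if x \<in> S then {g x} else carrier E)" using PiE_mem[of h "carrier E"] h subsetD[OF S(2) x] by blast
        then show ?thesis using x by simp
      qed
      then have "a h = a g" using a(2) h g by blast
      then show "h \<in> {g \<in> ?G. a g \<in> V}" using h g by auto
    qed
    ultimately show "\<exists>T. openin (krull_topology E K) T \<and> g \<in> T \<and> T \<subseteq> {g \<in> ?G. a g \<in> V}" using o by blast
  qed
  then show ?thesis using a(1) by (auto simp: cochain1_def continuous_map_def top)
qed

text \<open>The fibre through \<open>h\<close> is open and so contains a basic neighbourhood of
  \<open>h\<close>, which constrains only finitely many arguments.\<close>

lemma cochain1_krullD:
  assumes a: "cochain1 p (krull_topology E K) a" and h: "h \<in> carrier (gal E K)"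
  obtains S where "finite S" "S \<subseteq> carrier E"
    "\<And>g. g \<in> carrier (gal E K) \<Longrightarrow> (\<And>x. x \<in> S \<Longrightarrow> g x = h x) \<Longrightarrow> a g = a h"
proof -
  let ?G = "carrier (gal E K)" and ?P = "product_topology (\<lambda>_. discrete_topology (carrier E)) (carrier E)"
  note GP = gal_subset_PiE[of E K] and top = topspace_krull[of E K]
  have c: "continuous_map (krull_topology E K) (discrete_topology {0..<int p}) a" using a by (simp add: cochain1_def)
  have "a h \<in> {0..<int p}" by (rule cochain1_range[OF a h])
  then have "openin (krull_topology E K) {g \<in> topspace (krull_topology E K). a g \<in> {a h}}"
    using c by (intro openin_continuous_map_preimage[OF c]) auto
  then obtain W where W: "openin ?P W" "{g \<in> ?G. a g \<in> {a h}} = W \<inter> ?G"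
    unfolding top by (auto simp: krull_topology_def openin_subtopology)
  have "h \<in> W" using W(2) h by blast
  then obtain U where U: "finite {i \<in> carrier E. U i \<noteq> topspace (discrete_topology (carrier E))}"
    "h \<in> PiE (carrier E) U" "PiE (carrier E) U \<subseteq> W"
    using W(1) unfolding openin_product_topology_alt by blast
  let ?S = "{i \<in> carrier E. U i \<noteq> carrier E}"
  show ?thesis
  proof (rule that[of ?S])
    show "finite ?S" using U(1) by simp
    fix g assume g: "g \<in> ?G" "\<And>x. x \<in> ?S \<Longrightarrow> g x = h x"
    have "g \<in> PiE (carrier E) U"
    proof (rule PiE_I)
      fix x assume x: "x \<in> carrier E"
      then show "g x \<in> U x"
        using g GP U(2) by (cases "U x = carrier E") (auto simp: PiE_iff)
    next
      fix x assume "x \<notin> carrier E"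
      then show "g x = undefined" using g(1) by (auto simp: gal_def extensional_def)
    qed
    then show "a g = a h" using U(3) W(2) g(1) by blast
  qed auto
qed

section \<open>Restriction to a stable subfield and lifting to the separable closure\<close>

context separable_closure
begin

text \<open>Stability of \<open>M\<close> under both \<open>s\<close> and its inverse makes the
  restriction a bijection of \<open>M\<close>.\<close>

lemma restrict_Gam_in_gal:
  assumes M: "subfield M R" "K \<subseteq> M" "stable M" and s: "s \<in> Gam"
  shows "restrict s M \<in> carrier (gal (R\<lparr>carrier := M\<rparr>) K)"
proof -
  have Mc: "M \<subseteq> carrier R" using subfieldE(3)[OF M(1)] .
  note sr = subfieldE(1)[OF M(1)]
  have sM: "s x \<in> M" if "x \<in> M" for x using M(3) s that by (simp add: stable_def)
  have "bij_betw (restrict s M) M M"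
    unfolding bij_betw_def
  proof
    show "inj_on (restrict s M) M" using inj_on_subset[OF Gam_inj[OF s] Mc] by (simp add: inj_on_def)
    obtain t where t: "t \<in> Gam" "\<And>x. x \<in> carrier R \<Longrightarrow> s (t x) = x" using Gam_inv[OF s] by metis
    have "x \<in> s ` M" if x: "x \<in> M" for x
    proof -
      have "x = s (t x)" "t x \<in> M" using t(2)[of x] M(3) t(1) x Mc by (auto simp: stable_def)
      then show ?thesis by blast
    qed
    then show "restrict s M ` M = M" using sM by auto
  qed
  moreover have "restrict s M \<in> ring_hom (R\<lparr>carrier := M\<rparr>) (R\<lparr>carrier := M\<rparr>)"
    using sM Gam_add[OF s] Gam_mult[OF s] Gam_one[OF s] subringE(3,6,7)[OF sr] subsetD[OF Mc]
    by (intro ring_hom_memI) auto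
  moreover have "restrict s M k = k" if "k \<in> K" for k
    using that M(2) Gam_fix[OF s] by auto
  ultimately show ?thesis by (auto simp: gal_def ring_iso_def)
qed

text \<open>With this, cochains on the Galois group of \<open>M\<close> over \<open>K\<close> can be
  computed from automorphisms of the whole closure.\<close>

lemma gal_extends_to_Gam:
  assumes M: "subfield M R" "K \<subseteq> M" and g: "g \<in> carrier (gal (R\<lparr>carrier := M\<rparr>) K)"
  obtains s where "s \<in> Gam" "\<And>x. x \<in> M \<Longrightarrow> s x = g x"
proof -
  have h: "g \<in> ring_hom (R\<lparr>carrier := M\<rparr>) (R\<lparr>carrier := M\<rparr>)" "\<And>k. k \<in> K \<Longrightarrow> g k = k"
    using g by (auto simp: gal_def ring_iso_def)
  have "g \<in> ring_hom (R\<lparr>carrier := M\<rparr>) R"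
    using h(1) subfieldE(3)[OF M(1)] by (auto simp: ring_hom_def)
  then have "emb M g" using M h(2) by (simp add: emb_def)
  then obtain t where "emb (carrier R) t" "\<And>x. x \<in> M \<Longrightarrow> t x = g x" using emb_extend by metis
  then show ?thesis using that emb_carrier_Gam by blast
qed

end

theorem theorem8p1:
  fixes \<Omega> :: "('a, 'b) ring_scheme" and K :: "'a set" and p n :: nat
    and E :: "('a, 'b) ring_scheme" and chi :: "('a \<Rightarrow> 'a) \<Rightarrow> int"
  assumes "Factorial_Ring.prime p" and "n \<ge> 3"
    and "separable_closure_of \<Omega> K"
    and "add_pow \<Omega> p \<one>\<^bsub>\<Omega>\<^esub> \<noteq> \<zero>\<^bsub>\<Omega>\<^esub> \<Longrightarrow>
           (\<exists>\<zeta> \<in> K. \<zeta> [^]\<^bsub>\<Omega>\<^esub> p = \<one>\<^bsub>\<Omega>\<^esub> \<and> (\<forall>k::nat. 0 < k \<and> k < p \<longrightarrow> \<zeta> [^]\<^bsub>\<Omega>\<^esub> k \<noteq> \<one>\<^bsub>\<Omega>\<^esub>))"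
    and "p = 2 \<Longrightarrow> (\<exists>x \<in> K. x \<otimes>\<^bsub>\<Omega>\<^esub> x = \<ominus>\<^bsub>\<Omega>\<^esub> \<one>\<^bsub>\<Omega>\<^esub>)"
    and "E = \<Omega> \<or> E = \<Omega>\<lparr>carrier := max_p_ext \<Omega> K p\<rparr>"
    and "H1_elem p (gal E K) (krull_topology E K) chi"
  shows "massey_contains_zero p (gal E K) (krull_topology E K) n (\<lambda>_. chi)"
proof -
  interpret separable_closure \<Omega> K
    using assms(3) by (auto simp: separable_closure_def separable_closure_axioms_def separable_closure_of_def)
  \<comment> \<open>\<open>M\<close> covers both choices of the group at once: it is the separable
    closure or the maximal \<open>p\<close>-extension. Either way it is a stable intermediate field
    containing every finite Galois \<open>p\<close>-extension.\<close>
  obtain M where E: "E = \<Omega>\<lparr>carrier := M\<rparr>" and M: "subfield M \<Omega>" "K \<subseteq> M" "stable M"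
    and gM: "\<And>L. galois_p_ext \<Omega> K p L \<Longrightarrow> L \<subseteq> M"
  proof (cases "E = \<Omega>")
    case True
    show ?thesis
    proof (rule that[of "carrier \<Omega>"])
      show "E = \<Omega>\<lparr>carrier := carrier \<Omega>\<rparr>" using True by simp
      show "subfield (carrier \<Omega>) \<Omega>" by (rule carrier_is_subfield)
      show "K \<subseteq> carrier \<Omega>" by (rule K_carrier)
      show "stable (carrier \<Omega>)" by (simp add: stable_def Gam_closed)
      show "L \<subseteq> carrier \<Omega>" if "galois_p_ext \<Omega> K p L" for L
        using that subfieldE(3) unfolding galois_p_ext_def by fast
    qed
  next
    case False
    then show ?thesis
      using assms(6) max_p_ext_subfield[OF assms(1)] by (intro that[of "max_p_ext \<Omega> K p"]) (auto simp: max_p_ext_def)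
  qed
  let ?G = "carrier (gal E K)" and ?T = "krull_topology E K"
  have Mc: "M \<subseteq> carrier \<Omega>" using subfieldE(3)[OF M(1)] .
  have mult: "monoid.mult (gal E K) = compose M" by (simp add: gal_def E)
  have res: "restrict s M \<in> ?G" if "s \<in> Gam" for s using restrict_Gam_in_gal[OF M that] E by simp
  have chi: "cochain1 p ?T chi"
    and chi_hom: "\<And>g h. g \<in> ?G \<Longrightarrow> h \<in> ?G \<Longrightarrow> (chi h - chi (compose M g h) + chi g) mod int p = 0"
    using assms(7) by (auto simp: H1_elem_def delta1_def mult)
  have chi_range: "chi g \<in> {0..<int p}" if "g \<in> ?G" for g
    by (rule cochain1_range[OF chi that])
  \<comment> \<open>A natural number, because \<open>e s\<close> occurs as an exponent of
    \<open>\<zeta>\<close>.\<close>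
  define e where "e s = nat (chi (restrict s M))" for s
  have int_e: "int (e s) = chi (restrict s M)" if "s \<in> Gam" for s
    using chi_range[OF res[OF that]] by (simp add: e_def)
  have res_comp: "restrict (s \<circ> t) M = compose M (restrict s M) (restrict t M)" if "t \<in> Gam" for s t
    using M(3) that by (auto simp: compose_def stable_def)
  have id_G: "restrict id M \<in> ?G" by (rule res[OF Gam_id])
  \<comment> \<open>Continuity at the identity: \<open>chi\<close> is constant on the automorphisms
    that fix a finite set \<open>S\<close>. This yields the open kernel demanded by
    \<open>galois_character\<close>.\<close>
  obtain S where S: "finite S" "S \<subseteq> carrier E"
    "\<And>g. g \<in> ?G \<Longrightarrow> (\<And>x. x \<in> S \<Longrightarrow> g x = restrict id M x) \<Longrightarrow> chi g = chi (restrict id M)"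
    using cochain1_krullD[OF chi id_G] by metis
  have SM: "S \<subseteq> M" using S(2) E by simp
  have chi_id: "chi (restrict id M) = 0"
  proof -
    have "compose M (restrict id M) (restrict id M) = restrict id M" by (auto simp: compose_def)
    then have "int p dvd chi (restrict id M)" using chi_hom[OF id_G id_G] by (simp add: mod_0_imp_dvd)
    then show ?thesis using chi_range[OF id_G] by (auto dest: zdvd_imp_le)
  qed
  obtain xs where xs: "set xs = S" using finite_list[OF S(1)] by blast
  interpret galois_character \<Omega> K p e xs
  proof
    show "Factorial_Ring.prime p" by fact
    show "e s = e t" if "s \<in> Gam" "t \<in> Gam" "\<And>x. x \<in> carrier \<Omega> \<Longrightarrow> s x = t x" for s t
    proof -
      have "restrict s M = restrict t M" using that(3) Mc by (intro restrict_ext) auto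
      then show ?thesis by (simp add: e_def)
    qed
    show "[e (s \<circ> t) = e s + e t] (mod p)" if st: "s \<in> Gam" "t \<in> Gam" for s t
    proof -
      have "(int (e t) - int (e (s \<circ> t)) + int (e s)) mod int p = 0"
        unfolding int_e[OF st(1)] int_e[OF st(2)] int_e[OF Gam_comp[OF st]] res_comp[OF st(2)]
        by (rule chi_hom[OF res[OF st(1)] res[OF st(2)]])
      then have "[int (e (s \<circ> t)) = int (e s + e t)] (mod int p)"
        by (simp add: cong_iff_dvd_diff mod_eq_0_iff_dvd) (metis add.commute diff_add_eq dvd_minus_iff minus_diff_eq)
      then show ?thesis by (simp only: cong_int_iff)
    qed
    show "set xs \<subseteq> carrier \<Omega>" using xs SM Mc by blast
    show "[e s = 0] (mod p)" if "s \<in> fixes_on (set xs)" for s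
    proof -
      have s: "s \<in> Gam" "\<And>x. x \<in> S \<Longrightarrow> s x = x" using that xs by (auto simp: fixes_on_def)
      have "chi (restrict s M) = 0" using S(3)[OF res[OF s(1)]] s(2) SM chi_id by auto
      then show ?thesis by (simp add: e_def)
    qed
  qed
  obtain zs \<rho> where rep: "unipotent_rep n zs \<rho>"
  proof (cases "add_pow \<Omega> p \<one>\<^bsub>\<Omega>\<^esub> = \<zero>\<^bsub>\<Omega>\<^esub>")
    case True then show ?thesis using unipotent_rep_artin_schreier that by blast
  next
    case False
    then obtain \<zeta> where "\<zeta> \<in> K" "\<zeta> [^]\<^bsub>\<Omega>\<^esub> p = \<one>\<^bsub>\<Omega>\<^esub>" "\<And>k::nat. 0 < k \<Longrightarrow> k < p \<Longrightarrow> \<zeta> [^]\<^bsub>\<Omega>\<^esub> k \<noteq> \<one>\<^bsub>\<Omega>\<^esub>"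
      using assms(4) by blast
    then show ?thesis using unipotent_rep_kummer[OF False assms(2)] assms(5) that by metis
  qed
  have zs: "set zs \<subseteq> carrier \<Omega>" and gal: "galois_p_ext \<Omega> K p (adjoin zs)"
    using rep by (auto simp: unipotent_rep_def)
  have \<rho>_cong: "[\<rho> s i j = \<rho> t i j] (mod int p)"
    if "s \<in> Gam" "t \<in> Gam" "\<And>x. x \<in> set zs \<Longrightarrow> s x = t x" "i \<le> j" "j \<le> n" for s t i j
    using rep that by (simp add: unipotent_rep_def)
  have \<rho>_comp: "[\<rho> (s \<circ> t) i j = (\<Sum>l=i..j. \<rho> s i l * \<rho> t l j)] (mod int p)"
    if "s \<in> Gam" "t \<in> Gam" "i \<le> j" "j \<le> n" for s t i j
    using rep that by (simp add: unipotent_rep_def)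
  have \<rho>_diag: "[\<rho> s i i = 1] (mod int p)" if "s \<in> Gam" "i \<le> n" for s i
    using rep that by (simp add: unipotent_rep_def)
  have \<rho>_super: "[\<rho> s i (Suc i) = - int (e s)] (mod int p)" if "s \<in> Gam" "i < n" for s i
    using rep that by (simp add: unipotent_rep_def)
  have zsM: "set zs \<subseteq> M" using gM[OF gal] finite_extension_props(3)[OF zs] by blast
  \<comment> \<open>Lifts are chosen without regard to multiplicativity. Two lifts agree on
    \<open>M\<close>, which contains \<open>zs\<close>, so by \<open>\<rho>_cong\<close> the entries
    of \<open>\<rho>\<close> modulo \<open>p\<close> do not depend on the choice.\<close>
  have "\<forall>g. \<exists>s. g \<in> ?G \<longrightarrow> s \<in> Gam \<and> (\<forall>x\<in>M. s x = g x)"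
    using gal_extends_to_Gam[OF M(1,2)] E by metis
  then obtain lift where lift: "g \<in> ?G \<Longrightarrow> lift g \<in> Gam" "g \<in> ?G \<Longrightarrow> x \<in> M \<Longrightarrow> lift g x = g x" for g x
    by metis
  have p0: "0 < p" using prime_gt_0_nat[OF assms(1)] .
  \<comment> \<open>Indices of \<open>\<rho>\<close> start at \<open>0\<close>, those of a defining
    system at \<open>1\<close>. Reduction modulo \<open>p\<close> puts the values into the range of
    a cochain.\<close>
  define a where "a i j g = (- \<rho> (lift g) (i - 1) (j - 1)) mod int p" for i j :: nat and g
  have a_cong: "[a i j g = - \<rho> (lift g) (i - 1) (j - 1)] (mod int p)" for i j g
    by (simp add: a_def cong_def)
  have a_cochain: "cochain1 p ?T (a i j)" if ij: "1 \<le> i" "i < j" "j \<le> n + 1" for i j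
  proof (rule cochain1_krullI)
    show "finite (set zs)" "set zs \<subseteq> carrier E" using zsM E by auto
    show "a i j g \<in> {0..<int p}" for g using p0 by (simp add: a_def)
    fix g h assume st: "g \<in> ?G" "h \<in> ?G" and eq: "\<And>x. x \<in> set zs \<Longrightarrow> g x = h x"
    have "[\<rho> (lift g) (i - 1) (j - 1) = \<rho> (lift h) (i - 1) (j - 1)] (mod int p)"
      using ij eq lift(2)[OF st(1)] lift(2)[OF st(2)] zsM
      by (intro \<rho>_cong lift(1) st) auto
    then show "a i j g = a i j h" unfolding a_def cong_def[symmetric] by (simp add: cong_minus_minus_iff)
  qed
  have a_super: "a i (i + 1) g = chi g" if i: "1 \<le> i" "i \<le> n" and g: "g \<in> ?G" for i g
  proof -
    have "restrict (lift g) M = g"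
    proof (rule extensionalityI[of _ M])
      show "g \<in> extensional M" using g by (simp add: gal_def E)
    qed (use lift(2)[OF g] in auto)
    then have "int (e (lift g)) = chi g" using int_e[OF lift(1)[OF g]] by simp
    moreover have "[\<rho> (lift g) (i - 1) (Suc (i - 1)) = - int (e (lift g))] (mod int p)"
      using i by (intro \<rho>_super lift(1) g) auto
    ultimately have "[- \<rho> (lift g) (i - 1) i = chi g] (mod int p)"
      using i cong_minus_minus_iff by fastforce
    then show ?thesis using chi_range[OF g] by (simp add: a_def cong_def)
  qed
  \<comment> \<open>In the product formula for \<open>\<rho>\<close> the two extreme summands
    contribute the entries of \<open>?t\<close> and \<open>?s\<close> themselves; what remains is
    the sum over intermediate indices, where the signs of the two factors cancel. The pair
    \<open>(1, n + 1)\<close> is included and later shows that the Massey value is a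
    coboundary.\<close>
  have a_eq: "[delta1 (compose M) (a i j) g h = (\<Sum>l=i + 1..j - 1. cup11 (a i l) (a l j) g h)] (mod int p)"
    if ij: "1 \<le> i" "i < j" "j \<le> n + 1" and st: "g \<in> ?G" "h \<in> ?G" for i j g h
  proof -
    define i' j' where "i' = i - 1" and "j' = j - 1"
    have ij': "i' < j'" "j' \<le> n" "i = Suc i'" "j = Suc j'" using ij by (auto simp: i'_def j'_def)
    let ?s = "lift g" and ?t = "lift h"
    note sG = lift(1)[OF st(1)] and tG = lift(1)[OF st(2)]
    have st_eq: "restrict (?s \<circ> ?t) M = compose M g h"
    proof
      fix x show "restrict (?s \<circ> ?t) M x = compose M g h x"
        using M(3) tG lift(2)[OF st(1)] lift(2)[OF st(2)] by (auto simp: compose_def stable_def restrict_def)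
    qed
    have cG: "compose M g h \<in> ?G" using res[OF Gam_comp[OF sG tG]] unfolding st_eq .
    have cv: "compose M g h x = ?s (?t x)" if "x \<in> M" for x
      using that unfolding st_eq[symmetric] by simp
    have "[\<rho> (lift (compose M g h)) i' j' = \<rho> (?s \<circ> ?t) i' j'] (mod int p)"
      using lift(2)[OF cG] cv zsM ij' by (intro \<rho>_cong lift(1) cG Gam_comp sG tG) auto
    also have "[\<rho> (?s \<circ> ?t) i' j' = (\<Sum>l=i'..j'. \<rho> ?s i' l * \<rho> ?t l j')] (mod int p)"
      using ij' by (intro \<rho>_comp sG tG) auto
    also have "(\<Sum>l=i'..j'. \<rho> ?s i' l * \<rho> ?t l j') =
      \<rho> ?s i' i' * \<rho> ?t i' j' + \<rho> ?s i' j' * \<rho> ?t j' j' + (\<Sum>l=Suc i'..<j'. \<rho> ?s i' l * \<rho> ?t l j')"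
    proof -
      have "{i'..j'} = insert i' (insert j' {Suc i'..<j'})" using ij'(1) by auto
      then show ?thesis using ij'(1) by simp
    qed
    also have "[\<dots> = 1 * \<rho> ?t i' j' + \<rho> ?s i' j' * 1 + (\<Sum>l=Suc i'..<j'. \<rho> ?s i' l * \<rho> ?t l j')] (mod int p)"
      using ij' by (intro cong_add cong_mult cong_refl \<rho>_diag sG tG) auto
    finally have main: "[\<rho> (lift (compose M g h)) i' j' = \<rho> ?t i' j' + \<rho> ?s i' j' + (\<Sum>l=Suc i'..<j'. \<rho> ?s i' l * \<rho> ?t l j')] (mod int p)"
      by simp
    have "[delta1 (compose M) (a i j) g h = - \<rho> ?t i' j' - - \<rho> (lift (compose M g h)) i' j' + - \<rho> ?s i' j'] (mod int p)"
      unfolding delta1_def i'_def j'_def by (intro cong_add cong_diff a_cong)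
    also have "- \<rho> ?t i' j' - - \<rho> (lift (compose M g h)) i' j' + - \<rho> ?s i' j'
       = \<rho> (lift (compose M g h)) i' j' - (\<rho> ?t i' j' + \<rho> ?s i' j')" by simp
    also have "[\<dots> = (\<rho> ?t i' j' + \<rho> ?s i' j' + (\<Sum>l=Suc i'..<j'. \<rho> ?s i' l * \<rho> ?t l j')) - (\<rho> ?t i' j' + \<rho> ?s i' j')] (mod int p)"
      by (intro cong_diff main cong_refl)
    also have "(\<rho> ?t i' j' + \<rho> ?s i' j' + (\<Sum>l=Suc i'..<j'. \<rho> ?s i' l * \<rho> ?t l j')) - (\<rho> ?t i' j' + \<rho> ?s i' j')
       = (\<Sum>l=Suc i'..<j'. \<rho> ?s i' l * \<rho> ?t l j')" by simp
    also have "\<dots> = (\<Sum>l=i + 1..j - 1. (- \<rho> ?s i' (l - 1)) * (- \<rho> ?t (l - 1) j'))"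
      by (rule sum.reindex_bij_witness[of _ "\<lambda>l. l - 1" Suc]) (use ij' in auto)
    also have "[\<dots> = (\<Sum>l=i + 1..j - 1. cup11 (a i l) (a l j) g h)] (mod int p)"
      unfolding cup11_def i'_def j'_def by (intro cong_sum cong_mult cong_sym[OF a_cong])
    finally show ?thesis .
  qed
  have "defining_system p (gal E K) ?T n (\<lambda>_. chi) a"
    unfolding defining_system_def mult
  proof (intro allI impI conjI ballI; elim conjE)
    fix i j assume ij: "1 \<le> i" "i < j" "j \<le> n + 1"
    show "cochain1 p ?T (a i j)" by (rule a_cochain[OF ij])
    show "a i j s = chi s" if "j = i + 1" "s \<in> ?G" for s using a_super[of i s] ij that by simp
    show "(delta1 (compose M) (a i j) s t - (\<Sum>l=i + 1..j - 1. cup11 (a i l) (a l j) s t)) mod int p = 0"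
      if "s \<in> ?G" "t \<in> ?G" for s t
      using a_eq[OF ij that] by (simp add: cong_iff_dvd_diff mod_eq_0_iff_dvd)
  qed
  moreover have "massey_value_zero p (gal E K) ?T n a"
    unfolding massey_value_zero_def mult
  proof (intro exI[of _ "a 1 (n + 1)"] conjI ballI)
    show "cochain1 p ?T (a 1 (n + 1))" using assms(2) by (intro a_cochain) auto
    fix s t assume st: "s \<in> ?G" "t \<in> ?G"
    have "[delta1 (compose M) (a 1 (n + 1)) s t = (\<Sum>l=1 + 1..n + 1 - 1. cup11 (a 1 l) (a l (n + 1)) s t)] (mod int p)"
      using assms(2) by (intro a_eq st) auto
    then have "[(\<Sum>l=2..n. cup11 (a 1 l) (a l (n + 1)) s t) = delta1 (compose M) (a 1 (n + 1)) s t] (mod int p)"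
      by (simp add: cong_sym numeral_2_eq_2)
    then show "((\<Sum>k=2..n. cup11 (a 1 k) (a k (n + 1)) s t) - delta1 (compose M) (a 1 (n + 1)) s t) mod int p = 0"
      by (simp add: cong_iff_dvd_diff mod_eq_0_iff_dvd)
  qed
  ultimately show ?thesis unfolding massey_contains_zero_def by blast
qed

end
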